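(* Let $V_1,V_2:\mathbb{R}\to\mathbb{R}$ be measurable functions such that: (C1) $V_1$ is bounded from below, symmetric ($V_1(x)=V_1(-x)$ for all $x$), $\lim_{|x|\to\infty}V_1(x)=+\infty$, and $\int_\mathbb{R} e^{-2V_1(x)}\,dx<\infty$; (C2) $V_2$ is bounded from below, $\sup_{|x|\le\gamma}V_2(x)<\infty$ for some $\gamma>0$, and $\int_\mathbb{R}|x|\,e^{-V_2(x)}\,dx<\infty$. For $N\in\mathbb{N}$ and $\varepsilon\ge 0$ define the partition function $$\mathcal{Z}_{\varepsilon,N}=\int_{\mathbb{R}^{N-1}} e^{-\mathcal{H}_{[-1,N+1]}(\varphi)}\prod_{i=1}^{N-1}\big(\varepsilon\,\delta_0(d\varphi_i)+d\varphi_i\big),$$ where $\mathcal{H}_{[-1,N+1]}(\varphi)=\sum_{i=1}^{N+1}V_1(\nabla\varphi_i)+\sum_{i=0}^{N}V_2(\Delta\varphi_i)$, $\nabla\varphi_i=\varphi_i-\varphi_{i-1}$, $\Delta\varphi_i=\varphi_{i+1}+\varphi_{i-1}-2\varphi_i$, with boundary conditions $\varphi_{-1}=\varphi_0=\varphi_N=\varphi_{N+1}=0$, $\delta_0$ the Dirac mass at $0$ and $d\varphi_i$ Lebesgue measure. Let $F(\varepsilon)=\lim_{N\to\infty}\frac1N\log\big(\mathcal{Z}_{\varepsilon,N}/\mathcal{Z}_{0,N}\big)$ (this limit exists). Then $F(\varepsilon)>0$ for every $\varepsilon>0$; equivalently, the critical value $\varepsilon_c:=\sup\{\varepsilon\ge0: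 F(\varepsilon)=0\}$ equals $0$.
   Context: $F$ is the free energy of the pinning model $\mathbb{P}_{\varepsilon,N}(d\varphi_1,\dots,d\varphi_{N-1})=\mathcal{Z}_{\varepsilon,N}^{-1}e^{-\mathcal{H}_{[-1,N+1]}(\varphi)}\prod_{i=1}^{N-1}(\varepsilon\delta_0(d\varphi_i)+d\varphi_i)$; $F$ is non-decreasing in $\varepsilon$ with $F(0)=0$. *)

theory Defs
  imports "HOL-Analysis.Analysis"
begin

definition pin_measure :: "real \<Rightarrow> real measure" where
  "pin_measure \<epsilon> = measure_of UNIV (sets borel)
      (\<lambda>A. ennreal \<epsilon> * indicator A 0 + emeasure lborel A)"

definition ext_field :: "nat \<Rightarrow> (int \<Rightarrow> real) \<Rightarrow> int \<Rightarrow> real" where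
  "ext_field N \<phi> i = (if 1 \<le> i \<and> i \<le> int N - 1 then \<phi> i else 0)"

definition hamiltonian ::
    "(real \<Rightarrow> real) \<Rightarrow> (real \<Rightarrow> real) \<Rightarrow> nat \<Rightarrow> (int \<Rightarrow> real) \<Rightarrow> real" where
  "hamiltonian V1 V2 N \<phi> =
     (let \<psi> = ext_field N \<phi> in
        (\<Sum>i\<in>{1..int N + 1}. V1 (\<psi> i - \<psi> (i - 1)))
      + (\<Sum>i\<in>{0..int N}. V2 (\<psi> (i + 1) + \<psi> (i - 1) - 2 * \<psi> i)))"

definition partition_fn ::
    "(real \<Rightarrow> real) \<Rightarrow> (real \<Rightarrow> real) \<Rightarrow> real \<Rightarrow> nat \<Rightarrow> ennreal" where
  "partition_fn V1 V2 \<epsilon> N =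
     (\<integral>\<^sup>+ \<phi>. ennreal (exp (- hamiltonian V1 V2 N \<phi>))
        \<partial>(PiM {1..int N - 1} (\<lambda>_. pin_measure \<epsilon>)))"

definition free_energy_N ::
    "(real \<Rightarrow> real) \<Rightarrow> (real \<Rightarrow> real) \<Rightarrow> real \<Rightarrow> nat \<Rightarrow> real" where
  "free_energy_N V1 V2 \<epsilon> N =
     ln (enn2real (partition_fn V1 V2 \<epsilon> N) / enn2real (partition_fn V1 V2 0 N)) / real N"

end

theory Submission
  imports Defs
begin

text \<open>
  Under the free measure the increments of the field form a Markov chain with kernel
  \<open>k x y = exp (- V\<^sub>1 y - V\<^sub>2 (y - x))\<close>, and the partition function at \<open>\<epsilon> = 0\<close> is the weight of paths from
  \<open>0\<close> to \<open>0\<close> whose sum returns to \<open>0\<close>. Since \<open>V\<^sub>1 \<longrightarrow> \<infinity>\<close>, the kernel is small outside a compact set,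
  on which it satisfies a Doeblin condition; hence the weight of all paths of length \<open>n\<close> is of exact
  order \<open>\<lambda>\<^sup>n\<close>, and by integrability of \<open>|x| exp (- V\<^sub>2 x)\<close> the mean absolute height is \<open>O(n)\<close>. Reversal
  combined with reflection is a symmetry of the chain, so by Cauchy--Schwarz two halves of a path
  meet with probability at least \<open>c / n\<close>: the partition function at \<open>\<epsilon> = 0\<close> lies between
  \<open>c \<lambda>\<^sup>n / n\<close> and \<open>C \<lambda>\<^sup>n\<close>. Keeping only double contacts with the wall gives a renewal inequality
  for the pinned model, and since \<open>\<Sum> 1 / n\<close> diverges, its growth rate exceeds \<open>\<lambda>\<close> for every
  \<open>\<epsilon> > 0\<close>.
\<close>

text \<open>A contact fixes the height but not the increment, and the Laplacian couples three
  neighbouring heights, so one contact does not decouple the field. Two consecutive contacts return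
  the state (height, increment) to its starting value (0, 0); hence contacts are used in pairs, at
  the price \<epsilon>^2. No eigenfunction of the kernel is constructed. The rate \<open>lam\<close>
  is the Fekete limit for paths whose end increments lie in \<open>A\<close> =
  [-\<gamma>/2, \<gamma>/2]: \<open>V2\<close> is known to be bounded above only on
  [-\<gamma>, \<gamma>], so this is where two paths can be joined at a fixed cost \<open>g\<close>.
  Larger compact sets are crossed by chains of short moves, and a recursion that loses a factor 1/2
  against \<open>lam\<close> gives the exact order. No local limit theorem is used either: a height
  of order n meets O(n) slabs, so Cauchy-Schwarz yields only 1/n, which is just enough for
  divergence. It gives a return to an interval; one further increment, smeared by its Lebesgue
  density, turns this into a return to the point 0.\<close>

text \<open>Fekete's lemma. The threshold \<open>p\<close> admits logarithms of weights whose first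
  terms are not known to be positive. The bound at every single \<open>n\<close> is needed later as
  well as the limit.\<close>

lemma superadditive_limit:
  fixes a :: "nat \<Rightarrow> real"
  assumes p: "p \<ge> 1"
    and super: "\<And>m n. m \<ge> p \<Longrightarrow> n \<ge> p \<Longrightarrow> a m + a n \<le> a (m + n)"
    and upper: "\<And>n. n \<ge> p \<Longrightarrow> a n \<le> C * real n"
  shows "\<exists>l. (\<lambda>n. a n / real n) \<longlonglongrightarrow> l \<and> (\<forall>n\<ge>p. a n \<le> l * real n)"
proof -
  define l where "l = (SUP n\<in>{p..}. a n / real n)"
  have bdd: "bdd_above ((\<lambda>n. a n / real n) ` {p..})"
    using upper p by (intro bdd_aboveI[of _ C]) (auto simp: divide_le_eq)
  have le_l: "a n / real n \<le> l" if "n \<ge> p" for n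
    unfolding l_def using that by (intro cSUP_upper bdd) auto
  \<comment> \<open>By superadditivity \<open>a n - real n * t\<close> does not decrease when
    \<open>n\<close> grows by \<open>m\<close>, so its values on the block of length
    \<open>m\<close> starting at \<open>p\<close> bound it from below.\<close>
  have low: "\<exists>B. \<forall>n\<ge>p. a n - real n * (a m / real m) \<ge> - B" if m: "m \<ge> p" for m
  proof -
    define t where "t = a m / real m"
    have mt: "a m = real m * t" using m p by (simp add: t_def)
    define B where "B = Max ((\<lambda>r. \<bar>a r - real r * t\<bar>) ` {p..<p+m})"
    have "a n - real n * t \<ge> - B" if "n \<ge> p" for n
      using that
    proof (induction n rule: less_induct)
      case (less n)
      show ?case
      proof (cases "n < p + m")
        case True
        then have "\<bar>a n - real n * t\<bar> \<le> B"
          unfolding B_def using less.prems by (intro Max_ge) auto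
        then show ?thesis by linarith
      next
        case False
        then have "a (n - m) - real (n - m) * t \<ge> - B" using m p by (intro less.IH) auto
        moreover have "a (n - m) + a m \<le> a (n - m + m)" using False m by (intro super) auto
        ultimately show ?thesis using False mt by (simp add: of_nat_diff algebra_simps)
      qed
    qed
    then show ?thesis unfolding t_def by blast
  qed
  have "(\<lambda>n. a n / real n) \<longlonglongrightarrow> l"
  proof (rule order_tendstoI)
    fix u assume "u < l"
    then obtain m where m: "m \<ge> p" "u < a m / real m"
      unfolding l_def using less_cSUP_iff[OF _ bdd, of u] by auto
    obtain B where B: "\<And>n. n \<ge> p \<Longrightarrow> a n - real n * (a m / real m) \<ge> - B" using low[OF m(1)] by blast
    have "(\<lambda>n. a m / real m - B / real n) \<longlonglongrightarrow> a m / real m - 0"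
      by (intro tendsto_intros tendsto_divide_0[OF tendsto_const] filterlim_real_sequentially
          filterlim_at_top_imp_at_infinity)
    then have "\<forall>\<^sub>F n in sequentially. u < a m / real m - B / real n"
      using m(2) by (intro order_tendstoD) auto
    then show "\<forall>\<^sub>F n in sequentially. u < a n / real n"
      using eventually_ge_at_top[of p]
    proof eventually_elim
      case (elim n)
      have "(real n * (a m / real m) - B) / real n \<le> a n / real n"
        using B[OF elim(2)] by (intro divide_right_mono) auto
      moreover have "(real n * (a m / real m) - B) / real n = a m / real m - B / real n"
        using elim p by (simp add: diff_divide_distrib)
      ultimately have "a m / real m - B / real n \<le> a n / real n" by simp
      then show ?case using elim by linarith
    qed
  next
    fix u assume "l < u"
    then show "\<forall>\<^sub>F n in sequentially. a n / real n < u"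
      using eventually_ge_at_top[of p] by (elim eventually_mono) (use le_l in fastforce)
  qed
  then show ?thesis using le_l p by (intro exI[of _ l]) (auto simp: divide_le_eq)
qed

section \<open>Lebesgue measure with an atom at the origin\<close>

lemma sets_pin_measure [measurable_cong, simp]: "sets (pin_measure \<epsilon>) = sets borel"
  using sets.sigma_sets_eq[of "borel :: real measure"] by (simp add: pin_measure_def)

lemma emeasure_pin_measure:
  assumes "A \<in> sets borel"
  shows "emeasure (pin_measure \<epsilon>) A = ennreal \<epsilon> * indicator A 0 + emeasure lborel A"
proof (rule emeasure_measure_of[OF pin_measure_def])
  show "countably_additive (sets (pin_measure \<epsilon>)) (\<lambda>A. ennreal \<epsilon> * indicator A 0 + emeasure lborel A)"
  proof (rule countably_additiveI)
    fix A :: "nat \<Rightarrow> real set"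
    assume A: "range A \<subseteq> sets (pin_measure \<epsilon>)" "disjoint_family A"
    have "(\<Sum>i. indicator (A i) 0) = (indicator (\<Union>i. A i) 0 :: ennreal)"
      using A(2) by (rule suminf_indicator)
    moreover have "(\<Sum>i. emeasure lborel (A i)) = emeasure lborel (\<Union>i. A i)"
      using A by (intro suminf_emeasure) auto
    ultimately show "(\<Sum>i. ennreal \<epsilon> * indicator (A i) 0 + emeasure lborel (A i))
      = ennreal \<epsilon> * indicator (\<Union>i. A i) 0 + emeasure lborel (\<Union>i. A i)"
      by (simp add: suminf_add[symmetric])
  qed
qed (use assms in \<open>auto simp: positive_def\<close>)

lemma nn_integral_pin_measure:
  assumes [measurable]: "f \<in> borel_measurable borel"
  shows "(\<integral>\<^sup>+x. f x \<partial>pin_measure \<epsilon>) = ennreal \<epsilon> * f 0 + (\<integral>\<^sup>+x. f x \<partial>lborel)"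
  using assms
proof (induction f rule: borel_measurable_induct)
  case (cong f g)
  then show ?case by (simp cong: nn_integral_cong)
next
  case (set A)
  then show ?case by (simp add: emeasure_pin_measure)
next
  case (mult u c)
  then show ?case by (simp add: nn_integral_cmult algebra_simps measurable_cong_sets[OF sets_pin_measure refl])
next
  case (add u v)
  then show ?case by (simp add: nn_integral_add algebra_simps measurable_cong_sets[OF sets_pin_measure refl])
next
  case (seq U)
  have m: "U i \<in> borel_measurable lborel" "U i \<in> borel_measurable (pin_measure \<epsilon>)" for i
    using seq by (auto simp: measurable_cong_sets[OF sets_pin_measure refl])
  have "(\<integral>\<^sup>+x. (SUP i. U i) x \<partial>pin_measure \<epsilon>) = (SUP i. ennreal \<epsilon> * U i 0 + (\<integral>\<^sup>+x. U i x \<partial>lborel))"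
    using seq m by (simp add: nn_integral_monotone_convergence_SUP image_comp)
  also have "\<dots> = (SUP i. ennreal \<epsilon> * U i 0) + (SUP i. \<integral>\<^sup>+x. U i x \<partial>lborel)"
    using seq by (intro ennreal_SUP_add)
      (auto simp: mono_def incseq_def le_fun_def intro!: mult_left_mono nn_integral_mono)
  finally show ?case
    using seq m by (simp add: nn_integral_monotone_convergence_SUP image_comp SUP_mult_left_ennreal)
qed

lemma sigma_finite_pin_measure: "sigma_finite_measure (pin_measure \<epsilon>)"
proof
  show "\<exists>A. countable A \<and> A \<subseteq> sets (pin_measure \<epsilon>) \<and> \<Union> A = space (pin_measure \<epsilon>) \<and>
      (\<forall>a\<in>A. emeasure (pin_measure \<epsilon>) a \<noteq> \<infinity>)"
  proof (intro exI[of _ "range (\<lambda>n::nat. {- real n..real n})"] conjI)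
    have "\<exists>n::nat. x \<in> {- real n..real n}" for x :: real
      using real_arch_simple[of "\<bar>x\<bar>"] by (force simp: abs_le_iff)
    then show "\<Union> (range (\<lambda>n::nat. {- real n..real n})) = space (pin_measure \<epsilon>)"
      using sets_eq_imp_space_eq[OF sets_pin_measure] by fastforce
  qed (auto simp: emeasure_pin_measure ennreal_mult_eq_top_iff)
qed

lemma nn_integral_translate:
  fixes f :: "real \<Rightarrow> ennreal"
  assumes [measurable]: "f \<in> borel_measurable borel"
  shows "(\<integral>\<^sup>+x. f (s + x) \<partial>lborel) = (\<integral>\<^sup>+x. f x \<partial>lborel)"
  using nn_integral_real_affine[of f 1 s] by simp

lemma nn_integral_reflect:
  fixes f :: "real \<Rightarrow> ennreal"
  assumes [measurable]: "f \<in> borel_measurable borel"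
  shows "(\<integral>\<^sup>+x. f (- x) \<partial>lborel) = (\<integral>\<^sup>+x. f x \<partial>lborel)"
  using nn_integral_real_affine[of f "-1" 0] by simp

section \<open>Transfer operators for the partition function\<close>

locale pinning =
  fixes V1 V2 :: "real \<Rightarrow> real" and v1 v2 \<gamma> G :: real
  assumes V1_measurable [measurable]: "V1 \<in> borel_measurable borel"
    and V2_measurable [measurable]: "V2 \<in> borel_measurable borel"
    and V1_ge: "v1 \<le> V1 x"
    and V2_ge: "v2 \<le> V2 x"
    and V1_minus: "V1 (- x) = V1 x"
    and V1_lim: "filterlim V1 at_top at_infinity"
    and \<gamma>_pos: "\<gamma> > 0"
    and V2_le: "\<bar>x\<bar> \<le> \<gamma> \<Longrightarrow> V2 x \<le> G"
    and V2_int: "integrable lborel (\<lambda>x. \<bar>x\<bar> * exp (- V2 x))"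
begin

text \<open>Functions of two variables take the height \<^term>\<open>s\<close> of the field and its current
  increment \<^term>\<open>x\<close>. One step integrates the next height over Lebesgue measure (\<open>KK\<close>) or pins it
  to \<open>0\<close> (\<open>PP\<close>); \<open>fin\<close> is the weight of the two final steps to the boundary
  values \<open>\<phi>\<^sub>N = \<phi>\<^sub>N\<^sub>+\<^sub>1 = 0\<close>.\<close>

definition k :: "real \<Rightarrow> real \<Rightarrow> ennreal" where
  "k x y = ennreal (exp (- V1 y - V2 (y - x)))"

definition KK :: "(real \<Rightarrow> real \<Rightarrow> ennreal) \<Rightarrow> real \<Rightarrow> real \<Rightarrow> ennreal" where
  "KK F s x = (\<integral>\<^sup>+y. k x y * F (s + y) y \<partial>lborel)"

definition PP :: "(real \<Rightarrow> real \<Rightarrow> ennreal) \<Rightarrow> real \<Rightarrow> real \<Rightarrow> ennreal" where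
  "PP F s x = k x (- s) * F 0 (- s)"

definition TT :: "real \<Rightarrow> (real \<Rightarrow> real \<Rightarrow> ennreal) \<Rightarrow> real \<Rightarrow> real \<Rightarrow> ennreal" where
  "TT \<epsilon> F s x = ennreal \<epsilon> * PP F s x + KK F s x"

definition fin :: "real \<Rightarrow> real \<Rightarrow> ennreal" where
  "fin s x = k x (- s) * k (- s) 0"

lemma k_measurable [measurable]: "case_prod k \<in> borel_measurable (borel \<Otimes>\<^sub>M borel)"
  unfolding k_def case_prod_beta by measurable

lemma fin_measurable [measurable]: "case_prod fin \<in> borel_measurable (borel \<Otimes>\<^sub>M borel)"
  unfolding fin_def case_prod_beta by measurable

lemma KK_measurable [measurable]:
  assumes [measurable]: "case_prod F \<in> borel_measurable (borel \<Otimes>\<^sub>M borel)"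
  shows "case_prod (KK F) \<in> borel_measurable (borel \<Otimes>\<^sub>M borel)"
  unfolding KK_def case_prod_beta by measurable

lemma PP_measurable [measurable]:
  assumes [measurable]: "case_prod F \<in> borel_measurable (borel \<Otimes>\<^sub>M borel)"
  shows "case_prod (PP F) \<in> borel_measurable (borel \<Otimes>\<^sub>M borel)"
  unfolding PP_def case_prod_beta by measurable

lemma TT_measurable [measurable]:
  assumes [measurable]: "case_prod F \<in> borel_measurable (borel \<Otimes>\<^sub>M borel)"
  shows "case_prod (TT \<epsilon> F) \<in> borel_measurable (borel \<Otimes>\<^sub>M borel)"
  unfolding TT_def case_prod_beta by measurable

lemma TT_0: "TT 0 = KK"
  by (simp add: TT_def fun_eq_iff)

lemma TT_eq_nn_integral_pin_measure:
  assumes [measurable]: "case_prod F \<in> borel_measurable (borel \<Otimes>\<^sub>M borel)"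
  shows "(\<integral>\<^sup>+c. k x (c - s) * F c (c - s) \<partial>pin_measure \<epsilon>) = TT \<epsilon> F s x"
proof -
  have "(\<integral>\<^sup>+c. k x (c - s) * F c (c - s) \<partial>pin_measure \<epsilon>)
      = ennreal \<epsilon> * PP F s x + (\<integral>\<^sup>+c. k x (c - s) * F c (c - s) \<partial>lborel)"
    by (subst nn_integral_pin_measure) (auto simp: PP_def)
  also have "(\<integral>\<^sup>+c. k x (c - s) * F c (c - s) \<partial>lborel) = KK F s x"
    using nn_integral_translate[of "\<lambda>c. k x (c - s) * F c (c - s)" s] by (simp add: KK_def)
  finally show ?thesis by (simp add: TT_def)
qed

lemma ext_field_measurable [measurable]:
  "(\<lambda>\<phi>. ext_field (Suc n) \<phi> i) \<in> borel_measurable (PiM {1..int n} (\<lambda>_. pin_measure \<epsilon>))"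
proof (cases "1 \<le> i \<and> i \<le> int n")
  case True
  then have "(\<lambda>\<phi>. \<phi> i) \<in> measurable (PiM {1..int n} (\<lambda>_. pin_measure \<epsilon>)) (pin_measure \<epsilon>)"
    by (intro measurable_component_singleton) auto
  then show ?thesis using True by (simp add: ext_field_def measurable_cong_sets[OF refl sets_pin_measure])
qed (auto simp: ext_field_def)

text \<open>The last height is integrated out first, which turns the end function \<open>F\<close>
  into \<open>TT \<epsilon> F\<close>; hence the induction runs over all \<open>F\<close>. The
  starting point 0, 0 encodes the boundary values at -1 and 0.\<close>

lemma TT_funpow_eq_nn_integral_PiM:
  assumes "case_prod F \<in> borel_measurable (borel \<Otimes>\<^sub>M borel)"
  shows "(\<integral>\<^sup>+\<phi>. (let \<psi> = ext_field (Suc n) \<phi> in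
      (\<Prod>i<n. k (\<psi> (int i) - \<psi> (int i - 1)) (\<psi> (int i + 1) - \<psi> (int i)))
        * F (\<psi> (int n)) (\<psi> (int n) - \<psi> (int n - 1))) \<partial>PiM {1..int n} (\<lambda>_. pin_measure \<epsilon>))
    = (TT \<epsilon> ^^ n) F 0 0"
  using assms
proof (induction n arbitrary: F)
  case 0
  interpret product_sigma_finite "\<lambda>_::int. pin_measure \<epsilon>"
    by (simp add: product_sigma_finite_def sigma_finite_pin_measure)
  show ?case by (simp add: Let_def ext_field_def PiM_empty nn_integral_count_space_finite)
next
  case (Suc n)
  note [measurable] = Suc.prems
  interpret product_sigma_finite "\<lambda>_::int. pin_measure \<epsilon>"
    by (simp add: product_sigma_finite_def sigma_finite_pin_measure)
  let ?p = "\<lambda>m \<phi>. \<Prod>i<m. k (ext_field (Suc m) \<phi> (int i) - ext_field (Suc m) \<phi> (int i - 1))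
      (ext_field (Suc m) \<phi> (int i + 1) - ext_field (Suc m) \<phi> (int i))"
  let ?f = "\<lambda>m F \<phi>. ?p m \<phi> * F (ext_field (Suc m) \<phi> (int m))
      (ext_field (Suc m) \<phi> (int m) - ext_field (Suc m) \<phi> (int m - 1))"
  have ins: "{1..int (Suc n)} = insert (int n + 1) {1..int n}" by auto
  have upd: "ext_field (Suc (Suc n)) (\<phi>(int n + 1 := c)) i = ext_field (Suc n) \<phi> i"
    if "i \<le> int n" for i \<phi> c
    using that by (auto simp: ext_field_def)
  have upd': "ext_field (Suc (Suc n)) (\<phi>(int n + 1 := c)) (int n + 1) = c" for \<phi> c
    by (auto simp: ext_field_def)
  have step: "?f (Suc n) F (\<phi>(int n + 1 := c)) = ?p n \<phi> *
      (k (ext_field (Suc n) \<phi> (int n) - ext_field (Suc n) \<phi> (int n - 1)) (c - ext_field (Suc n) \<phi> (int n))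
        * F c (c - ext_field (Suc n) \<phi> (int n)))" for \<phi> c
  proof -
    have "?p (Suc n) (\<phi>(int n + 1 := c)) = ?p n \<phi> *
      k (ext_field (Suc n) \<phi> (int n) - ext_field (Suc n) \<phi> (int n - 1)) (c - ext_field (Suc n) \<phi> (int n))"
      unfolding prod.lessThan_Suc
      by (intro arg_cong2[where f="(*)"] prod.cong) (simp_all add: upd upd')
    then show ?thesis by (simp add: upd upd' mult.assoc add.commute[of 1])
  qed
  have meas: "?f (Suc n) F \<in> borel_measurable (PiM {1..int (Suc n)} (\<lambda>_. pin_measure \<epsilon>))"
    by measurable
  have "(\<integral>\<^sup>+\<phi>. ?f (Suc n) F \<phi> \<partial>PiM {1..int (Suc n)} (\<lambda>_. pin_measure \<epsilon>))
      = (\<integral>\<^sup>+\<phi>. (\<integral>\<^sup>+c. ?f (Suc n) F (\<phi>(int n + 1 := c)) \<partial>pin_measure \<epsilon>) \<partial>PiM {1..int n} (\<lambda>_. pin_measure \<epsilon>))"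
    using meas unfolding ins by (intro product_nn_integral_insert) auto
  also have "\<dots> = (\<integral>\<^sup>+\<phi>. ?f n (TT \<epsilon> F) \<phi> \<partial>PiM {1..int n} (\<lambda>_. pin_measure \<epsilon>))"
    unfolding step
    by (intro nn_integral_cong, subst nn_integral_cmult)
       (auto simp: TT_eq_nn_integral_pin_measure measurable_cong_sets[OF sets_pin_measure refl])
  also have "\<dots> = (TT \<epsilon> ^^ n) (TT \<epsilon> F) 0 0"
    using Suc.IH[of "TT \<epsilon> F"] by (simp add: Let_def)
  finally show ?case by (simp only: Let_def funpow_Suc_right comp_apply)
qed

text \<open>Pairing the gradient term at \<open>i + 1\<close> with the Laplacian term at
  \<open>i\<close> splits the Gibbs weight into \<open>n + 2\<close> kernel factors; the last two
  involve the boundary zeros and form \<open>fin\<close>.\<close>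

lemma partition_fn_eq: "partition_fn V1 V2 \<epsilon> (Suc n) = (TT \<epsilon> ^^ n) fin 0 0"
proof -
  have "ennreal (exp (- hamiltonian V1 V2 (Suc n) \<phi>)) = (let \<psi> = ext_field (Suc n) \<phi> in
      (\<Prod>i<n. k (\<psi> (int i) - \<psi> (int i - 1)) (\<psi> (int i + 1) - \<psi> (int i)))
        * fin (\<psi> (int n)) (\<psi> (int n) - \<psi> (int n - 1)))" for \<phi>
  proof -
    define \<psi> where "\<psi> = ext_field (Suc n) \<phi>"
    let ?a = "\<lambda>i. V1 (\<psi> (i + 1) - \<psi> i) + V2 (\<psi> (i + 1) + \<psi> (i - 1) - 2 * \<psi> i)"
    have 0: "\<psi> (int n + 1) = 0" "\<psi> (int n + 2) = 0" "\<psi> (2 + int n) = 0" "\<psi> (1 + int n) = 0"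
      by (auto simp: \<psi>_def ext_field_def)
    have "(\<Sum>i\<in>{1..int (Suc n) + 1}. V1 (\<psi> i - \<psi> (i - 1)))
        = (\<Sum>i<Suc (Suc n). V1 (\<psi> (int i + 1) - \<psi> (int i)))"
      by (rule sum.reindex_bij_witness[of _ "\<lambda>i. int i + 1" "\<lambda>i. nat (i - 1)"]) auto
    moreover have "(\<Sum>i\<in>{0..int (Suc n)}. V2 (\<psi> (i + 1) + \<psi> (i - 1) - 2 * \<psi> i))
        = (\<Sum>i<Suc (Suc n). V2 (\<psi> (int i + 1) + \<psi> (int i - 1) - 2 * \<psi> (int i)))"
      by (rule sum.reindex_bij_witness[of _ "\<lambda>i. int i" "\<lambda>i. nat i"]) auto
    ultimately have "hamiltonian V1 V2 (Suc n) \<phi> = (\<Sum>i<Suc (Suc n). ?a (int i))"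
      by (simp only: hamiltonian_def Let_def \<psi>_def[symmetric] sum.distrib)
    then have "ennreal (exp (- hamiltonian V1 V2 (Suc n) \<phi>)) = (\<Prod>i<Suc (Suc n). ennreal (exp (- ?a (int i))))"
      by (simp only: sum_negf[symmetric] exp_sum[OF finite_lessThan] prod_ennreal exp_ge_zero)
    also have "\<dots> = (\<Prod>i<Suc (Suc n). k (\<psi> (int i) - \<psi> (int i - 1)) (\<psi> (int i + 1) - \<psi> (int i)))"
      by (intro prod.cong refl) (simp add: k_def algebra_simps)
    also have "\<dots> = (\<Prod>i<n. k (\<psi> (int i) - \<psi> (int i - 1)) (\<psi> (int i + 1) - \<psi> (int i)))
        * fin (\<psi> (int n)) (\<psi> (int n) - \<psi> (int n - 1))"
      by (simp add: fin_def 0 algebra_simps)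
    finally show ?thesis by (simp add: \<psi>_def Let_def)
  qed
  then show ?thesis
    unfolding partition_fn_def using TT_funpow_eq_nn_integral_PiM[of fin n \<epsilon>] by simp
qed


section \<open>Site weight, interaction, and the set on which paths are joined\<close>

definition e1 :: "real \<Rightarrow> ennreal" where "e1 y = ennreal (exp (- V1 y))"
definition q :: "real \<Rightarrow> real \<Rightarrow> ennreal" where "q x y = ennreal (exp (- V2 (y - x)))"
text \<open>The half width is \<gamma>/2 so that any two points of \<open>A\<close> differ by at
  most \<gamma> and interact with weight at least \<open>g\<close>; the symmetry of \<open>A\<close>
  makes it compatible with reflection.\<close>

definition A :: "real set" where "A = {- (\<gamma> / 2)..\<gamma> / 2}"
abbreviation iA :: "real \<Rightarrow> ennreal" where "iA \<equiv> indicator A"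
definition g :: ennreal where "g = ennreal (exp (- G))"

lemma e1_measurable [measurable]: "e1 \<in> borel_measurable borel"
  unfolding e1_def by measurable

lemma q_measurable [measurable]: "case_prod q \<in> borel_measurable (borel \<Otimes>\<^sub>M borel)"
  unfolding q_def case_prod_beta by measurable

lemma A_measurable [measurable]: "A \<in> sets borel"
  by (simp add: A_def)

lemma k_eq: "k x y = e1 y * q x y"
  by (simp add: k_def e1_def q_def ennreal_mult[symmetric] exp_add[symmetric])

lemma e1_minus: "e1 (- x) = e1 x"
  by (simp add: e1_def V1_minus)

lemma q_minus: "q (- y) (- x) = q x y"
  by (simp add: q_def)

lemma A_minus: "iA (- x) = iA x"
  by (auto simp: A_def indicator_def)

lemma g_le_q: "\<bar>y - x\<bar> \<le> \<gamma> \<Longrightarrow> g \<le> q x y"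
  unfolding g_def q_def using V2_le[of "y - x"] by simp

lemma g_le_k: "x \<in> A \<Longrightarrow> g * (e1 y * iA y) \<le> k x y"
  using g_le_q[of y x] by (auto simp: A_def indicator_def k_eq mult.commute[of g] intro!: mult_left_mono)

subsection \<open>Iterated kernels\<close>

text \<open>Instances of this serve as local rules of the measurability prover for curried functions
  of three arguments.\<close>

lemma measurable_triple_compose:
  fixes F :: "real \<Rightarrow> real \<Rightarrow> real \<Rightarrow> ennreal"
  assumes "(\<lambda>(t, s, x). F t s x) \<in> borel_measurable (borel \<Otimes>\<^sub>M borel \<Otimes>\<^sub>M borel)"
    and "a \<in> borel_measurable M" "b \<in> borel_measurable M" "c \<in> borel_measurable M"
  shows "(\<lambda>p. F (a p) (b p) (c p)) \<in> borel_measurable M"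
proof -
  have "(\<lambda>p. (a p, b p, c p)) \<in> measurable M (borel \<Otimes>\<^sub>M borel \<Otimes>\<^sub>M borel)"
    using assms(2-) by measurable
  from measurable_compose[OF this assms(1)] show ?thesis by simp
qed

text \<open>The parameter \<open>t\<close> plays the first increment in path functionals and a
  height shift in \<open>nu_shift_measurable\<close>.\<close>

lemma KK_funpow_measurable_param:
  fixes F :: "real \<Rightarrow> real \<Rightarrow> real \<Rightarrow> ennreal"
  assumes "(\<lambda>(t, s, x). F t s x) \<in> borel_measurable (borel \<Otimes>\<^sub>M borel \<Otimes>\<^sub>M borel)"
  shows "(\<lambda>(t, s, x). (KK ^^ n) (F t) s x) \<in> borel_measurable (borel \<Otimes>\<^sub>M borel \<Otimes>\<^sub>M borel)"
proof (induction n)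
  case (Suc n)
  note [measurable (raw)] = measurable_triple_compose[OF Suc]
  have "(\<lambda>p. KK ((KK ^^ n) (F (fst p))) (fst (snd p)) (snd (snd p)))
      \<in> borel_measurable (borel \<Otimes>\<^sub>M borel \<Otimes>\<^sub>M borel)"
    unfolding KK_def[of "(KK ^^ n) (F _)"] by measurable
  then show ?case by (simp add: case_prod_beta)
qed (use assms in simp)

lemma KK_funpow_measurable [measurable]:
  assumes [measurable]: "case_prod F \<in> borel_measurable (borel \<Otimes>\<^sub>M borel)"
  shows "case_prod ((KK ^^ n) F) \<in> borel_measurable (borel \<Otimes>\<^sub>M borel)"
  by (induction n) auto

lemma KK_mono: "(\<And>s y. F s y \<le> F' s y) \<Longrightarrow> KK F s x \<le> KK F' s x"
  unfolding KK_def by (intro nn_integral_mono mult_left_mono) auto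

lemma KK_funpow_mono: "(\<And>s y. F s y \<le> F' s y) \<Longrightarrow> (KK ^^ n) F s x \<le> (KK ^^ n) F' s x"
  by (induction n arbitrary: s x) (auto intro: KK_mono)

lemma KK_funpow_cmult:
  assumes [measurable]: "case_prod F \<in> borel_measurable (borel \<Otimes>\<^sub>M borel)"
  shows "(KK ^^ n) (\<lambda>s y. c * F s y) = (\<lambda>s x. c * (KK ^^ n) F s x)"
proof (induction n)
  case (Suc n)
  show ?case
    by (intro ext, simp only: funpow.simps comp_apply Suc KK_def[of "\<lambda>s y. c * _ s y"] KK_def[of "(KK ^^ n) F"])
      (simp add: nn_integral_cmult[symmetric] mult.left_commute)
qed simp

lemma KK_funpow_add:
  assumes [measurable]: "case_prod F \<in> borel_measurable (borel \<Otimes>\<^sub>M borel)"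
    "case_prod F' \<in> borel_measurable (borel \<Otimes>\<^sub>M borel)"
  shows "(KK ^^ n) (\<lambda>s y. F s y + F' s y) = (\<lambda>s x. (KK ^^ n) F s x + (KK ^^ n) F' s x)"
proof (induction n)
  case (Suc n)
  show ?case
    by (intro ext, simp only: funpow.simps comp_apply Suc KK_def[of "\<lambda>s y. _ s y + _ s y"]
        KK_def[of "(KK ^^ n) F"] KK_def[of "(KK ^^ n) F'"])
      (simp add: nn_integral_add[symmetric] distrib_left)
qed simp

text \<open>The increments evolve without seeing the height, which enters only through
  \<open>F\<close>.\<close>

lemma KK_funpow_translate: "(KK ^^ n) F (a + s) x = (KK ^^ n) (\<lambda>s. F (a + s)) s x"
proof (induction n arbitrary: s x)
  case (Suc n)
  have "KK ((KK ^^ n) F) (a + s) x = KK ((KK ^^ n) (\<lambda>s. F (a + s))) s x"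
    unfolding KK_def[of "(KK ^^ n) _"] by (simp add: Suc[symmetric] add.assoc)
  then show ?case by simp
qed simp

subsection \<open>Path functionals\<close>

text \<open>In \<open>pth n \<Phi>\<close> the arguments of \<open>\<Phi>\<close> are the first increment, the sum of all \<open>n + 1\<close> increments
  and the last increment of a path.\<close>

definition pth :: "nat \<Rightarrow> (real \<Rightarrow> real \<Rightarrow> real \<Rightarrow> ennreal) \<Rightarrow> ennreal" where
  "pth n \<Phi> = (\<integral>\<^sup>+x. e1 x * (KK ^^ n) (\<Phi> x) x x \<partial>lborel)"

text \<open>Counterpart of \<open>KK\<close> at the front of a path: it integrates out an increment
  \<open>z\<close> placed before the first increment \<open>x\<close>. The weight
  \<open>e1 x\<close> is left to \<open>pth\<close>.\<close>

definition Fr :: "(real \<Rightarrow> real \<Rightarrow> real \<Rightarrow> ennreal) \<Rightarrow> real \<Rightarrow> real \<Rightarrow> real \<Rightarrow> ennreal" where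
  "Fr \<Phi> x s y = (\<integral>\<^sup>+z. e1 z * q z x * \<Phi> z (s + z) y \<partial>lborel)"

lemma Fr_measurable:
  assumes "(\<lambda>(x, s, y). \<Phi> x s y) \<in> borel_measurable (borel \<Otimes>\<^sub>M borel \<Otimes>\<^sub>M borel)"
  shows "(\<lambda>(x, s, y). Fr \<Phi> x s y) \<in> borel_measurable (borel \<Otimes>\<^sub>M borel \<Otimes>\<^sub>M borel)"
proof -
  note [measurable (raw)] = measurable_triple_compose[OF assms]
  have "(\<lambda>p. Fr \<Phi> (fst p) (fst (snd p)) (snd (snd p)))
      \<in> borel_measurable (borel \<Otimes>\<^sub>M borel \<Otimes>\<^sub>M borel)"
    unfolding Fr_def by measurable
  then show ?thesis by (simp add: case_prod_beta)
qed

lemma pth_Suc_back: "pth (Suc n) \<Phi> = pth n (\<lambda>x. KK (\<Phi> x))"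
  by (simp add: pth_def funpow_swap1)

text \<open>By Fubini, removing an increment at the front commutes with removing one at the back, so
  the induction can go on at the back.\<close>

lemma pth_Suc_front:
  assumes "(\<lambda>(x, s, y). \<Phi> x s y) \<in> borel_measurable (borel \<Otimes>\<^sub>M borel \<Otimes>\<^sub>M borel)"
  shows "pth (Suc n) \<Phi> = pth n (Fr \<Phi>)"
  using assms
proof (induction n arbitrary: \<Phi>)
  case 0
  note [measurable (raw)] = measurable_triple_compose[OF 0]
  have "pth (Suc 0) \<Phi> = (\<integral>\<^sup>+x. \<integral>\<^sup>+z. e1 x * (e1 z * q x z * \<Phi> x (x + z) z) \<partial>lborel \<partial>lborel)"
    by (simp add: pth_def KK_def k_eq nn_integral_cmult)
  also have "\<dots> = (\<integral>\<^sup>+z. \<integral>\<^sup>+x. e1 x * (e1 z * q x z * \<Phi> x (x + z) z) \<partial>lborel \<partial>lborel)"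
    by (rule lborel_pair.Fubini') measurable
  also have "\<dots> = pth 0 (Fr \<Phi>)"
    by (simp add: pth_def Fr_def nn_integral_cmult[symmetric] algebra_simps)
  finally show ?case .
next
  case (Suc n)
  note [measurable (raw)] = measurable_triple_compose[OF Suc.prems]
  have "Fr (\<lambda>x. KK (\<Phi> x)) x s y = KK (Fr \<Phi> x) s y" for x s y
  proof -
    have "Fr (\<lambda>x. KK (\<Phi> x)) x s y
        = (\<integral>\<^sup>+z. \<integral>\<^sup>+w. e1 z * q z x * (k y w * \<Phi> z (s + z + w) w) \<partial>lborel \<partial>lborel)"
      by (simp add: Fr_def KK_def nn_integral_cmult)
    also have "\<dots> = (\<integral>\<^sup>+w. \<integral>\<^sup>+z. e1 z * q z x * (k y w * \<Phi> z (s + z + w) w) \<partial>lborel \<partial>lborel)"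
      by (rule lborel_pair.Fubini') measurable
    also have "\<dots> = KK (Fr \<Phi> x) s y"
      by (simp add: Fr_def KK_def nn_integral_cmult[symmetric] algebra_simps)
    finally show ?thesis .
  qed
  then have eq: "Fr (\<lambda>x. KK (\<Phi> x)) = (\<lambda>x. KK (Fr \<Phi> x))" by (intro ext)
  have "(\<lambda>(x, s, y). KK (\<Phi> x) s y) \<in> borel_measurable (borel \<Otimes>\<^sub>M borel \<Otimes>\<^sub>M borel)"
    using KK_funpow_measurable_param[OF Suc.prems, of 1] by simp
  then have "pth (Suc n) (\<lambda>x. KK (\<Phi> x)) = pth n (Fr (\<lambda>x. KK (\<Phi> x)))"
    by (rule Suc.IH)
  then show ?case
    by (simp only: pth_Suc_back eq)
qed

text \<open>The map (x_0, ..., x_n) to (-x_n, ..., -x_0) keeps every difference x_(i+1) - x_i, and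
  \<open>V1\<close> is even. Reflection or reversal alone would turn \<open>q x y\<close> into
  \<open>q y x\<close>. In the induction a step removed at the back of one path is a step removed at
  the front of its image.\<close>

lemma pth_reverse:
  assumes "(\<lambda>(x, s, y). \<Phi> x s y) \<in> borel_measurable (borel \<Otimes>\<^sub>M borel \<Otimes>\<^sub>M borel)"
  shows "pth n (\<lambda>x s y. \<Phi> (- y) (- s) (- x)) = pth n \<Phi>"
  using assms
proof (induction n arbitrary: \<Phi>)
  case 0
  note [measurable (raw)] = measurable_triple_compose[OF 0]
  show ?case
    using nn_integral_reflect[of "\<lambda>x. e1 x * \<Phi> x x x"] by (simp add: pth_def e1_minus)
next
  case (Suc n)
  note [measurable (raw)] = measurable_triple_compose[OF Suc.prems]
  have "KK (\<lambda>s y. \<Phi> (- y) (- s) (- x)) s y = Fr \<Phi> (- y) (- s) (- x)" for x s y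
    using nn_integral_reflect[of "\<lambda>z. e1 z * q z (- y) * \<Phi> z (- s + z) (- x)"]
    by (simp add: KK_def Fr_def k_eq e1_minus q_minus)
  then have "(\<lambda>x. KK (\<lambda>s y. \<Phi> (- y) (- s) (- x))) = (\<lambda>x s y. Fr \<Phi> (- y) (- s) (- x))"
    by (intro ext)
  then show ?case
    using Suc.IH[OF Fr_measurable[OF Suc.prems]] pth_Suc_front[OF Suc.prems]
    by (simp add: pth_Suc_back)
qed

text \<open>The law of the height after \<open>n + 1\<close> increments, unnormalised. Restricting
  both end increments to \<open>A\<close> makes paths joinable at cost \<open>g\<close> and keeps
  the reversal symmetry.\<close>

definition nu :: "nat \<Rightarrow> (real \<Rightarrow> ennreal) \<Rightarrow> ennreal" where
  "nu n f = pth n (\<lambda>x s y. iA x * (f s * iA y))"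

lemma nu_eq:
  assumes [measurable]: "f \<in> borel_measurable borel"
  shows "nu n f = (\<integral>\<^sup>+x. e1 x * iA x * (KK ^^ n) (\<lambda>s y. f s * iA y) x x \<partial>lborel)"
  unfolding nu_def pth_def by (subst KK_funpow_cmult) (simp_all add: mult.assoc)

lemma nu_mono: "(\<And>s. f s \<le> f' s) \<Longrightarrow> nu n f \<le> nu n f'"
  unfolding nu_def pth_def
  by (intro nn_integral_mono mult_left_mono KK_funpow_mono mult_right_mono) auto

lemma nu_cmult:
  assumes [measurable]: "f \<in> borel_measurable borel"
  shows "nu n (\<lambda>s. c * f s) = c * nu n f"
proof -
  have "(KK ^^ n) (\<lambda>s y. c * f s * iA y) = (\<lambda>s x. c * (KK ^^ n) (\<lambda>s y. f s * iA y) s x)"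
    using KK_funpow_cmult[of "\<lambda>s y. f s * iA y" n c] by (simp add: mult.assoc)
  then show ?thesis
    by (simp add: nu_eq nn_integral_cmult[symmetric] algebra_simps)
qed

lemma nu_add:
  assumes [measurable]: "f \<in> borel_measurable borel" "f' \<in> borel_measurable borel"
  shows "nu n (\<lambda>s. f s + f' s) = nu n f + nu n f'"
proof -
  have "(KK ^^ n) (\<lambda>s y. (f s + f' s) * iA y)
      = (\<lambda>s x. (KK ^^ n) (\<lambda>s y. f s * iA y) s x + (KK ^^ n) (\<lambda>s y. f' s * iA y) s x)"
    using KK_funpow_add[of "\<lambda>s y. f s * iA y" "\<lambda>s y. f' s * iA y" n] by (simp add: distrib_right)
  then show ?thesis
    by (simp add: nu_eq nn_integral_add[symmetric] algebra_simps)
qed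

lemma nu_sum:
  assumes "finite I" and [measurable]: "\<And>i. i \<in> I \<Longrightarrow> f i \<in> borel_measurable borel"
  shows "nu n (\<lambda>s. \<Sum>i\<in>I. f i s) = (\<Sum>i\<in>I. nu n (f i))"
  using assms
proof (induction I rule: finite_induct)
  case empty
  show ?case using nu_cmult[of "\<lambda>_. 0" n 0] by simp
next
  case (insert i I)
  then show ?case by (simp add: nu_add)
qed

text \<open>Reversal swaps the two end conditions, which are the same symmetric set, and changes the
  sign of the height.\<close>

lemma nu_minus:
  assumes [measurable]: "f \<in> borel_measurable borel"
  shows "nu n (\<lambda>s. f (- s)) = nu n f"
  using pth_reverse[of "\<lambda>x s y. iA x * (f s * iA y)" n]
  by (simp add: nu_def A_minus mult_ac)

lemma nu_shift_measurable [measurable]: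
  assumes [measurable]: "f \<in> borel_measurable borel"
  shows "(\<lambda>s. nu n (\<lambda>s'. f (s + s'))) \<in> borel_measurable borel"
proof -
  have "(\<lambda>(t, s, x). (KK ^^ n) (\<lambda>s y. f (t + s) * iA y) s x)
      \<in> borel_measurable (borel \<Otimes>\<^sub>M borel \<Otimes>\<^sub>M borel)"
    by (rule KK_funpow_measurable_param) measurable
  note [measurable (raw)] = measurable_triple_compose[OF this]
  show ?thesis by (simp add: nu_eq)
qed

text \<open>The increments on either side of the joint both lie in \<open>A\<close>, so their
  interaction is at least \<open>g\<close>. Together there are (n + 1) + (j + 1) increments, whence
  the index \<open>n + Suc j\<close>.\<close>

lemma nu_concat:
  assumes [measurable]: "f \<in> borel_measurable borel"
  shows "g * nu n (\<lambda>s. nu j (\<lambda>s'. f (s + s'))) \<le> nu (n + Suc j) f"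
proof -
  let ?F = "\<lambda>s y. f s * iA y"
  have 1: "g * nu j (\<lambda>s'. f (s + s')) * iA y \<le> KK ((KK ^^ j) ?F) s y" for s y
  proof (cases "y \<in> A")
    case True
    have "g * nu j (\<lambda>s'. f (s + s'))
        = (\<integral>\<^sup>+z. g * (e1 z * iA z) * (KK ^^ j) ?F (s + z) z \<partial>lborel)"
      by (simp add: nu_eq KK_funpow_translate nn_integral_cmult[symmetric] mult.assoc)
    also have "\<dots> \<le> KK ((KK ^^ j) ?F) s y"
      unfolding KK_def by (intro nn_integral_mono mult_right_mono g_le_k True) auto
    finally show ?thesis using True by simp
  qed simp
  have "g * nu n (\<lambda>s. nu j (\<lambda>s'. f (s + s'))) = nu n (\<lambda>s. g * nu j (\<lambda>s'. f (s + s')))"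
    by (simp add: nu_cmult)
  also have "\<dots> \<le> (\<integral>\<^sup>+x. e1 x * iA x * (KK ^^ n) (KK ((KK ^^ j) ?F)) x x \<partial>lborel)"
    by (subst nu_eq) (auto intro!: nn_integral_mono mult_left_mono KK_funpow_mono 1)
  also have "\<dots> = nu (n + Suc j) f"
    by (simp add: nu_eq funpow_add funpow_swap1)
  finally show ?thesis .
qed

text \<open>Adds one increment in \<open>A\<close> at the front. Its integral stands inside
  \<open>nu n\<close>, so that \<open>f\<close> is averaged against the density \<open>e1\<close> on
  \<open>A\<close>; this is the smoothing used for returns to a point.\<close>

lemma nu_front:
  assumes [measurable]: "f \<in> borel_measurable borel"
  shows "g * nu n (\<lambda>s. \<integral>\<^sup>+z. e1 z * iA z * f (s + z) \<partial>lborel) \<le> nu (Suc n) f"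
proof -
  let ?h = "\<lambda>s. \<integral>\<^sup>+z. e1 z * iA z * f (s + z) \<partial>lborel"
  have le: "iA x * (g * ?h s * iA y) \<le> Fr (\<lambda>x s y. iA x * (f s * iA y)) x s y" for x s y
  proof (cases "x \<in> A")
    case True
    have "g * (e1 z * iA z * (f (s + z) * iA y)) \<le> e1 z * q z x * (iA z * (f (s + z) * iA y))" for z
    proof (cases "z \<in> A")
      case z: True
      then have "g \<le> q z x" using g_le_q[of x z] True by (auto simp: A_def)
      from mult_right_mono[OF this, of "e1 z * (iA z * (f (s + z) * iA y))"] show ?thesis
        by (simp add: mult_ac)
    qed simp
    then have "(\<integral>\<^sup>+z. g * (e1 z * iA z * (f (s + z) * iA y)) \<partial>lborel)
        \<le> Fr (\<lambda>x s y. iA x * (f s * iA y)) x s y"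
      unfolding Fr_def by (intro nn_integral_mono)
    moreover have "(\<integral>\<^sup>+z. g * (e1 z * iA z * (f (s + z) * iA y)) \<partial>lborel) = g * ?h s * iA y"
      by (simp add: nn_integral_cmult nn_integral_multc[symmetric] mult.assoc)
    ultimately show ?thesis using True by simp
  qed simp
  have "g * nu n ?h = nu n (\<lambda>s. g * ?h s)"
    by (simp add: nu_cmult)
  also have "\<dots> \<le> pth n (Fr (\<lambda>x s y. iA x * (f s * iA y)))"
    unfolding nu_def pth_def by (intro nn_integral_mono mult_left_mono KK_funpow_mono le) auto
  also have "\<dots> = nu (Suc n) f"
    unfolding nu_def by (rule pth_Suc_front[symmetric]) measurable
  finally show ?thesis .
qed

end

lemma finite_positive_lower_bound:
  fixes f :: "'a \<Rightarrow> real"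
  assumes "finite I" "\<And>i. i \<in> I \<Longrightarrow> f i > 0"
  shows "\<exists>c>0. \<forall>i\<in>I. c \<le> f i"
proof (cases "I = {}")
  case False
  then show ?thesis using assms by (intro exI[of _ "Min (f ` I)"]) auto
qed (auto intro: exI[of _ 1])

context pinning
begin

section \<open>The chain of increments without the height\<close>

definition K :: "(real \<Rightarrow> ennreal) \<Rightarrow> real \<Rightarrow> ennreal" where
  "K f x = (\<integral>\<^sup>+y. k x y * f y \<partial>lborel)"

lemma KK_funpow_const: "(KK ^^ n) (\<lambda>s. f) = (\<lambda>s. (K ^^ n) f)"
  by (induction n) (auto simp: KK_def K_def)

lemma K_measurable [measurable]:
  assumes [measurable]: "f \<in> borel_measurable borel"
  shows "K f \<in> borel_measurable borel"
  unfolding K_def[of f] by measurable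

lemma K_funpow_measurable [measurable]:
  "f \<in> borel_measurable borel \<Longrightarrow> (K ^^ n) f \<in> borel_measurable borel"
  by (induction n) auto

lemma K_mono: "(\<And>y. f y \<le> f' y) \<Longrightarrow> K f x \<le> K f' x"
  unfolding K_def by (intro nn_integral_mono mult_left_mono) auto

lemma K_funpow_mono: "(\<And>y. f y \<le> f' y) \<Longrightarrow> (K ^^ n) f x \<le> (K ^^ n) f' x"
  by (induction n arbitrary: x) (auto intro: K_mono)

lemma K_cmult: "f \<in> borel_measurable borel \<Longrightarrow> K (\<lambda>y. c * f y) x = c * K f x"
  by (simp add: K_def nn_integral_cmult[symmetric] mult.left_commute)

lemma K_add:
  "f \<in> borel_measurable borel \<Longrightarrow> f' \<in> borel_measurable borel \<Longrightarrow>
    K (\<lambda>y. f y + f' y) x = K f x + K f' x"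
  by (simp add: K_def nn_integral_add[symmetric] distrib_left)

lemma K_sum:
  assumes "\<And>i. i \<in> I \<Longrightarrow> f i \<in> borel_measurable borel"
  shows "K (\<lambda>y. \<Sum>i\<in>I. f i y) x = (\<Sum>i\<in>I. K (f i) x)"
  using assms unfolding K_def by (simp add: sum_distrib_left nn_integral_sum)

lemma K_funpow_cmult:
  "f \<in> borel_measurable borel \<Longrightarrow> (K ^^ n) (\<lambda>y. c * f y) = (\<lambda>x. c * (K ^^ n) f x)"
  by (induction n) (auto simp: K_cmult)

lemma K_funpow_add:
  "f \<in> borel_measurable borel \<Longrightarrow> f' \<in> borel_measurable borel \<Longrightarrow>
    (K ^^ n) (\<lambda>y. f y + f' y) = (\<lambda>x. (K ^^ n) f x + (K ^^ n) f' x)"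
  by (induction n) (auto simp: K_add)

subsection \<open>Bounds on the weights\<close>

definition c1 :: real where "c1 = exp (- v1)"
definition c2 :: real where "c2 = exp (- v2)"
definition C0 :: real where "C0 = enn2real (\<integral>\<^sup>+u. ennreal (exp (- V2 u)) \<partial>lborel)"
definition C1 :: real where "C1 = enn2real (\<integral>\<^sup>+u. ennreal (\<bar>u\<bar> * exp (- V2 u)) \<partial>lborel)"
definition mA :: real where "mA = enn2real (\<integral>\<^sup>+x. e1 x * iA x \<partial>lborel)"

lemma e1_le: "e1 y \<le> ennreal c1"
  unfolding e1_def c1_def using V1_ge[of y] by (intro ennreal_leI) simp

lemma q_le: "q x y \<le> ennreal c2"
  unfolding q_def c2_def using V2_ge[of "y - x"] by (intro ennreal_leI) simp

lemma c1_pos: "c1 > 0" and c2_pos: "c2 > 0"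
  by (auto simp: c1_def c2_def)

lemma ennreal_C1: "(\<integral>\<^sup>+u. ennreal (\<bar>u\<bar> * exp (- V2 u)) \<partial>lborel) = ennreal C1"
  using V2_int unfolding C1_def integrable_iff_bounded by (simp add: abs_mult)

text \<open>Finite because \<open>exp (- V2 u)\<close> is at most \<open>c2\<close> on [-1, 1] and
  at most \<open>\<bar>u\<bar> * exp (- V2 u)\<close> elsewhere.\<close>

lemma ennreal_C0: "(\<integral>\<^sup>+u. ennreal (exp (- V2 u)) \<partial>lborel) = ennreal C0"
proof -
  have "ennreal (exp (- V2 u)) \<le> ennreal c2 * indicator {-1..1} u + ennreal (\<bar>u\<bar> * exp (- V2 u))" for u
  proof (cases "\<bar>u\<bar> \<le> 1")
    case True
    have "ennreal (exp (- V2 u)) \<le> ennreal c2"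
      unfolding c2_def using V2_ge[of u] by (intro ennreal_leI) simp
    then show ?thesis using True by (simp add: indicator_def abs_le_iff add_increasing2)
  next
    case False
    then show ?thesis by (auto intro!: add_increasing ennreal_leI)
  qed
  then have "(\<integral>\<^sup>+u. ennreal (exp (- V2 u)) \<partial>lborel)
      \<le> (\<integral>\<^sup>+u. ennreal c2 * indicator {-1..1} u + ennreal (\<bar>u\<bar> * exp (- V2 u)) \<partial>lborel)"
    by (intro nn_integral_mono)
  also have "\<dots> = ennreal c2 * 2 + ennreal C1"
    by (simp add: nn_integral_add nn_integral_cmult ennreal_C1)
  also have "\<dots> < \<infinity>" by (simp add: ennreal_mult_less_top)
  finally show ?thesis by (simp add: C0_def)
qed

lemma C0_nonneg: "C0 \<ge> 0" and C1_nonneg: "C1 \<ge> 0"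
  by (auto simp: C0_def C1_def)

lemma nn_integral_q: "(\<integral>\<^sup>+y. q x y \<partial>lborel) = ennreal C0"
  using nn_integral_translate[of "\<lambda>y. ennreal (exp (- V2 y))" "- x"]
  by (simp add: q_def ennreal_C0 algebra_simps)

lemma nn_integral_abs_q: "(\<integral>\<^sup>+y. ennreal \<bar>y\<bar> * q x y \<partial>lborel) \<le> ennreal (C1 + \<bar>x\<bar> * C0)"
proof -
  have "(\<integral>\<^sup>+y. ennreal \<bar>y\<bar> * q x y \<partial>lborel)
      \<le> (\<integral>\<^sup>+y. ennreal (\<bar>y - x\<bar> * exp (- V2 (y - x))) + ennreal \<bar>x\<bar> * q x y \<partial>lborel)"
  proof (intro nn_integral_mono)
    fix y
    have "\<bar>y\<bar> * exp (- V2 (y - x)) \<le> (\<bar>y - x\<bar> + \<bar>x\<bar>) * exp (- V2 (y - x))"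
      by (intro mult_right_mono) auto
    then show "ennreal \<bar>y\<bar> * q x y \<le> ennreal (\<bar>y - x\<bar> * exp (- V2 (y - x))) + ennreal \<bar>x\<bar> * q x y"
      unfolding q_def by (simp add: ennreal_mult[symmetric] ennreal_plus[symmetric] distrib_right
          del: ennreal_plus)
  qed
  also have "\<dots> = ennreal C1 + ennreal \<bar>x\<bar> * ennreal C0"
    using nn_integral_translate[of "\<lambda>y. ennreal (\<bar>y\<bar> * exp (- V2 y))" "- x"]
    by (simp add: nn_integral_add nn_integral_cmult nn_integral_q ennreal_C1)
  also have "\<dots> = ennreal (C1 + \<bar>x\<bar> * C0)"
    using C0_nonneg C1_nonneg by (simp add: ennreal_mult[symmetric])
  finally show ?thesis .
qed

lemma nn_integral_e1_interval:
  assumes "a < b"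
  shows "(\<integral>\<^sup>+x. e1 x * indicator {a..b} x \<partial>lborel) > 0"
    and "(\<integral>\<^sup>+x. e1 x * indicator {a..b} x \<partial>lborel) < \<infinity>"
proof -
  have "(\<integral>\<^sup>+x. e1 x * indicator {a..b} x \<partial>lborel) \<noteq> 0"
  proof
    assume "(\<integral>\<^sup>+x. e1 x * indicator {a..b} x \<partial>lborel) = 0"
    then have "AE x in lborel. e1 x * indicator {a..b} x = 0"
      by (subst (asm) nn_integral_0_iff_AE) auto
    then have "AE x in lborel. x \<notin> {a..b}"
      by (elim eventually_mono) (auto simp: e1_def indicator_def split: if_splits)
    then have "emeasure lborel {a..b} = 0"
      by (subst (asm) AE_iff_measurable[of "{a..b}"]) auto
    then show False using assms by simp
  qed
  then show "(\<integral>\<^sup>+x. e1 x * indicator {a..b} x \<partial>lborel) > 0"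
    by (simp add: zero_less_iff_neq_zero)
  have "(\<integral>\<^sup>+x. e1 x * indicator {a..b} x \<partial>lborel) \<le> (\<integral>\<^sup>+x. ennreal c1 * indicator {a..b} x \<partial>lborel)"
    by (intro nn_integral_mono mult_right_mono e1_le) auto
  also have "\<dots> < \<infinity>"
    using assms by (simp add: nn_integral_cmult ennreal_mult_less_top)
  finally show "(\<integral>\<^sup>+x. e1 x * indicator {a..b} x \<partial>lborel) < \<infinity>" .
qed

lemma ennreal_mA: "(\<integral>\<^sup>+x. e1 x * iA x \<partial>lborel) = ennreal mA" and mA_pos: "mA > 0"
  using nn_integral_e1_interval[of "- (\<gamma> / 2)" "\<gamma> / 2"] \<gamma>_pos
  by (auto simp: mA_def A_def enn2real_positive_iff)

lemma K_1_le: "K (\<lambda>_. 1) x \<le> ennreal (c1 * C0)"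
proof -
  have "K (\<lambda>_. 1) x \<le> (\<integral>\<^sup>+y. ennreal c1 * q x y \<partial>lborel)"
    unfolding K_def k_eq by (intro nn_integral_mono) (auto intro!: mult_right_mono e1_le)
  then show ?thesis
    using c1_pos C0_nonneg by (simp add: nn_integral_cmult nn_integral_q ennreal_mult[symmetric])
qed

text \<open>Submultiplicativity of the supremum norms of the iterates, for a positive kernel applied
  to the constant 1.\<close>

lemma K_funpow_bounded_power:
  assumes "t \<ge> 0" "\<And>x. (K ^^ n) (\<lambda>_. 1) x \<le> ennreal t"
  shows "(K ^^ (n * j)) (\<lambda>_. 1) x \<le> ennreal (t ^ j)"
proof (induction j arbitrary: x)
  case (Suc j)
  have "(K ^^ (n * Suc j)) (\<lambda>_. 1) x = (K ^^ n) ((K ^^ (n * j)) (\<lambda>_. 1)) x"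
    by (simp add: funpow_add)
  also have "\<dots> \<le> (K ^^ n) (\<lambda>_. ennreal (t ^ j) * 1) x"
    using Suc by (intro K_funpow_mono) simp
  also have "\<dots> = ennreal (t ^ j) * (K ^^ n) (\<lambda>_. 1) x"
    by (subst K_funpow_cmult) auto
  also have "\<dots> \<le> ennreal (t ^ j) * ennreal t"
    by (intro mult_left_mono assms) auto
  finally show ?case using assms(1) by (simp add: ennreal_mult[symmetric] mult.commute)
qed simp

text \<open>Inside [-L, L] the interaction is replaced by its maximum \<open>c2\<close>, which makes
  the bound independent of \<open>x\<close>; outside, the small site weight is taken out and the
  interaction integrates to \<open>C0\<close>.\<close>

lemma K_split_le:
  assumes [measurable]: "f \<in> borel_measurable borel"
    and "\<eta> \<ge> 0" "\<And>y. L < \<bar>y\<bar> \<Longrightarrow> exp (- V1 y) \<le> \<eta>" "\<And>y. f y \<le> B"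
  shows "K f x \<le> ennreal c2 * (\<integral>\<^sup>+y. e1 y * indicator {-L..L} y * f y \<partial>lborel) + ennreal (\<eta> * C0) * B"
proof -
  have "K f x \<le> (\<integral>\<^sup>+y. ennreal c2 * (e1 y * indicator {-L..L} y * f y) + ennreal \<eta> * q x y * B \<partial>lborel)"
    unfolding K_def k_eq
  proof (intro nn_integral_mono)
    fix y
    show "e1 y * q x y * f y \<le> ennreal c2 * (e1 y * indicator {-L..L} y * f y) + ennreal \<eta> * q x y * B"
    proof (cases "\<bar>y\<bar> \<le> L")
      case True
      have "q x y * (e1 y * f y) \<le> ennreal c2 * (e1 y * f y)"
        by (intro mult_right_mono q_le) auto
      then show ?thesis using True by (auto simp: abs_le_iff mult_ac intro!: add_increasing2)
    next
      case False
      have "e1 y * q x y * f y \<le> ennreal \<eta> * q x y * B"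
        using assms False unfolding e1_def by (intro mult_mono ennreal_leI) auto
      then show ?thesis by (auto intro!: add_increasing)
    qed
  qed
  also have "\<dots> = ennreal c2 * (\<integral>\<^sup>+y. e1 y * indicator {-L..L} y * f y \<partial>lborel) + ennreal (\<eta> * C0) * B"
    using assms(2) C0_nonneg
    by (simp add: nn_integral_add nn_integral_cmult nn_integral_multc nn_integral_q ennreal_mult)
  finally show ?thesis .
qed

lemma K_outside_le:
  assumes "\<eta> \<ge> 0" "\<And>y. L < \<bar>y\<bar> \<Longrightarrow> exp (- V1 y) \<le> \<eta>"
  shows "K (\<lambda>y. indicator (- {-L..L}) y) x \<le> ennreal (\<eta> * C0)"
proof -
  have "K (\<lambda>y. indicator (- {-L..L}) y) x \<le> ennreal c2 * (\<integral>\<^sup>+y. e1 y * indicator {-L..L} y * indicator (- {-L..L}) y \<partial>lborel) + ennreal (\<eta> * C0) * 1"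
    by (rule K_split_le[OF _ assms]) (auto simp: indicator_def)
  also have "(\<lambda>y. e1 y * indicator {-L..L} y * indicator (- {-L..L}) y) = (\<lambda>y. 0)"
    by (auto simp: indicator_def)
  finally show ?thesis by simp
qed

text \<open>A drift condition of Foster-Lyapunov type for the increment: the coefficient of
  \<open>\<bar>x\<bar>\<close> becomes small against \<open>lam\<close> once \<open>L\<close> is
  large.\<close>

lemma K_abs_le:
  assumes "\<eta> \<ge> 0" "L \<ge> 0" "\<And>y. L < \<bar>y\<bar> \<Longrightarrow> exp (- V1 y) \<le> \<eta>"
  shows "K (\<lambda>y. ennreal \<bar>y\<bar>) x \<le> ennreal (\<eta> * C0 * \<bar>x\<bar> + (L * c1 * C0 + \<eta> * C1))"
proof -
  have "K (\<lambda>y. ennreal \<bar>y\<bar>) x \<le> (\<integral>\<^sup>+y. ennreal L * (k x y * 1) + ennreal \<eta> * (ennreal \<bar>y\<bar> * q x y) \<partial>lborel)"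
    unfolding K_def
  proof (intro nn_integral_mono)
    fix y
    show "k x y * ennreal \<bar>y\<bar> \<le> ennreal L * (k x y * 1) + ennreal \<eta> * (ennreal \<bar>y\<bar> * q x y)"
    proof (cases "\<bar>y\<bar> \<le> L")
      case True
      have "ennreal \<bar>y\<bar> * k x y \<le> ennreal L * k x y"
        using True by (intro mult_right_mono ennreal_leI) auto
      then show ?thesis by (auto simp: mult_ac intro!: add_increasing2)
    next
      case False
      have "e1 y * (ennreal \<bar>y\<bar> * q x y) \<le> ennreal \<eta> * (ennreal \<bar>y\<bar> * q x y)"
        using assms False unfolding e1_def by (intro mult_right_mono ennreal_leI) auto
      then show ?thesis by (auto simp: k_eq mult_ac intro!: add_increasing)
    qed
  qed
  also have "\<dots> = ennreal L * K (\<lambda>_. 1) x + ennreal \<eta> * (\<integral>\<^sup>+y. ennreal \<bar>y\<bar> * q x y \<partial>lborel)"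
    unfolding K_def by (simp add: nn_integral_add nn_integral_cmult)
  also have "\<dots> \<le> ennreal L * ennreal (c1 * C0) + ennreal \<eta> * ennreal (C1 + \<bar>x\<bar> * C0)"
    by (intro add_mono mult_left_mono K_1_le nn_integral_abs_q) auto
  also have "\<dots> = ennreal (\<eta> * C0 * \<bar>x\<bar> + (L * c1 * C0 + \<eta> * C1))"
    using assms c1_pos C0_nonneg C1_nonneg
    by (simp add: ennreal_mult[symmetric] ennreal_plus[symmetric] algebra_simps del: ennreal_plus)
  finally show ?thesis .
qed

subsection \<open>Communication between compact sets\<close>

text \<open>Intervals of length \<gamma>/2: points of equal or adjacent cells differ by at most
  \<gamma>, so one step between them has interaction at least \<open>g\<close>.\<close>

definition cell :: "int \<Rightarrow> real set" where
  "cell i = {real_of_int i * (\<gamma> / 2)..real_of_int (i + 1) * (\<gamma> / 2)}"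

lemma cell_measurable [measurable]: "cell i \<in> sets borel"
  by (simp add: cell_def)

text \<open>The path is forced through neighbouring cells on its way from \<open>i\<close> to
  \<open>j\<close>: each of the \<open>Suc n\<close> steps costs \<open>g\<close>, and each of the
  \<open>n\<close> intermediate cells contributes mass at least \<mu>.\<close>

lemma K_funpow_cell:
  assumes [measurable]: "f \<in> borel_measurable borel"
    and \<mu>: "\<And>i. i \<in> {- int p..<int p} \<Longrightarrow> \<mu> \<le> (\<integral>\<^sup>+x. e1 x * indicator (cell i) x \<partial>lborel)"
    and "i \<in> {- int p..<int p}" "j \<in> {- int p..<int p}" "\<bar>i - j\<bar> \<le> int n + 1" "x \<in> cell i"
  shows "g ^ Suc n * \<mu> ^ n * (\<integral>\<^sup>+y. e1 y * indicator (cell j) y * f y \<partial>lborel) \<le> (K ^^ Suc n) f x"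
  using assms(3-)
proof (induction n arbitrary: i x)
  have gk: "g * (e1 y * indicator (cell j) y) \<le> k x y"
    if "x \<in> cell i" "\<bar>i - j\<bar> \<le> 1" for i j x y
  proof (cases "y \<in> cell j")
    case True
    have "\<bar>y - x\<bar> \<le> \<gamma>"
    proof -
      have "j = i - 1 \<or> j = i \<or> j = i + 1" using that(2) by linarith
      then show ?thesis using that(1) True by (auto simp: cell_def algebra_simps)
    qed
    then show ?thesis using g_le_q[of y x] True by (simp add: k_eq mult.commute[of g] mult_left_mono)
  qed simp
  {
    case 0
    have "g * (\<integral>\<^sup>+y. e1 y * indicator (cell j) y * f y \<partial>lborel)
        = (\<integral>\<^sup>+y. g * (e1 y * indicator (cell j) y) * f y \<partial>lborel)"
      by (simp add: nn_integral_cmult[symmetric] mult.assoc)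
    also have "\<dots> \<le> K f x"
      unfolding K_def using 0 by (intro nn_integral_mono mult_right_mono gk[of x i]) auto
    finally show ?case by simp
  next
    case (Suc n)
    let ?I = "\<integral>\<^sup>+y. e1 y * indicator (cell j) y * f y \<partial>lborel"
    \<comment> \<open>One cell towards \<open>j\<close>, or no move when \<open>j\<close> is already
      reached; waiting allows every number of steps that is large enough.\<close>
    define i' where "i' = (if i < j then i + 1 else if i > j then i - 1 else i)"
    have i': "i' \<in> {- int p..<int p}" "\<bar>i' - j\<bar> \<le> int n + 1" "\<bar>i - i'\<bar> \<le> 1"
      using Suc.prems by (auto simp: i'_def)
    have "g ^ Suc (Suc n) * \<mu> ^ Suc n * ?I = (g * \<mu>) * (g ^ Suc n * \<mu> ^ n * ?I)"
      by (simp add: mult_ac)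
    also have "\<dots> \<le> (g * (\<integral>\<^sup>+y. e1 y * indicator (cell i') y \<partial>lborel)) * (g ^ Suc n * \<mu> ^ n * ?I)"
      using \<mu>[OF i'(1)] by (intro mult_left_mono mult_right_mono) auto
    also have "\<dots> = (\<integral>\<^sup>+y. g * (e1 y * indicator (cell i') y) * (g ^ Suc n * \<mu> ^ n * ?I) \<partial>lborel)"
      by (simp add: nn_integral_cmult nn_integral_multc)
    also have "\<dots> \<le> K ((K ^^ Suc n) f) x"
      unfolding K_def[of "(K ^^ Suc n) f"]
    proof (intro nn_integral_mono)
      fix y
      show "g * (e1 y * indicator (cell i') y) * (g ^ Suc n * \<mu> ^ n * ?I) \<le> k x y * (K ^^ Suc n) f y"
      proof (cases "y \<in> cell i'")
        case True
        show ?thesis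
          using Suc.IH[OF i'(1) Suc.prems(2) i'(2) True] gk[OF Suc.prems(4) i'(3), of y]
          by (intro mult_mono) auto
      qed simp
    qed
    finally show ?case by simp
  }
qed

text \<open>The Doeblin minorisation. The compact set consists of 2p cells, so 2p steps reach every
  cell from every other.\<close>

lemma K_funpow_compact:
  assumes "p > 0"
  shows "\<exists>c>0. \<forall>f\<in>borel_measurable borel. \<forall>x\<in>{- (real p * (\<gamma> / 2))..real p * (\<gamma> / 2)}.
    ennreal c * (\<integral>\<^sup>+y. e1 y * indicator {- (real p * (\<gamma> / 2))..real p * (\<gamma> / 2)} y * f y \<partial>lborel)
      \<le> (K ^^ (2 * p)) f x"
proof -
  let ?P = "{- int p..<int p}" and ?C = "{- (real p * (\<gamma> / 2))..real p * (\<gamma> / 2)}"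
  define mc where "mc i = enn2real (\<integral>\<^sup>+x. e1 x * indicator (cell i) x \<partial>lborel)" for i
  have mc: "(\<integral>\<^sup>+x. e1 x * indicator (cell i) x \<partial>lborel) = ennreal (mc i)" "mc i > 0" for i
    using nn_integral_e1_interval[of "real_of_int i * (\<gamma> / 2)" "real_of_int (i + 1) * (\<gamma> / 2)"] \<gamma>_pos
    by (auto simp: mc_def cell_def enn2real_positive_iff)
  obtain \<mu> where \<mu>: "\<mu> > 0" "\<And>i. i \<in> ?P \<Longrightarrow> \<mu> \<le> mc i"
    using finite_positive_lower_bound[of ?P mc] mc(2) by auto
  have C: "\<exists>i\<in>?P. x \<in> cell i" if "x \<in> ?C" for x
  proof (cases "x = real p * (\<gamma> / 2)")
    case True
    then show ?thesis using assms \<gamma>_pos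
      by (intro bexI[of _ "int p - 1"]) (auto simp: cell_def field_simps)
  next
    case False
    define i where "i = \<lfloor>x / (\<gamma> / 2)\<rfloor>"
    have i: "real_of_int i \<le> x / (\<gamma> / 2)" "x / (\<gamma> / 2) < real_of_int i + 1"
      by (auto simp: i_def)
    have x: "x / (\<gamma> / 2) < real p" "x / (\<gamma> / 2) \<ge> - real p"
      using that False \<gamma>_pos by (auto simp: field_simps)
    have "i < int p" using i x by linarith
    moreover have "i \<ge> - int p" using i x by linarith
    moreover have "x \<in> cell i" using i \<gamma>_pos by (auto simp: cell_def field_simps)
    ultimately show ?thesis by auto
  qed
  define n where "n = 2 * p - 1"
  have n: "Suc n = 2 * p" using assms by (simp add: n_def)
  \<comment> \<open>The path bound for one target cell, divided by the number 2p of target cells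
    over which it is averaged.\<close>
  define c where "c = exp (- G) ^ Suc n * \<mu> ^ n / real (2 * p)"
  have "c > 0" using \<mu> assms by (simp add: c_def)
  moreover have "ennreal c * (\<integral>\<^sup>+y. e1 y * indicator ?C y * f y \<partial>lborel) \<le> (K ^^ (2 * p)) f x"
    if [measurable]: "f \<in> borel_measurable borel" and x: "x \<in> ?C" for f x
  proof -
    obtain i where i: "i \<in> ?P" "x \<in> cell i" using C[OF x] by auto
    have "(\<integral>\<^sup>+y. e1 y * indicator ?C y * f y \<partial>lborel) \<le> (\<integral>\<^sup>+y. (\<Sum>j\<in>?P. e1 y * indicator (cell j) y * f y) \<partial>lborel)"
    proof (intro nn_integral_mono)
      fix y
      show "e1 y * indicator ?C y * f y \<le> (\<Sum>j\<in>?P. e1 y * indicator (cell j) y * f y)"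
      proof (cases "y \<in> ?C")
        case True
        then obtain j where "j \<in> ?P" "y \<in> cell j" using C by blast
        then show ?thesis using True member_le_sum[of j ?P "\<lambda>j. e1 y * indicator (cell j) y * f y"] by simp
      qed simp
    qed
    also have "\<dots> = (\<Sum>j\<in>?P. \<integral>\<^sup>+y. e1 y * indicator (cell j) y * f y \<partial>lborel)"
      by (rule nn_integral_sum) auto
    finally have "ennreal (exp (- G) ^ Suc n * \<mu> ^ n) * (\<integral>\<^sup>+y. e1 y * indicator ?C y * f y \<partial>lborel)
        \<le> (\<Sum>j\<in>?P. ennreal (exp (- G) ^ Suc n * \<mu> ^ n) * (\<integral>\<^sup>+y. e1 y * indicator (cell j) y * f y \<partial>lborel))"
      by (simp add: sum_distrib_left[symmetric] mult_left_mono)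
    also have "\<dots> \<le> (\<Sum>j\<in>?P. (K ^^ Suc n) f x)"
    proof (intro sum_mono)
      fix j assume j: "j \<in> ?P"
      have "int n + 1 = 2 * int p" using n by linarith
      then have "\<bar>i - j\<bar> \<le> int n + 1" using i(1) j by auto
      with j show "ennreal (exp (- G) ^ Suc n * \<mu> ^ n) * (\<integral>\<^sup>+y. e1 y * indicator (cell j) y * f y \<partial>lborel)
          \<le> (K ^^ Suc n) f x"
        using K_funpow_cell[of f p "ennreal \<mu>" i j n x] i \<mu> n mc(1)
        by (simp add: g_def ennreal_mult ennreal_power ennreal_leI del: power_Suc)
    qed
    also have "\<dots> = of_nat (2 * p) * (K ^^ (2 * p)) f x"
      by (simp add: n nat_mult_distrib)
    finally have le: "ennreal (exp (- G) ^ Suc n * \<mu> ^ n) * (\<integral>\<^sup>+y. e1 y * indicator ?C y * f y \<partial>lborel)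
        \<le> of_nat (2 * p) * (K ^^ (2 * p)) f x" .
    have eq: "ennreal (1 / real (2 * p)) * of_nat (2 * p) = 1"
      using assms by (simp add: ennreal_of_nat_eq_real_of_nat ennreal_mult[symmetric] del: of_nat_mult)
    have "ennreal c * (\<integral>\<^sup>+y. e1 y * indicator ?C y * f y \<partial>lborel)
        = ennreal (1 / real (2 * p)) * (ennreal (exp (- G) ^ Suc n * \<mu> ^ n) * (\<integral>\<^sup>+y. e1 y * indicator ?C y * f y \<partial>lborel))"
      using \<mu>(1) by (simp add: c_def ennreal_mult[symmetric] mult.assoc[symmetric] del: of_nat_mult)
    also have "\<dots> \<le> ennreal (1 / real (2 * p)) * (of_nat (2 * p) * (K ^^ (2 * p)) f x)"
      by (intro mult_left_mono le) auto
    also have "\<dots> = (K ^^ (2 * p)) f x"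
      by (simp only: mult.assoc[symmetric] eq mult_1)
    finally show ?thesis .
  qed
  ultimately show ?thesis by auto
qed


subsection \<open>The growth rate\<close>

definition a :: "nat \<Rightarrow> ennreal" where "a n = nu n (\<lambda>_. 1)"
definition ar :: "nat \<Rightarrow> real" where "ar n = enn2real (a n)"
definition gr :: real where "gr = exp (- G)"
text \<open>Growth rate per increment of paths from \<open>A\<close> to \<open>A\<close>. Since
  \<open>ar (n - 1)\<close> weighs paths of \<open>n\<close> increments,
  \<open>gr * ar (n - 1)\<close> is supermultiplicative for \<open>n\<close> at least 1.\<close>

definition lam :: real where "lam = exp (lim (\<lambda>n. ln (gr * ar (n - 1)) / real n))"

lemma gr_pos: "gr > 0" and g_gr: "g = ennreal gr"
  by (auto simp: gr_def g_def)

lemma a_eq: "a n = (\<integral>\<^sup>+x. e1 x * iA x * (K ^^ n) iA x \<partial>lborel)"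
  by (simp add: a_def nu_eq KK_funpow_const)

lemma a_le:
  assumes "\<And>x. (K ^^ n) (\<lambda>_. 1) x \<le> ennreal t" "t \<ge> 0"
  shows "a n \<le> ennreal (mA * t)"
proof -
  have "a n \<le> (\<integral>\<^sup>+x. e1 x * iA x * ennreal t \<partial>lborel)"
    unfolding a_eq
  proof (intro nn_integral_mono mult_left_mono)
    fix x
    have "(K ^^ n) iA x \<le> (K ^^ n) (\<lambda>_. 1) x" by (intro K_funpow_mono) (auto simp: indicator_def)
    then show "(K ^^ n) iA x \<le> ennreal t" using assms(1) order_trans by blast
  qed auto
  also have "\<dots> = ennreal (mA * t)"
    using assms mA_pos by (simp add: nn_integral_multc ennreal_mA ennreal_mult)
  finally show ?thesis .
qed

lemma a_finite: "a n = ennreal (ar n)" and ar_le: "ar n \<le> mA * (c1 * C0) ^ n"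
proof -
  have "a n \<le> ennreal (mA * (c1 * C0) ^ n)"
    using K_funpow_bounded_power[of "c1 * C0" 1 n] K_1_le c1_pos C0_nonneg by (intro a_le) auto
  then show "a n = ennreal (ar n)" "ar n \<le> mA * (c1 * C0) ^ n"
    using mA_pos c1_pos C0_nonneg
    by (auto simp: ar_def enn2real_leI le_less_trans[OF _ ennreal_less_top])
qed

lemma a_super: "g * (a n * a j) \<le> a (n + Suc j)"
  using nu_concat[of "\<lambda>_. 1" n j] nu_cmult[of "\<lambda>_. 1" n "a j"]
  by (simp add: a_def mult.commute)

lemma ar_nonneg: "ar n \<ge> 0" by (simp add: ar_def)

lemma ar_super: "gr * ar n * ar j \<le> ar (n + Suc j)"
  using a_super[of n j] ar_nonneg gr_pos
  by (simp add: a_finite g_gr ennreal_mult[symmetric] mult.assoc)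

lemma ar_0: "ar 0 = mA"
proof -
  have "a 0 = ennreal mA"
    by (simp add: a_eq ennreal_mA[symmetric] mult.assoc indicator_inter_arith[symmetric])
  then show ?thesis using mA_pos by (simp add: ar_def)
qed

lemma ar_pos: "ar n > 0"
proof (induction n)
  case (Suc n)
  have "0 < gr * ar n * ar 0" using Suc gr_pos mA_pos by (simp add: ar_0)
  also have "\<dots> \<le> ar (n + Suc 0)" by (rule ar_super)
  finally show ?case by simp
qed (simp add: ar_0 mA_pos)

lemma lam_lim: "(\<lambda>n. ln (gr * ar (n - 1)) / real n) \<longlonglongrightarrow> ln lam"
  and ar_le_lam: "gr * ar n \<le> lam ^ Suc n"
proof -
  let ?b = "\<lambda>n. ln (gr * ar (n - 1))"
  \<comment> \<open>Large enough to absorb both the prefactor and the cost per step into the pure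
    power \<open>t ^ n\<close>.\<close>
  define t where "t = max 1 (max (gr * mA) (c1 * C0))"
  have "\<exists>l. (\<lambda>n. ?b n / real n) \<longlonglongrightarrow> l \<and> (\<forall>n\<ge>1. ?b n \<le> l * real n)"
  proof (rule superadditive_limit)
    fix m n :: nat assume mn: "m \<ge> 1" "n \<ge> 1"
    then have "gr * ar (m - 1) * ar (n - 1) \<le> ar (m + n - 1)"
      using ar_super[of "m - 1" "n - 1"] by simp
    then have "(gr * ar (m - 1)) * (gr * ar (n - 1)) \<le> gr * ar (m + n - 1)"
      using gr_pos by (simp add: mult_ac)
    then have "ln ((gr * ar (m - 1)) * (gr * ar (n - 1))) \<le> ln (gr * ar (m + n - 1))"
      using gr_pos ar_pos by (intro ln_mono) auto
    then show "?b m + ?b n \<le> ?b (m + n)"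
      using gr_pos ar_pos by (simp add: ln_mult_pos)
  next
    fix n :: nat assume n: "n \<ge> 1"
    have "gr * ar (n - 1) \<le> gr * mA * (c1 * C0) ^ (n - 1)"
      using ar_le[of "n - 1"] gr_pos by simp
    also have "\<dots> \<le> t * t ^ (n - 1)"
      using gr_pos mA_pos c1_pos C0_nonneg by (intro mult_mono power_mono) (auto simp: t_def)
    also have "\<dots> = t ^ n" using n by (simp add: power_eq_if)
    finally have "gr * ar (n - 1) \<le> t ^ n" .
    then have "?b n \<le> ln (t ^ n)" using gr_pos ar_pos by (intro ln_mono) (auto simp: t_def)
    then show "?b n \<le> ln t * real n"
      by (simp add: ln_realpow t_def mult.commute)
  qed simp
  then obtain l where l: "(\<lambda>n. ?b n / real n) \<longlonglongrightarrow> l" "\<And>n. n \<ge> 1 \<Longrightarrow> ?b n \<le> l * real n" by blast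
  have "lam = exp l" using limI[OF l(1)] by (simp add: lam_def)
  then have lnl: "ln lam = l" "lam > 0" by auto
  show "(\<lambda>n. ?b n / real n) \<longlonglongrightarrow> ln lam" using l lnl by simp
  have "ln (gr * ar n) \<le> ln lam * real (Suc n)" using l(2)[of "Suc n"] lnl by simp
  also have "\<dots> = ln (lam ^ Suc n)" using lnl(2) by (simp add: ln_realpow del: power_Suc)
  finally show "gr * ar n \<le> lam ^ Suc n"
    using lnl(2) gr_pos ar_pos[of n] by (subst (asm) ln_le_cancel_iff) auto
qed

lemma lam_pos: "lam > 0"
  by (simp add: lam_def)

text \<open>A uniform bound on \<open>n\<close> steps, iterated, bounds the growth of
  \<open>ar\<close> along multiples of \<open>n\<close>, hence the rate \<open>lam\<close>. In
  \<open>ar_lower\<close> this excludes that the iterates decay faster than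
  \<open>lam\<close>.\<close>

lemma lam_power_le:
  assumes "n \<ge> 1" "t \<ge> 0" "\<And>x. (K ^^ n) (\<lambda>_. 1) x \<le> ennreal t"
  shows "lam ^ n \<le> t"
proof -
  have ub: "ar (n * j) \<le> mA * t ^ j" for j
    using a_le[OF K_funpow_bounded_power[OF assms(2,3), of j]] mA_pos assms(2) by (simp add: a_finite)
  have t: "t > 0"
    using ub[of 1] ar_pos[of n] assms(2) by (cases "t = 0") auto
  \<comment> \<open>The shift by one makes \<open>ar (?s j - 1)\<close> the value at
    \<open>n * j\<close>.\<close>
  let ?s = "\<lambda>j. n * j + 1"
  have "(\<lambda>j. ln (gr * ar (?s j - 1)) / real (?s j)) \<longlonglongrightarrow> ln lam"
    using LIMSEQ_subseq_LIMSEQ[OF lam_lim, of ?s] assms(1) by (simp add: strict_mono_def o_def)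
  moreover have "(\<lambda>j. (ln (gr * mA) + real j * ln t) / real (?s j)) \<longlonglongrightarrow> ln t / real n"
  proof -
    have "(\<lambda>j. (ln (gr * mA) - ln t / real n) / real (?s j) + ln t / real n) \<longlonglongrightarrow> 0 + ln t / real n"
    proof (intro tendsto_add tendsto_const tendsto_divide_0[OF tendsto_const] filterlim_at_top_imp_at_infinity)
      have "filterlim ?s at_top sequentially"
        using assms(1) by (intro filterlim_subseq) (simp add: strict_mono_def)
      then show "filterlim (\<lambda>j. real (?s j)) at_top sequentially"
        by (rule filterlim_compose[OF filterlim_real_sequentially])
    qed
    moreover have "(ln (gr * mA) - ln t / real n) / real (?s j) + ln t / real n
        = (ln (gr * mA) + real j * ln t) / real (?s j)" for j
    proof -
      have "real (?s j) \<noteq> 0" "real n \<noteq> 0" using assms(1) by (auto simp del: of_nat_add of_nat_mult)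
      then show ?thesis by (simp add: divide_simps del: of_nat_eq_0_iff) (simp add: algebra_simps)
    qed
    ultimately show ?thesis by simp
  qed
  moreover have "ln (gr * ar (?s j - 1)) / real (?s j) \<le> (ln (gr * mA) + real j * ln t) / real (?s j)" for j
  proof (intro divide_right_mono)
    have "ln (gr * ar (n * j)) \<le> ln (gr * mA * t ^ j)"
      using ub[of j] gr_pos ar_pos by (intro ln_mono) auto
    then show "ln (gr * ar (?s j - 1)) \<le> ln (gr * mA) + real j * ln t"
      using gr_pos mA_pos t by (simp add: ln_mult_pos ln_realpow)
  qed simp
  ultimately have "ln lam \<le> ln t / real n"
    by (intro LIMSEQ_le) auto
  then have "ln (lam ^ n) \<le> ln t"
    using assms(1) lam_pos by (simp add: ln_realpow field_simps)
  then show ?thesis using lam_pos t by (subst (asm) ln_le_cancel_iff) auto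
qed

text \<open>The cutoff is a multiple of \<gamma>/2 so that the compact set is a union of cells;
  lam/4 is small enough that two exits from it cost lam/2 in total.\<close>

lemma exists_cutoff:
  "\<exists>p>0. \<exists>\<eta>\<ge>0. \<eta> * C0 \<le> lam / 4 \<and> (\<forall>y. real p * (\<gamma> / 2) < \<bar>y\<bar> \<longrightarrow> exp (- V1 y) \<le> \<eta>)"
proof -
  define \<eta> where "\<eta> = lam / (4 * (C0 + 1))"
  have \<eta>: "\<eta> > 0" "\<eta> * C0 \<le> lam / 4"
    using lam_pos C0_nonneg by (auto simp: \<eta>_def field_simps)
  have "\<forall>\<^sub>F y in at_infinity. V1 y \<ge> - ln \<eta>"
    using V1_lim by (simp add: filterlim_at_top)
  then obtain b where b: "\<And>y. norm y \<ge> b \<Longrightarrow> V1 y \<ge> - ln \<eta>"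
    by (auto simp: eventually_at_infinity)
  obtain p :: nat where p: "b / (\<gamma> / 2) < real p" using reals_Archimedean2 by blast
  have "exp (- V1 y) \<le> \<eta>" if "real (Suc p) * (\<gamma> / 2) < \<bar>y\<bar>" for y
  proof -
    have "b < real p * (\<gamma> / 2)" using p \<gamma>_pos by (simp add: field_simps)
    also have "\<dots> \<le> real (Suc p) * (\<gamma> / 2)" using \<gamma>_pos by simp
    finally have "V1 y \<ge> - ln \<eta>" using that by (intro b) simp
    then have "exp (- V1 y) \<le> exp (ln \<eta>)" by simp
    then show ?thesis using \<eta> by simp
  qed
  moreover have "Suc p > 0" "\<eta> \<ge> 0" using \<eta> by auto
  ultimately show ?thesis using \<eta>(2) by blast
qed

text \<open>Paths whose first or last step leaves the compact set lose lam/4 each. For the others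
  both ends lie in the compact set, where the minorisation connects them to \<open>A\<close> by 2p
  extra steps on either side, so their weight is bounded by \<open>ar (n + m)\<close> with m =
  4p.\<close>

lemma K_recursion:
  "\<exists>m. \<exists>Cc>0. \<forall>n B. B \<ge> 0 \<longrightarrow> (\<forall>x. (K ^^ n) (\<lambda>_. 1) x \<le> ennreal B) \<longrightarrow>
    (\<forall>x. (K ^^ Suc n) (\<lambda>_. 1) x \<le> ennreal (Cc * ar (n + m) + lam / 2 * B))"
proof -
  obtain p \<eta> where p: "p > 0" and \<eta>: "\<eta> \<ge> 0" "\<eta> * C0 \<le> lam / 4"
    and out: "\<And>y. real p * (\<gamma> / 2) < \<bar>y\<bar> \<Longrightarrow> exp (- V1 y) \<le> \<eta>"
    using exists_cutoff by blast
  define L where "L = real p * (\<gamma> / 2)"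
  let ?C = "{- L..L}"
  obtain c where c: "c > 0" and conn: "\<And>f x. f \<in> borel_measurable borel \<Longrightarrow> x \<in> ?C \<Longrightarrow>
    ennreal c * (\<integral>\<^sup>+y. e1 y * indicator ?C y * f y \<partial>lborel) \<le> (K ^^ (2 * p)) f x"
    using K_funpow_compact[OF p] unfolding L_def by blast
  have "1 * (\<gamma> / 2) \<le> L" unfolding L_def using p \<gamma>_pos by (intro mult_right_mono) auto
  then have AC: "A \<subseteq> ?C" by (auto simp: A_def)
  have e1A: "e1 y * indicator ?C y * iA y = e1 y * iA y" for y
    using AC by (auto simp: indicator_def)
  define m where "m = 4 * p"
  let ?\<alpha> = "\<lambda>n. \<integral>\<^sup>+y. e1 y * indicator ?C y * (K ^^ n) (indicator ?C) y \<partial>lborel"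
  have hit: "ennreal (c * mA) * indicator ?C x \<le> (K ^^ (2 * p)) iA x" for x
    using conn[of iA x] c mA_pos
    by (cases "x \<in> ?C") (auto simp: e1A ennreal_mA ennreal_mult)
  have \<alpha>: "ennreal (mA * c * (c * mA)) * ?\<alpha> n \<le> a (n + m)" for n
  proof -
    have "ennreal (mA * c * (c * mA)) * ?\<alpha> n
        = ennreal mA * (ennreal c * (\<integral>\<^sup>+y. e1 y * indicator ?C y * (K ^^ n) (\<lambda>x. ennreal (c * mA) * indicator ?C x) y \<partial>lborel))"
      using c mA_pos
      by (simp add: K_funpow_cmult nn_integral_cmult[symmetric] ennreal_mult mult_ac)
    also have "\<dots> = (\<integral>\<^sup>+x. e1 x * iA x * (ennreal c * (\<integral>\<^sup>+y. e1 y * indicator ?C y * (K ^^ n) (\<lambda>x. ennreal (c * mA) * indicator ?C x) y \<partial>lborel)) \<partial>lborel)"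
      by (simp add: nn_integral_multc ennreal_mA)
    also have "\<dots> \<le> (\<integral>\<^sup>+x. e1 x * iA x * (K ^^ (2 * p)) ((K ^^ n) (\<lambda>x. ennreal (c * mA) * indicator ?C x)) x \<partial>lborel)"
    proof (intro nn_integral_mono)
      fix x
      show "e1 x * iA x * (ennreal c * (\<integral>\<^sup>+y. e1 y * indicator ?C y * (K ^^ n) (\<lambda>x. ennreal (c * mA) * indicator ?C x) y \<partial>lborel))
        \<le> e1 x * iA x * (K ^^ (2 * p)) ((K ^^ n) (\<lambda>x. ennreal (c * mA) * indicator ?C x)) x"
      proof (cases "x \<in> A")
        case True
        then show ?thesis using AC by (intro mult_left_mono conn) auto
      qed simp
    qed
    also have "\<dots> \<le> (\<integral>\<^sup>+x. e1 x * iA x * (K ^^ (2 * p)) ((K ^^ n) ((K ^^ (2 * p)) iA)) x \<partial>lborel)"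
      by (intro nn_integral_mono mult_left_mono K_funpow_mono hit) auto
    also have "\<dots> = a (n + m)"
    proof -
      have "(K ^^ (2 * p)) ((K ^^ n) ((K ^^ (2 * p)) iA)) = (K ^^ (2 * p + (n + 2 * p))) iA"
        by (simp only: funpow_add comp_apply)
      also have "2 * p + (n + 2 * p) = n + m" by (simp add: m_def)
      finally show ?thesis by (simp add: a_eq)
    qed
    finally show ?thesis .
  qed
  define Cc where "Cc = c2 / (mA * c * (c * mA))"
  have Cc: "Cc > 0" using c2_pos c mA_pos by (simp add: Cc_def)
  have \<alpha>': "ennreal c2 * ?\<alpha> n \<le> ennreal (Cc * ar (n + m))" for n
  proof -
    have "ennreal c2 * ?\<alpha> n = ennreal Cc * (ennreal (mA * c * (c * mA)) * ?\<alpha> n)"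
      using c2_pos c mA_pos Cc
      by (subst mult.assoc[symmetric], subst ennreal_mult[symmetric]) (auto simp: Cc_def)
    also have "\<dots> \<le> ennreal Cc * a (n + m)" by (intro mult_left_mono \<alpha>) auto
    finally show ?thesis using Cc ar_nonneg by (simp add: a_finite ennreal_mult)
  qed
  have "(K ^^ Suc n) (\<lambda>_. 1) x \<le> ennreal (Cc * ar (n + m) + lam / 2 * B)"
    if B: "B \<ge> 0" "\<And>x. (K ^^ n) (\<lambda>_. 1) x \<le> ennreal B" for n B x
  proof -
    have split: "(\<lambda>_. 1) = (\<lambda>y. indicator ?C y + indicator (- ?C) y :: ennreal)"
      by (auto simp: indicator_def)
    have "(K ^^ Suc n) (\<lambda>_. 1) x = (K ^^ Suc n) (indicator ?C) x + (K ^^ Suc n) (indicator (- ?C)) x"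
      by (subst split, subst K_funpow_add) auto
    also have "\<dots> \<le> (ennreal c2 * ?\<alpha> n + ennreal (\<eta> * C0) * ennreal B) + ennreal (\<eta> * C0) * ennreal B"
    proof (intro add_mono)
      have "(K ^^ n) (indicator ?C) y \<le> ennreal B" for y
        using order_trans[OF K_funpow_mono[of "indicator ?C" "\<lambda>_. 1" n y] B(2)[of y]]
        by (simp add: indicator_def)
      then show "(K ^^ Suc n) (indicator ?C) x \<le> ennreal c2 * ?\<alpha> n + ennreal (\<eta> * C0) * ennreal B"
        using K_split_le[where f = "(K ^^ n) (indicator ?C)" and B = "ennreal B" and x = x and \<eta> = \<eta> and L = L]
          \<eta>(1) out by (simp add: L_def)
      have "(K ^^ Suc n) (indicator (- ?C)) x = (K ^^ n) (K (indicator (- ?C))) x"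
        by (simp add: funpow_swap1)
      also have "\<dots> \<le> (K ^^ n) (\<lambda>_. ennreal (\<eta> * C0) * 1) x"
        using K_outside_le[OF \<eta>(1) out] by (intro K_funpow_mono) (simp add: L_def)
      also have "\<dots> \<le> ennreal (\<eta> * C0) * ennreal B"
        by (subst K_funpow_cmult) (auto intro!: mult_left_mono B)
      finally show "(K ^^ Suc n) (indicator (- ?C)) x \<le> ennreal (\<eta> * C0) * ennreal B" .
    qed
    also have "\<dots> \<le> (ennreal (Cc * ar (n + m)) + ennreal (lam / 4) * ennreal B) + ennreal (lam / 4) * ennreal B"
      by (intro add_mono \<alpha>' mult_right_mono ennreal_leI \<eta>) auto
    also have "\<dots> = ennreal (Cc * ar (n + m) + lam / 2 * B)"
      using Cc ar_nonneg lam_pos B(1)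
      by (simp add: ennreal_mult[symmetric] ennreal_plus[symmetric] del: ennreal_plus)
    finally show ?thesis .
  qed
  then show ?thesis using Cc by blast
qed

text \<open>In the recursion the second term takes up half of \<open>B * lam ^ Suc n\<close>; by
  \<open>ar_le_lam\<close> the choice of \<open>B\<close> makes the first term fit into the other
  half.\<close>

lemma K_power_upper: "\<exists>B>0. \<forall>n x. (K ^^ n) (\<lambda>_. 1) x \<le> ennreal (B * lam ^ n)"
proof -
  obtain m Cc where Cc: "Cc > 0" and rec: "\<And>n B x. B \<ge> 0 \<Longrightarrow> (\<And>x. (K ^^ n) (\<lambda>_. 1) x \<le> ennreal B) \<Longrightarrow>
    (K ^^ Suc n) (\<lambda>_. 1) x \<le> ennreal (Cc * ar (n + m) + lam / 2 * B)"
    using K_recursion by blast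
  define B where "B = max 1 (2 * Cc * lam ^ m / gr)"
  have B: "B \<ge> 1" "B > 0" "2 * Cc * lam ^ m / gr \<le> B" by (auto simp: B_def)
  have "(K ^^ n) (\<lambda>_. 1) x \<le> ennreal (B * lam ^ n)" for n x
  proof (induction n arbitrary: x)
    case 0
    then show ?case using B by (simp add: ennreal_leI[of 1, simplified])
  next
    case (Suc n)
    have "(K ^^ Suc n) (\<lambda>_. 1) x \<le> ennreal (Cc * ar (n + m) + lam / 2 * (B * lam ^ n))"
      using B lam_pos Suc by (intro rec) auto
    also have "\<dots> \<le> ennreal (B * lam ^ Suc n)"
    proof (intro ennreal_leI)
      have "ar (n + m) \<le> lam ^ Suc (n + m) / gr"
        using ar_le_lam[of "n + m"] gr_pos by (simp add: field_simps)
      then have "Cc * ar (n + m) \<le> Cc * (lam ^ Suc (n + m) / gr)"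
        using Cc by (intro mult_left_mono) auto
      also have "\<dots> = (2 * Cc * lam ^ m / gr) * (lam ^ Suc n / 2)"
        by (simp add: power_add field_simps)
      also have "\<dots> \<le> B * (lam ^ Suc n / 2)"
        using B lam_pos by (intro mult_right_mono) auto
      finally show "Cc * ar (n + m) + lam / 2 * (B * lam ^ n) \<le> B * lam ^ Suc n" by (simp add: field_simps)
    qed
    finally show ?case .
  qed
  then show ?thesis using B by blast
qed

text \<open>If \<open>ar\<close> were too small on a whole window of \<open>j + 1\<close> indices,
  the recursion would push the constant in front of \<open>lam ^ n\<close> below 1, against
  \<open>lam_power_le\<close>. So every window holds a good index, and supermultiplicativity carries
  the bound from there to all indices.\<close>

lemma ar_lower: "\<exists>c>0. \<forall>n. c * lam ^ n \<le> ar n"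
proof -
  obtain m Cc where Cc: "Cc > 0" and rec: "\<And>n B x. B \<ge> 0 \<Longrightarrow> (\<And>x. (K ^^ n) (\<lambda>_. 1) x \<le> ennreal B) \<Longrightarrow>
    (K ^^ Suc n) (\<lambda>_. 1) x \<le> ennreal (Cc * ar (n + m) + lam / 2 * B)"
    using K_recursion by blast
  obtain B where B: "B > 0" "\<And>n x. (K ^^ n) (\<lambda>_. 1) x \<le> ennreal (B * lam ^ n)"
    using K_power_upper by blast
  obtain j :: nat where j: "4 * B < 2 ^ j" using real_arch_pow[of 2 "4 * B"] by auto
  have window: "\<exists>i<Suc j. lam ^ Suc (n + i) / 8 < Cc * ar (n + i + m)" for n
  proof (rule ccontr)
    assume "\<not> ?thesis"
    then have small: "Cc * ar (n + i + m) \<le> lam ^ Suc (n + i) / 8" if "i < Suc j" for i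
      using that by (meson not_less)
    \<comment> \<open>The map c to c/2 + 1/8 has fixed point 1/4, and the excess \<open>B\<close> is
      halved at every step.\<close>
    have main: "(K ^^ (n + i)) (\<lambda>_. 1) x \<le> ennreal ((B / 2 ^ i + 1 / 4) * lam ^ (n + i))" if "i \<le> Suc j" for i x
      using that
    proof (induction i arbitrary: x)
      case 0
      have "(K ^^ n) (\<lambda>_. 1) x \<le> ennreal (B * lam ^ n)" by (rule B)
      also have "\<dots> \<le> ennreal ((B + 1 / 4) * lam ^ n)"
        using lam_pos by (intro ennreal_leI mult_right_mono) auto
      finally show ?case by simp
    next
      case (Suc i)
      have "(K ^^ Suc (n + i)) (\<lambda>_. 1) x
          \<le> ennreal (Cc * ar (n + i + m) + lam / 2 * ((B / 2 ^ i + 1 / 4) * lam ^ (n + i)))"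
        using B lam_pos Suc by (intro rec) auto
      also have "\<dots> \<le> ennreal (lam ^ Suc (n + i) / 8 + lam / 2 * ((B / 2 ^ i + 1 / 4) * lam ^ (n + i)))"
        using small[of i] Suc.prems by (intro ennreal_leI) simp
      also have "lam ^ Suc (n + i) / 8 + lam / 2 * ((B / 2 ^ i + 1 / 4) * lam ^ (n + i))
          = (B / 2 ^ Suc i + 1 / 4) * lam ^ (n + Suc i)"
        by (simp add: field_simps)
      finally show ?case by simp
    qed
    have "lam ^ (n + Suc j) \<le> (B / 2 ^ Suc j + 1 / 4) * lam ^ (n + Suc j)"
      using main[of "Suc j"] B lam_pos by (intro lam_power_le) (auto simp del: funpow.simps)
    moreover have "B / 2 ^ Suc j + 1 / 4 < 1" using j B by (simp add: field_simps)
    ultimately show False using lam_pos by (simp add: mult_le_cancel_right)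
  qed
  \<comment> \<open>Window length plus the shift \<open>m\<close>. The constant \<theta> covers all
    smaller indices, both as initial values and as the gap \<open>j - i\<close> from the good index
    to \<open>N\<close>.\<close>
  let ?J = "j + 1 + m"
  obtain \<theta> where \<theta>: "\<theta> > 0" "\<And>i. i < ?J \<Longrightarrow> \<theta> \<le> ar i / lam ^ i"
    using finite_positive_lower_bound[of "{..<?J}" "\<lambda>i. ar i / lam ^ i"] ar_pos lam_pos by auto
  have "\<theta> * min 1 (gr / (8 * Cc * lam ^ m)) * lam ^ N \<le> ar N" for N
  proof (cases "N < ?J")
    case True
    have "\<theta> * min 1 (gr / (8 * Cc * lam ^ m)) * lam ^ N \<le> \<theta> * 1 * lam ^ N"
      using \<theta> lam_pos by (intro mult_mono) (auto simp: gr_pos less_imp_le Cc)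
    then show ?thesis using \<theta>(2)[OF True] lam_pos by (simp add: field_simps)
  next
    case False
    define n where "n = N - ?J"
    obtain i where i: "i < Suc j" "lam ^ Suc (n + i) / 8 < Cc * ar (n + i + m)" using window by blast
    have N: "N = n + i + m + Suc (j - i)" using False i by (simp add: n_def)
    have ji: "\<theta> * lam ^ (j - i) \<le> ar (j - i)" using \<theta>(2)[of "j - i"] lam_pos by (simp add: field_simps)
    have "\<theta> * min 1 (gr / (8 * Cc * lam ^ m)) * lam ^ N \<le> \<theta> * (gr / (8 * Cc * lam ^ m)) * lam ^ N"
      using \<theta> lam_pos gr_pos Cc by (intro mult_mono) auto
    also have "\<dots> = gr * (lam ^ Suc (n + i) / (8 * Cc)) * (\<theta> * lam ^ (j - i))"
      using lam_pos by (simp add: N power_add field_simps)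
    also have "\<dots> \<le> gr * ar (n + i + m) * ar (j - i)"
      using i(2) ji gr_pos lam_pos \<theta> Cc ar_nonneg by (intro mult_mono) (auto simp: field_simps)
    also have "\<dots> \<le> ar N" unfolding N by (rule ar_super)
    finally show ?thesis .
  qed
  moreover have "\<theta> * min 1 (gr / (8 * Cc * lam ^ m)) > 0" using \<theta> gr_pos Cc lam_pos by simp
  ultimately show ?thesis by blast
qed


subsection \<open>The first moment of the height\<close>

text \<open>With \<open>K_abs_le\<close> one step multiplies the modulus by at most lam/2 and adds
  \<open>b\<close>; the spare lam/2 absorbs the accumulated additions.\<close>

lemma K_funpow_abs_le: "\<exists>D\<ge>0. \<forall>n x. (K ^^ n) (\<lambda>y. ennreal \<bar>y\<bar>) x \<le> ennreal ((\<bar>x\<bar> + D) * lam ^ n)"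
proof -
  obtain p \<eta> where p: "p > 0" and \<eta>: "\<eta> \<ge> 0" "\<eta> * C0 \<le> lam / 4"
    and out: "\<And>y. real p * (\<gamma> / 2) < \<bar>y\<bar> \<Longrightarrow> exp (- V1 y) \<le> \<eta>"
    using exists_cutoff by blast
  define L where "L = real p * (\<gamma> / 2)"
  have L: "L \<ge> 0" using \<gamma>_pos by (simp add: L_def)
  have out': "exp (- V1 y) \<le> \<eta>" if "L < \<bar>y\<bar>" for y
    using out that by (simp only: L_def)
  define b where "b = L * c1 * C0 + \<eta> * C1"
  have b: "b \<ge> 0" using L c1_pos C0_nonneg C1_nonneg \<eta> by (simp add: b_def)
  obtain B where B: "B > 0" "\<And>n x. (K ^^ n) (\<lambda>_. 1) x \<le> ennreal (B * lam ^ n)"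
    using K_power_upper by blast
  \<comment> \<open>Chosen so that \<open>b * B = h * D\<close>, which closes the induction.\<close>
  define D where "D = 2 * b * B / lam"
  have D: "D \<ge> 0" using b B lam_pos by (simp add: D_def)
  define h where "h = lam / 2"
  have h: "2 * h = lam" "h \<ge> 0" using lam_pos by (auto simp: h_def)
  have Kabs: "K (\<lambda>y. ennreal \<bar>y\<bar>) x \<le> ennreal h * ennreal \<bar>x\<bar> + ennreal b * 1" for x
  proof -
    have "K (\<lambda>y. ennreal \<bar>y\<bar>) x \<le> ennreal (\<eta> * C0 * \<bar>x\<bar> + b)"
      unfolding b_def by (rule K_abs_le[OF \<eta>(1) L out'])
    also have "\<dots> \<le> ennreal (h * \<bar>x\<bar> + b)"
    proof -
      have "\<eta> * C0 \<le> h" using \<eta>(2) lam_pos h by linarith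
      then show ?thesis by (intro ennreal_leI add_right_mono mult_right_mono) simp_all
    qed
    also have "\<dots> = ennreal h * ennreal \<bar>x\<bar> + ennreal b * 1"
      using b h(2) by (simp add: ennreal_mult ennreal_plus)
    finally show ?thesis .
  qed
  have "(K ^^ n) (\<lambda>y. ennreal \<bar>y\<bar>) x \<le> ennreal ((\<bar>x\<bar> + D) * lam ^ n)" for n x
  proof (induction n)
    case 0
    then show ?case using D by (auto intro!: ennreal_leI)
  next
    case (Suc n)
    have "(K ^^ Suc n) (\<lambda>y. ennreal \<bar>y\<bar>) x = (K ^^ n) (K (\<lambda>y. ennreal \<bar>y\<bar>)) x"
      by (simp add: funpow_swap1)
    also have "\<dots> \<le> (K ^^ n) (\<lambda>x. ennreal h * ennreal \<bar>x\<bar> + ennreal b * 1) x"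
      by (intro K_funpow_mono Kabs)
    also have "\<dots> = ennreal h * (K ^^ n) (\<lambda>y. ennreal \<bar>y\<bar>) x + ennreal b * (K ^^ n) (\<lambda>_. 1) x"
      using K_funpow_add[of "\<lambda>x. ennreal h * ennreal \<bar>x\<bar>" "\<lambda>_. ennreal b * 1" n]
        K_funpow_cmult[of "\<lambda>x. ennreal \<bar>x\<bar>" n "ennreal (h)"] K_funpow_cmult[of "\<lambda>_. 1" n "ennreal b"]
      by simp
    also have "\<dots> \<le> ennreal h * ennreal ((\<bar>x\<bar> + D) * lam ^ n) + ennreal b * ennreal (B * lam ^ n)"
      by (intro add_mono mult_left_mono Suc B) auto
    also have "\<dots> = ennreal ((h * (\<bar>x\<bar> + D) + b * B) * lam ^ n)"
      using D b B(1) lam_pos h(2)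
      by (simp add: ennreal_mult[symmetric] ennreal_plus[symmetric] algebra_simps del: ennreal_plus)
    also have "\<dots> \<le> ennreal ((\<bar>x\<bar> + D) * lam ^ Suc n)"
    proof (intro ennreal_leI)
      have "b * B = h * D" using lam_pos by (simp add: D_def h_def)
      then have "h * (\<bar>x\<bar> + D) + b * B = h * \<bar>x\<bar> + (2 * h) * D" by (simp add: algebra_simps)
      also have "\<dots> \<le> lam * \<bar>x\<bar> + lam * D"
        using h lam_pos D by (intro add_mono mult_right_mono) auto
      finally have "h * (\<bar>x\<bar> + D) + b * B \<le> lam * (\<bar>x\<bar> + D)"
        by (simp only: distrib_left)
      then have "(h * (\<bar>x\<bar> + D) + b * B) * lam ^ n \<le> lam * (\<bar>x\<bar> + D) * lam ^ n"
        using lam_pos by (intro mult_right_mono) auto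
      then show "(h * (\<bar>x\<bar> + D) + b * B) * lam ^ n \<le> (\<bar>x\<bar> + D) * lam ^ Suc n"
        by (simp add: mult_ac)
    qed
    finally show ?case .
  qed
  then show ?thesis using D by blast
qed

text \<open>The triangle inequality along the path: the summand \<open>i\<close> is the modulus of
  the increment after \<open>Suc i\<close> steps, with the remaining \<open>n - Suc i\<close> steps
  bounded by their total mass.\<close>

lemma KK_funpow_abs_le:
  assumes B: "B > 0" "\<And>n x. (K ^^ n) (\<lambda>_. 1) x \<le> ennreal (B * lam ^ n)"
  shows "(KK ^^ n) (\<lambda>s y. ennreal \<bar>s\<bar>) s x
    \<le> ennreal \<bar>s\<bar> * (K ^^ n) (\<lambda>_. 1) x
      + (\<Sum>i<n. ennreal (B * lam ^ (n - Suc i)) * (K ^^ Suc i) (\<lambda>y. ennreal \<bar>y\<bar>) x)"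
proof (induction n arbitrary: s x)
  case (Suc n)
  let ?w = "\<lambda>y. ennreal \<bar>y\<bar>"
  let ?R = "\<lambda>n x. \<Sum>i<n. ennreal (B * lam ^ (n - Suc i)) * (K ^^ Suc i) ?w x"
  have "(KK ^^ Suc n) (\<lambda>s y. ennreal \<bar>s\<bar>) s x = (\<integral>\<^sup>+y. k x y * (KK ^^ n) (\<lambda>s y. ennreal \<bar>s\<bar>) (s + y) y \<partial>lborel)"
    by (simp add: KK_def[of "(KK ^^ n) _"])
  also have "\<dots> \<le> (\<integral>\<^sup>+y. k x y * (ennreal \<bar>s\<bar> * (K ^^ n) (\<lambda>_. 1) y + ennreal (B * lam ^ n) * ?w y + ?R n y) \<partial>lborel)"
  proof (intro nn_integral_mono mult_left_mono)
    fix y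
    have "(KK ^^ n) (\<lambda>s y. ennreal \<bar>s\<bar>) (s + y) y \<le> ennreal \<bar>s + y\<bar> * (K ^^ n) (\<lambda>_. 1) y + ?R n y"
      by (rule Suc)
    also have "\<dots> \<le> (ennreal \<bar>s\<bar> + ?w y) * (K ^^ n) (\<lambda>_. 1) y + ?R n y"
      by (intro add_mono mult_right_mono order_refl) (auto simp: ennreal_plus[symmetric] simp del: ennreal_plus intro!: ennreal_leI)
    also have "\<dots> \<le> ennreal \<bar>s\<bar> * (K ^^ n) (\<lambda>_. 1) y + ennreal (B * lam ^ n) * ?w y + ?R n y"
      using B(2)[of n y] by (auto simp: distrib_right mult.commute intro!: add_mono mult_left_mono)
    finally show "(KK ^^ n) (\<lambda>s y. ennreal \<bar>s\<bar>) (s + y) y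
        \<le> ennreal \<bar>s\<bar> * (K ^^ n) (\<lambda>_. 1) y + ennreal (B * lam ^ n) * ?w y + ?R n y" .
  qed auto
  also have "\<dots> = K (\<lambda>y. ennreal \<bar>s\<bar> * (K ^^ n) (\<lambda>_. 1) y + ennreal (B * lam ^ n) * ?w y + ?R n y) x"
    by (simp add: K_def)
  also have "\<dots> = ennreal \<bar>s\<bar> * K ((K ^^ n) (\<lambda>_. 1)) x + ennreal (B * lam ^ n) * K ?w x + K (?R n) x"
    by (simp add: K_add K_cmult)
  also have "K (?R n) x = (\<Sum>i<n. ennreal (B * lam ^ (n - Suc i)) * K ((K ^^ Suc i) ?w) x)"
    by (subst K_sum) (auto simp: K_cmult)
  also have "ennreal \<bar>s\<bar> * K ((K ^^ n) (\<lambda>_. 1)) x + ennreal (B * lam ^ n) * K ?w x + \<dots>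
      = ennreal \<bar>s\<bar> * (K ^^ Suc n) (\<lambda>_. 1) x + ?R (Suc n) x"
    by (subst sum.lessThan_Suc_shift) (simp add: add.assoc)
  finally show ?case .
qed simp

lemma nu_abs_le: "\<exists>E>0. \<forall>n. nu n (\<lambda>s. ennreal \<bar>s\<bar>) \<le> ennreal (E * real (Suc n) * lam ^ n)"
proof -
  obtain B where B: "B > 0" "\<And>n x. (K ^^ n) (\<lambda>_. 1) x \<le> ennreal (B * lam ^ n)"
    using K_power_upper by blast
  obtain D where D: "D \<ge> 0" "\<And>n x. (K ^^ n) (\<lambda>y. ennreal \<bar>y\<bar>) x \<le> ennreal ((\<bar>x\<bar> + D) * lam ^ n)"
    using K_funpow_abs_le by blast
  define E where "E = B * (\<gamma> / 2 + D)"
  have E: "E > 0" using B D \<gamma>_pos by (simp add: E_def)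
  have bound: "(KK ^^ n) (\<lambda>s y. ennreal \<bar>s\<bar>) x x \<le> ennreal (E * real (Suc n) * lam ^ n)"
    if "x \<in> A" for n x
  proof -
    have x: "\<bar>x\<bar> \<le> \<gamma> / 2" using that by (auto simp: A_def)
    have "(KK ^^ n) (\<lambda>s y. ennreal \<bar>s\<bar>) x x \<le> ennreal \<bar>x\<bar> * (K ^^ n) (\<lambda>_. 1) x
      + (\<Sum>i<n. ennreal (B * lam ^ (n - Suc i)) * (K ^^ Suc i) (\<lambda>y. ennreal \<bar>y\<bar>) x)"
      by (rule KK_funpow_abs_le[OF B])
    also have "\<dots> \<le> ennreal (\<gamma> / 2 + D) * ennreal (B * lam ^ n) + (\<Sum>i<n. ennreal (E * lam ^ n))"
    proof (intro add_mono mult_mono sum_mono B ennreal_leI)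
      fix i assume i: "i \<in> {..<n}"
      have "ennreal (B * lam ^ (n - Suc i)) * (K ^^ Suc i) (\<lambda>y. ennreal \<bar>y\<bar>) x
        \<le> ennreal (B * lam ^ (n - Suc i)) * ennreal ((\<gamma> / 2 + D) * lam ^ Suc i)"
        using x lam_pos by (intro mult_left_mono order_trans[OF D(2)[of "Suc i" x]] ennreal_leI mult_right_mono) auto
      also have "\<dots> = ennreal (E * (lam ^ (n - Suc i) * lam ^ Suc i))"
        using B D \<gamma>_pos lam_pos by (subst ennreal_mult[symmetric]) (auto simp: E_def mult_ac)
      also have "lam ^ (n - Suc i) * lam ^ Suc i = lam ^ n"
        using i by (simp add: power_add[symmetric] del: power_Suc)
      finally show "ennreal (B * lam ^ (n - Suc i)) * (K ^^ Suc i) (\<lambda>y. ennreal \<bar>y\<bar>) x \<le> ennreal (E * lam ^ n)" .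
    qed (use x D in auto)
    also have "\<dots> = ennreal (E * real (Suc n) * lam ^ n)"
    proof -
      have "(\<Sum>i<n. ennreal (E * lam ^ n)) = ennreal (\<Sum>i<n. E * lam ^ n)"
        using E lam_pos by (intro sum_ennreal) auto
      moreover have "ennreal (\<gamma> / 2 + D) * ennreal (B * lam ^ n) = ennreal (E * lam ^ n)"
        using B D \<gamma>_pos lam_pos by (subst ennreal_mult[symmetric]) (auto simp: E_def mult_ac)
      ultimately show ?thesis
        using E lam_pos by (simp add: ennreal_plus[symmetric] algebra_simps del: ennreal_plus)
    qed
    finally show ?thesis .
  qed
  have "nu n (\<lambda>s. ennreal \<bar>s\<bar>) \<le> ennreal (mA * E * real (Suc n) * lam ^ n)" for n
  proof -
    have "nu n (\<lambda>s. ennreal \<bar>s\<bar>) \<le> (\<integral>\<^sup>+x. e1 x * iA x * ennreal (E * real (Suc n) * lam ^ n) \<partial>lborel)"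
    proof (subst nu_eq, simp, intro nn_integral_mono)
      fix x
      have "(KK ^^ n) (\<lambda>s y. ennreal \<bar>s\<bar> * iA y) x x \<le> (KK ^^ n) (\<lambda>s y. ennreal \<bar>s\<bar>) x x"
        by (intro KK_funpow_mono) (auto simp: indicator_def)
      then show "e1 x * iA x * (KK ^^ n) (\<lambda>s y. ennreal \<bar>s\<bar> * iA y) x x
          \<le> e1 x * iA x * ennreal (E * real (Suc n) * lam ^ n)"
        using order_trans[OF _ bound[of x n]] by (cases "x \<in> A") (auto intro!: mult_left_mono)
    qed
    also have "\<dots> = ennreal (mA * E * real (Suc n) * lam ^ n)"
      using mA_pos E lam_pos
      by (simp add: nn_integral_multc ennreal_mA) (simp add: ennreal_mult[symmetric] mult.assoc)
    finally show ?thesis .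
  qed
  then show ?thesis using E mA_pos by (intro exI[of _ "mA * E"]) auto
qed

subsection \<open>Returns of the height to the origin\<close>

text \<open>Half-open, so that each height lies in exactly one slab.\<close>

definition slab :: "real \<Rightarrow> int \<Rightarrow> real set" where
  "slab \<tau> j = {real_of_int j * \<tau>..<real_of_int (j + 1) * \<tau>}"

lemma slab_measurable [measurable]: "slab \<tau> j \<in> sets borel"
  by (simp add: slab_def)

text \<open>Only the slab of \<open>s\<close> contributes, and if \<open>- s'\<close> lies in it
  too, then \<open>s + s'\<close> is at most \<tau> in modulus.\<close>

lemma sum_slab_product_le:
  assumes "\<tau> > 0" "finite P"
  shows "(\<Sum>j\<in>P. indicator (slab \<tau> j) s * indicator (slab \<tau> j) (- s')) \<le> (indicator {- \<tau>..\<tau>} (s + s') :: ennreal)"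
    (is "sum ?f P \<le> ?r")
proof -
  have 0: "?f j = 0" if "j \<noteq> \<lfloor>s / \<tau>\<rfloor>" for j
    using floor_unique[of j "s / \<tau>"] assms that
    by (auto simp: slab_def pos_le_divide_eq pos_divide_less_eq indicator_def)
  have 1: "?f j \<le> ?r" for j
    using assms by (auto simp: slab_def indicator_def algebra_simps)
  have "sum ?f P \<le> sum ?f (insert \<lfloor>s / \<tau>\<rfloor> P)"
    using assms by (intro sum_mono2) auto
  also have "\<dots> = sum ?f {\<lfloor>s / \<tau>\<rfloor>}"
    using assms 0 by (intro sum.mono_neutral_right) blast+
  also have "\<dots> = ?f \<lfloor>s / \<tau>\<rfloor>"
    by (simp only: sum.insert[OF finite.emptyI] empty_iff not_False_eq_True sum.empty add_0_right)
  finally show ?thesis using 1 order_trans by blast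
qed

text \<open>Markov's inequality in pointwise form: a height outside the 2J slabs has modulus at
  least \<open>real J * \<tau>\<close>.\<close>

lemma one_le_sum_slab:
  assumes "\<tau> > 0" "J > 0"
  shows "1 \<le> (\<Sum>j\<in>{- int J..<int J}. indicator (slab \<tau> j) s) + ennreal (1 / (real J * \<tau>)) * ennreal \<bar>s\<bar>"
proof (cases "\<bar>s\<bar> < real J * \<tau>")
  case True
  define j where "j = \<lfloor>s / \<tau>\<rfloor>"
  have j: "real_of_int j \<le> s / \<tau>" "s / \<tau> < real_of_int j + 1" by (auto simp: j_def)
  have "s / \<tau> < real J" "s / \<tau> > - real J" using True assms by (auto simp: field_simps abs_less_iff)
  then have "j < int J" "- int J < j + 1" using j by linarith+
  then have jP: "j \<in> {- int J..<int J}" by simp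
  have js: "s \<in> slab \<tau> j" using j assms by (auto simp: slab_def pos_le_divide_eq pos_divide_less_eq)
  have "(1 :: ennreal) = indicator (slab \<tau> j) s" using js by simp
  also have "\<dots> \<le> (\<Sum>j\<in>{- int J..<int J}. indicator (slab \<tau> j) s)"
    using jP by (rule member_le_sum) auto
  finally show ?thesis by (rule add_increasing2[rotated]) simp
next
  case False
  then have "1 \<le> 1 / (real J * \<tau>) * \<bar>s\<bar>" using assms by (simp add: field_simps)
  then have "1 \<le> ennreal (1 / (real J * \<tau>)) * ennreal \<bar>s\<bar>"
    using assms ennreal_leI[of 1 "1 / (real J * \<tau>) * \<bar>s\<bar>"] by (subst ennreal_mult[symmetric]) auto
  then show ?thesis by (rule add_increasing[rotated]) simp
qed

text \<open>By symmetry an independent pair of paths ends in opposite slabs with the sum of the squared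
  slab probabilities, and the first moment confines the height to \<open>O(n)\<close> slabs.\<close>

lemma nu_nu_lower:
  assumes "\<tau> > 0"
  shows "\<exists>c>0. \<forall>n. ennreal (c * lam ^ (2 * n) / real (Suc n))
    \<le> nu n (\<lambda>s. nu n (\<lambda>s'. indicator {- \<tau>..\<tau>} (s + s')))"
proof -
  obtain c where c: "c > 0" "\<And>n. c * lam ^ n \<le> ar n" using ar_lower by blast
  obtain E where E: "E > 0" "\<And>n. nu n (\<lambda>s. ennreal \<bar>s\<bar>) \<le> ennreal (E * real (Suc n) * lam ^ n)"
    using nu_abs_le by blast
  \<comment> \<open>With J = M(n + 1) slabs on either side, the heights outside carry at most half
    of the lower bound \<open>c * lam ^ n\<close> for the total mass.\<close>
  define M where "M = nat \<lceil>2 * E / (c * \<tau>)\<rceil> + 1"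
  have M: "real M * \<tau> * c \<ge> 2 * E" "M > 0"
  proof -
    have "2 * E / (c * \<tau>) \<le> real M" unfolding M_def by linarith
    then show "real M * \<tau> * c \<ge> 2 * E" using c assms by (simp add: field_simps)
  qed (simp add: M_def)
  have "ennreal (c ^ 2 / (8 * real M) * lam ^ (2 * n) / real (Suc n))
      \<le> nu n (\<lambda>s. nu n (\<lambda>s'. indicator {- \<tau>..\<tau>} (s + s')))" for n
  proof -
    define J where "J = M * Suc n"
    have J: "J > 0" using M by (simp add: J_def)
    let ?P = "{- int J..<int J}"
    define pr where "pr j = enn2real (nu n (indicator (slab \<tau> j)))" for j
    have pr: "nu n (indicator (slab \<tau> j)) = ennreal (pr j)" for j
    proof -
      have "nu n (indicator (slab \<tau> j)) \<le> a n"
        unfolding a_def by (intro nu_mono) (auto simp: indicator_def)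
      then show ?thesis using a_finite[of n] by (simp add: pr_def le_less_trans[OF _ ennreal_less_top])
    qed
    have pr_nonneg: "pr j \<ge> 0" for j by (simp add: pr_def)
    have cover: "1 \<le> (\<Sum>j\<in>?P. indicator (slab \<tau> j) s) + ennreal (1 / (real J * \<tau>)) * ennreal \<bar>s\<bar>" for s
      using assms J by (rule one_le_sum_slab)
    have "a n \<le> nu n (\<lambda>s. (\<Sum>j\<in>?P. indicator (slab \<tau> j) s) + ennreal (1 / (real J * \<tau>)) * ennreal \<bar>s\<bar>)"
      unfolding a_def by (intro nu_mono cover)
    also have "\<dots> = (\<Sum>j\<in>?P. ennreal (pr j)) + ennreal (1 / (real J * \<tau>)) * nu n (\<lambda>s. ennreal \<bar>s\<bar>)"
      by (simp add: nu_add nu_sum nu_cmult pr)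
    also have "\<dots> \<le> (\<Sum>j\<in>?P. ennreal (pr j)) + ennreal (1 / (real J * \<tau>)) * ennreal (E * real (Suc n) * lam ^ n)"
      by (intro add_mono mult_left_mono E) auto
    also have "\<dots> = ennreal ((\<Sum>j\<in>?P. pr j) + 1 / (real J * \<tau>) * (E * real (Suc n) * lam ^ n))"
    proof -
      have "(\<Sum>j\<in>?P. ennreal (pr j)) = ennreal (\<Sum>j\<in>?P. pr j)"
        using pr_nonneg by (intro sum_ennreal)
      moreover have "0 \<le> (\<Sum>j\<in>?P. pr j)" by (intro sum_nonneg pr_nonneg)
      moreover have "0 \<le> 1 / (real J * \<tau>)" "0 \<le> E * real (Suc n) * lam ^ n"
        using E lam_pos assms by auto
      ultimately show ?thesis by (metis ennreal_mult ennreal_plus mult_nonneg_nonneg)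
    qed
    finally have "ennreal (ar n) \<le> ennreal ((\<Sum>j\<in>?P. pr j) + 1 / (real J * \<tau>) * (E * real (Suc n) * lam ^ n))"
      by (simp only: a_finite)
    moreover have "0 \<le> (\<Sum>j\<in>?P. pr j) + 1 / (real J * \<tau>) * (E * real (Suc n) * lam ^ n)"
      using E lam_pos assms by (intro add_nonneg_nonneg sum_nonneg pr_nonneg) auto
    ultimately have "ar n \<le> (\<Sum>j\<in>?P. pr j) + 1 / (real J * \<tau>) * (E * real (Suc n) * lam ^ n)"
      by (simp only: ennreal_le_iff)
    moreover have "1 / (real J * \<tau>) * (E * real (Suc n) * lam ^ n) \<le> c / 2 * lam ^ n"
    proof -
      have "1 / (real J * \<tau>) * (E * real (Suc n)) = E / (real M * \<tau>)"
      proof -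
        have "1 / (m * N * \<tau>) * (E * N) = E / (m * \<tau>)" if "N \<noteq> 0" for m N :: real
          using that by simp
        moreover have "real (Suc n) \<noteq> 0" by simp
        ultimately show ?thesis by (simp only: J_def of_nat_mult)
      qed
      also have "\<dots> \<le> c / 2"
      proof -
        have "0 < real M * \<tau>" using M(2) assms by simp
        moreover have "E \<le> c / 2 * (real M * \<tau>)" using M(1) by (simp add: mult_ac)
        ultimately show ?thesis by (simp only: pos_divide_le_eq)
      qed
      finally have "1 / (real J * \<tau>) * (E * real (Suc n)) * lam ^ n \<le> c / 2 * lam ^ n"
        using lam_pos by (intro mult_right_mono) auto
      then show ?thesis by (simp add: mult.assoc)
    qed
    moreover have "y \<le> S" if "x \<le> S + t" "t \<le> y" "2 * y \<le> x" for x y S t :: real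
      using that by linarith
    moreover have "2 * (c / 2 * lam ^ n) \<le> ar n" using c(2)[of n] by simp
    ultimately have sum_ge: "c / 2 * lam ^ n \<le> (\<Sum>j\<in>?P. pr j)" by blast
    have "(c / 2 * lam ^ n)\<^sup>2 \<le> (\<Sum>j\<in>?P. pr j)\<^sup>2"
      using c lam_pos by (intro power_mono sum_ge) auto
    also have "\<dots> \<le> (\<Sum>j\<in>?P. (pr j)\<^sup>2) * (\<Sum>j\<in>?P. 1\<^sup>2)"
      using Cauchy_Schwarz_ineq_sum[of pr "\<lambda>_. 1" ?P] by simp
    also have "(\<Sum>j\<in>?P. 1\<^sup>2) = 2 * real J" by simp
    finally have sq: "(c / 2 * lam ^ n)\<^sup>2 / (2 * real J) \<le> (\<Sum>j\<in>?P. (pr j)\<^sup>2)"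
      using J by (subst pos_divide_le_eq) auto
    have "(\<Sum>j\<in>?P. indicator (slab \<tau> j) s * indicator (slab \<tau> j) (- s')) \<le> (indicator {- \<tau>..\<tau>} (s + s') :: ennreal)" for s s'
      using assms by (intro sum_slab_product_le) auto
    then have "nu n (\<lambda>s. nu n (\<lambda>s'. \<Sum>j\<in>?P. indicator (slab \<tau> j) s * indicator (slab \<tau> j) (- s')))
        \<le> nu n (\<lambda>s. nu n (\<lambda>s'. indicator {- \<tau>..\<tau>} (s + s')))"
      by (intro nu_mono)
    moreover have "nu n (\<lambda>s'. \<Sum>j\<in>?P. indicator (slab \<tau> j) s * indicator (slab \<tau> j) (- s'))
        = (\<Sum>j\<in>?P. ennreal (pr j) * indicator (slab \<tau> j) s)" for s
    proof -
      \<comment> \<open>Here the symmetry enters: the second path ends in the opposite slab with the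
        same weight, which produces the squares.\<close>
      have "nu n (\<lambda>s'. indicator (slab \<tau> j) (- s')) = ennreal (pr j)" for j
        using nu_minus[of "indicator (slab \<tau> j)" n] by (simp only: pr borel_measurable_indicator slab_measurable)
      then have "nu n (\<lambda>s'. indicator (slab \<tau> j) s * indicator (slab \<tau> j) (- s')) = ennreal (pr j) * indicator (slab \<tau> j) s" for j
        by (subst nu_cmult) (simp_all add: mult.commute)
      then show ?thesis by (subst nu_sum) simp_all
    qed
    moreover have "nu n (\<lambda>s. \<Sum>j\<in>?P. ennreal (pr j) * indicator (slab \<tau> j) s) = ennreal (\<Sum>j\<in>?P. (pr j)\<^sup>2)"
    proof -
      have "nu n (\<lambda>s. ennreal (pr j) * indicator (slab \<tau> j) s) = ennreal ((pr j)\<^sup>2)" for j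
        using pr_nonneg[of j] by (subst nu_cmult) (simp_all add: pr ennreal_mult[symmetric] power2_eq_square)
      then have "nu n (\<lambda>s. \<Sum>j\<in>?P. ennreal (pr j) * indicator (slab \<tau> j) s) = (\<Sum>j\<in>?P. ennreal ((pr j)\<^sup>2))"
        by (subst nu_sum) simp_all
      then show ?thesis by (simp add: sum_ennreal)
    qed
    ultimately have "ennreal (\<Sum>j\<in>?P. (pr j)\<^sup>2) \<le> nu n (\<lambda>s. nu n (\<lambda>s'. indicator {- \<tau>..\<tau>} (s + s')))"
      by simp
    then have "ennreal ((c / 2 * lam ^ n)\<^sup>2 / (2 * real J)) \<le> nu n (\<lambda>s. nu n (\<lambda>s'. indicator {- \<tau>..\<tau>} (s + s')))"
      using ennreal_leI[OF sq] order_trans by blast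
    moreover have "(c / 2 * lam ^ n)\<^sup>2 / (2 * real J) = c ^ 2 / (8 * real M) * lam ^ (2 * n) / real (Suc n)"
    proof -
      have "(c / 2 * l)\<^sup>2 / (2 * (m * N)) = c ^ 2 / (8 * m) * (l * l) / N" for l m N :: real
        by (simp add: power2_eq_square mult_ac)
      from this[of "lam ^ n" "real M" "real (Suc n)"] show ?thesis
        by (simp only: J_def of_nat_mult mult_2 power_add)
    qed
    ultimately show ?thesis by simp
  qed
  moreover have "c ^ 2 / (8 * real M) > 0" using c M by simp
  ultimately show ?thesis by blast
qed


subsection \<open>The unpinned partition function\<close>

text \<open>\<open>V1\<close> may be unbounded on \<open>A\<close>, so \<open>e1\<close> need not
  have a positive lower bound there. It has one on a subset of almost full measure, which must meet
  its translate by a small \<open>s\<close>.\<close>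

lemma self_convolution_lower:
  "\<exists>\<kappa>>0. \<forall>s. \<bar>s\<bar> \<le> \<gamma> / 4 \<longrightarrow>
    ennreal \<kappa> \<le> (\<integral>\<^sup>+z. e1 z * iA z * (e1 (s + z) * iA (s + z)) \<partial>lborel)"
proof -
  define E where "E n = {x\<in>A. V1 x \<le> real n}" for n :: nat
  have [measurable]: "E n \<in> sets borel" for n unfolding E_def by measurable
  have "(\<lambda>n. emeasure lborel (E n)) \<longlonglongrightarrow> emeasure lborel (\<Union>n. E n)"
    by (intro Lim_emeasure_incseq) (force simp: E_def incseq_def)+
  also have "(\<Union>n. E n) = A"
    using real_arch_simple by (auto simp: E_def)
  also have "emeasure lborel A = ennreal \<gamma>"
    using \<gamma>_pos by (simp add: A_def)
  finally have "\<forall>\<^sub>F n in sequentially. ennreal (7 / 8 * \<gamma>) < emeasure lborel (E n)"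
    by (rule order_tendstoD) (use \<gamma>_pos in \<open>simp add: ennreal_less_iff\<close>)
  then obtain M where M: "ennreal (7 / 8 * \<gamma>) < emeasure lborel (E M)"
    by (auto simp: eventually_sequentially)
  define \<kappa> where "\<kappa> = exp (- real M) * exp (- real M) * (\<gamma> / 4)"
  have "ennreal \<kappa> \<le> (\<integral>\<^sup>+z. e1 z * iA z * (e1 (s + z) * iA (s + z)) \<partial>lborel)"
    if s: "\<bar>s\<bar> \<le> \<gamma> / 4" for s
  proof -
    define E' where "E' = {z. s + z \<in> E M}"
    have [measurable]: "E' \<in> sets borel" unfolding E'_def by measurable
    have "emeasure lborel E' = (\<integral>\<^sup>+z. indicator (E M) (s + z) \<partial>lborel)"
    proof -
      have "indicator E' z = (indicator (E M) (s + z) :: ennreal)" for z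
        by (simp add: E'_def indicator_def)
      then show ?thesis using nn_integral_indicator[of E' lborel] by simp
    qed
    also have "\<dots> = emeasure lborel (E M)"
      by (subst nn_integral_translate) auto
    finally have E': "emeasure lborel E' = emeasure lborel (E M)" .
    \<comment> \<open>Two sets of measure at least 7\<gamma>/8 inside an interval of length
      3\<gamma>/2 overlap in measure at least \<gamma>/4.\<close>
    have "E M \<union> E' \<subseteq> {- (3 / 4 * \<gamma>)..3 / 4 * \<gamma>}"
      using s by (auto simp: E_def E'_def A_def)
    then have un: "emeasure lborel (E M \<union> E') \<le> ennreal (3 / 2 * \<gamma>)"
      using emeasure_mono[of "E M \<union> E'" "{- (3 / 4 * \<gamma>)..3 / 4 * \<gamma>}" lborel] \<gamma>_pos by simp
    have "ennreal (7 / 4 * \<gamma>) = ennreal (7 / 8 * \<gamma>) + ennreal (7 / 8 * \<gamma>)"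
      using \<gamma>_pos by (subst ennreal_plus[symmetric]) auto
    also have "\<dots> \<le> emeasure lborel (E M) + emeasure lborel E'"
      using M E' by (intro add_mono) auto
    also have "\<dots> = emeasure lborel (E M \<union> E') + emeasure lborel (E M \<inter> E')"
      by (intro emeasure_Un_Int) auto
    also have "\<dots> \<le> ennreal (3 / 2 * \<gamma>) + emeasure lborel (E M \<inter> E')"
      by (intro add_mono un) auto
    finally have "ennreal (7 / 4 * \<gamma>) \<le> ennreal (3 / 2 * \<gamma>) + emeasure lborel (E M \<inter> E')" .
    then have "ennreal (7 / 4 * \<gamma>) - ennreal (3 / 2 * \<gamma>) \<le> emeasure lborel (E M \<inter> E')"
      by (subst ennreal_minus_le_iff) auto
    then have int: "ennreal (\<gamma> / 4) \<le> emeasure lborel (E M \<inter> E')"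
      using \<gamma>_pos by (subst (asm) ennreal_minus) auto
    have "ennreal \<kappa> = ennreal (exp (- real M) * exp (- real M)) * ennreal (\<gamma> / 4)"
      unfolding \<kappa>_def using \<gamma>_pos by (subst ennreal_mult[symmetric]) auto
    also have "\<dots> \<le> ennreal (exp (- real M) * exp (- real M)) * emeasure lborel (E M \<inter> E')"
      by (intro mult_left_mono int) auto
    also have "\<dots> = (\<integral>\<^sup>+z. ennreal (exp (- real M) * exp (- real M)) * indicator (E M \<inter> E') z \<partial>lborel)"
      by (subst nn_integral_cmult_indicator) auto
    also have "\<dots> \<le> (\<integral>\<^sup>+z. e1 z * iA z * (e1 (s + z) * iA (s + z)) \<partial>lborel)"
    proof (intro nn_integral_mono)
      fix z
      show "ennreal (exp (- real M) * exp (- real M)) * indicator (E M \<inter> E') z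
          \<le> e1 z * iA z * (e1 (s + z) * iA (s + z))"
      proof (cases "z \<in> E M \<inter> E'")
        case True
        then have "exp (- real M) * exp (- real M) \<le> exp (- V1 z) * exp (- V1 (s + z))"
          by (intro mult_mono) (auto simp: E_def E'_def)
        then have "ennreal (exp (- real M) * exp (- real M)) \<le> e1 z * e1 (s + z)"
          unfolding e1_def by (subst ennreal_mult[symmetric]) (auto intro: ennreal_leI)
        then show ?thesis using True by (auto simp: E_def E'_def)
      qed simp
    qed
    finally show ?thesis .
  qed
  moreover have "\<kappa> > 0" using \<gamma>_pos by (simp add: \<kappa>_def)
  ultimately show ?thesis by blast
qed

text \<open>Two paths of \<open>n + 1\<close> increments joined have 2n + 2 increments, which is
  index 2n + 1 of \<open>nu\<close>.\<close>

lemma nu_return_odd: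
  assumes "\<tau> > 0"
  shows "\<exists>c>0. \<forall>n. ennreal (c * lam ^ (2 * n) / real (Suc n)) \<le> nu (2 * n + 1) (indicator {- \<tau>..\<tau>})"
proof -
  obtain c where c: "c > 0" "\<And>n. ennreal (c * lam ^ (2 * n) / real (Suc n))
    \<le> nu n (\<lambda>s. nu n (\<lambda>s'. indicator {- \<tau>..\<tau>} (s + s')))"
    using nu_nu_lower[OF assms] by blast
  have "ennreal (gr * c * lam ^ (2 * n) / real (Suc n)) \<le> nu (2 * n + 1) (indicator {- \<tau>..\<tau>})" for n
  proof -
    have "ennreal (gr * c * lam ^ (2 * n) / real (Suc n)) = g * ennreal (c * lam ^ (2 * n) / real (Suc n))"
      unfolding g_gr using gr_pos c lam_pos by (subst ennreal_mult[symmetric]) (auto simp: mult.assoc)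
    also have "\<dots> \<le> g * nu n (\<lambda>s. nu n (\<lambda>s'. indicator {- \<tau>..\<tau>} (s + s')))"
      by (intro mult_left_mono c) auto
    also have "\<dots> \<le> nu (n + Suc n) (indicator {- \<tau>..\<tau>})"
      by (intro nu_concat) auto
    finally show ?thesis by (simp add: mult_2)
  qed
  then show ?thesis using gr_pos c(1) by (intro exI[of _ "gr * c"]) auto
qed

text \<open>Inserting one increment of size at most \<open>\<tau> / 2\<close> between the two paths takes care of
  the other parity.\<close>

lemma nu_return_even:
  assumes "\<tau> > 0"
  shows "\<exists>c>0. \<forall>n. ennreal (c * lam ^ (2 * n) / real (Suc n)) \<le> nu (2 * n + 2) (indicator {- \<tau>..\<tau>})"
proof -
  let ?h = "indicator {- (\<tau> / 2)..\<tau> / 2} :: real \<Rightarrow> ennreal"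
  obtain c where c: "c > 0" "\<And>n. ennreal (c * lam ^ (2 * n) / real (Suc n))
    \<le> nu n (\<lambda>s. nu n (\<lambda>s'. ?h (s + s')))"
    using nu_nu_lower[of "\<tau> / 2"] assms by auto
  \<comment> \<open>The bound \<gamma>/2 puts the inserted increment into \<open>A\<close>, as
    \<open>nu\<close> requires.\<close>
  define r where "r = min (\<tau> / 2) (\<gamma> / 2)"
  have r: "r > 0" "r \<le> \<tau> / 2" "r \<le> \<gamma> / 2" using assms \<gamma>_pos by (auto simp: r_def)
  obtain m0 where m0: "(\<integral>\<^sup>+x. e1 x * indicator {-r..r} x \<partial>lborel) = ennreal m0" "m0 > 0"
  proof -
    have "(\<integral>\<^sup>+x. e1 x * indicator {-r..r} x \<partial>lborel) > 0" "(\<integral>\<^sup>+x. e1 x * indicator {-r..r} x \<partial>lborel) < \<infinity>"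
      using nn_integral_e1_interval[of "-r" r] r by auto
    then show thesis
      by (intro that[of "enn2real (\<integral>\<^sup>+x. e1 x * indicator {-r..r} x \<partial>lborel)"])
        (auto simp: enn2real_positive_iff)
  qed
  have nu0: "nu 0 ?h \<ge> ennreal m0"
    unfolding m0(1)[symmetric] using r
    by (subst nu_eq) (auto simp: A_def indicator_def intro!: nn_integral_mono)
  have step: "g * (ennreal m0 * nu n (\<lambda>s'. ?h (s + s'))) \<le> nu (Suc n) (\<lambda>s'. indicator {- \<tau>..\<tau>} (s + s'))" for n s
  proof -
    have "g * (ennreal m0 * nu n (\<lambda>s'. ?h (s + s'))) \<le> g * (nu n (\<lambda>s'. ?h (s + s')) * nu 0 ?h)"
      using nu0 by (subst mult.commute[of "ennreal m0"]) (intro mult_left_mono, auto)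
    also have "nu n (\<lambda>s'. ?h (s + s')) * nu 0 ?h = nu 0 (\<lambda>u. nu n (\<lambda>s'. ?h (s + s')) * ?h u)"
      by (subst nu_cmult) auto
    also have "\<dots> = nu 0 (\<lambda>u. nu n (\<lambda>s'. ?h u * ?h (s + s')))"
      by (subst nu_cmult) (auto simp: mult.commute)
    also have "\<dots> \<le> nu 0 (\<lambda>u. nu n (\<lambda>s'. indicator {- \<tau>..\<tau>} (s + (u + s'))))"
      by (intro nu_mono) (auto simp: indicator_def)
    also have "g * \<dots> \<le> nu (0 + Suc n) (\<lambda>s'. indicator {- \<tau>..\<tau>} (s + s'))"
      by (rule nu_concat[of "\<lambda>s'. indicator {- \<tau>..\<tau>} (s + s')" 0 n]) simp
    finally show ?thesis by (simp add: mult_left_mono)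
  qed
  have "ennreal (gr * gr * m0 * c * lam ^ (2 * n) / real (Suc n)) \<le> nu (2 * n + 2) (indicator {- \<tau>..\<tau>})" for n
  proof -
    have "ennreal (gr * gr * m0 * c * lam ^ (2 * n) / real (Suc n))
        = g * ((g * ennreal m0) * ennreal (c * lam ^ (2 * n) / real (Suc n)))"
      unfolding g_gr using gr_pos c(1) lam_pos m0(2) by (simp add: ennreal_mult[symmetric] mult.assoc)
    also have "\<dots> \<le> g * ((g * ennreal m0) * nu n (\<lambda>s. nu n (\<lambda>s'. ?h (s + s'))))"
      by (intro mult_left_mono c) auto
    also have "\<dots> = g * nu n (\<lambda>s. g * (ennreal m0 * nu n (\<lambda>s'. ?h (s + s'))))"
      by (subst nu_cmult[symmetric]) (auto simp: mult.assoc)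
    also have "\<dots> \<le> g * nu n (\<lambda>s. nu (Suc n) (\<lambda>s'. indicator {- \<tau>..\<tau>} (s + s')))"
      by (intro mult_left_mono nu_mono step) auto
    also have "\<dots> \<le> nu (n + Suc (Suc n)) (indicator {- \<tau>..\<tau>})"
      by (intro nu_concat) auto
    finally show ?thesis by (simp add: mult_2)
  qed
  then show ?thesis using gr_pos c(1) m0(2) by (intro exI[of _ "gr * gr * m0 * c"]) auto
qed

text \<open>The increments x, -s, 0 all lie in \<open>A\<close>, so both interactions in
  \<open>fin\<close> are at least \<open>g\<close>.\<close>

lemma fin_lower:
  "g * g * e1 0 * (e1 s * iA s * iA x) \<le> fin s x"
proof (cases "s \<in> A \<and> x \<in> A")
  case True
  then have "g \<le> q x (- s)" "g \<le> q (- s) 0"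
    by (auto intro!: g_le_q simp: A_def)
  then have "(g * e1 s) * (g * e1 0) \<le> (q x (- s) * e1 s) * (q (- s) 0 * e1 0)"
    by (intro mult_mono) auto
  then show ?thesis using True by (simp add: fin_def k_eq e1_minus mult_ac)
qed auto

text \<open>Return to an interval becomes return to 0. One extra increment at the front smooths the
  height, so that the weight \<open>e1 s * iA s\<close> of the closing jump -s has a positive
  average; one more step starts the path from increment 0, which lies in \<open>A\<close>. Hence the
  index \<open>n + 2\<close>.\<close>

lemma KK_funpow_fin_ge_nu:
  "\<exists>\<kappa>>0. \<forall>n. ennreal \<kappa> * nu n (indicator {- (\<gamma> / 4)..\<gamma> / 4}) \<le> (KK ^^ (n + 2)) fin 0 0"
proof -
  obtain \<kappa> where \<kappa>: "\<kappa> > 0" "\<And>s. \<bar>s\<bar> \<le> \<gamma> / 4 \<Longrightarrow>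
      ennreal \<kappa> \<le> (\<integral>\<^sup>+z. e1 z * iA z * (e1 (s + z) * iA (s + z)) \<partial>lborel)"
    using self_convolution_lower by blast
  let ?\<rho> = "\<lambda>s. e1 s * iA s"
  let ?c = "g * g * e1 0"
  have 1: "g * ennreal \<kappa> * nu n (indicator {- (\<gamma> / 4)..\<gamma> / 4}) \<le> nu (Suc n) ?\<rho>" for n
  proof -
    have "g * ennreal \<kappa> * nu n (indicator {- (\<gamma> / 4)..\<gamma> / 4})
        = g * nu n (\<lambda>s. ennreal \<kappa> * indicator {- (\<gamma> / 4)..\<gamma> / 4} s)"
      by (simp add: nu_cmult mult.assoc)
    also have "\<dots> \<le> g * nu n (\<lambda>s. \<integral>\<^sup>+z. e1 z * iA z * ?\<rho> (s + z) \<partial>lborel)"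
    proof (intro mult_left_mono nu_mono)
      fix s
      show "ennreal \<kappa> * indicator {- (\<gamma> / 4)..\<gamma> / 4} s \<le> (\<integral>\<^sup>+z. e1 z * iA z * ?\<rho> (s + z) \<partial>lborel)"
        using \<kappa>(2)[of s] by (cases "s \<in> {- (\<gamma> / 4)..\<gamma> / 4}") (auto simp: abs_le_iff)
    qed auto
    also have "\<dots> \<le> nu (Suc n) ?\<rho>" by (intro nu_front) auto
    finally show ?thesis .
  qed
  have 2: "g * ?c * nu n ?\<rho> \<le> (KK ^^ Suc n) fin 0 0" for n
  proof -
    have "g * ?c * nu n ?\<rho> = (\<integral>\<^sup>+y. g * (e1 y * iA y) * (?c * (KK ^^ n) (\<lambda>s y. ?\<rho> s * iA y) y y) \<partial>lborel)"
      by (simp add: nu_eq nn_integral_cmult[symmetric] mult_ac)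
    also have "\<dots> \<le> (\<integral>\<^sup>+y. k 0 y * (KK ^^ n) fin y y \<partial>lborel)"
    proof (intro nn_integral_mono mult_mono)
      fix y
      show "g * (e1 y * iA y) \<le> k 0 y" by (rule g_le_k) (use \<gamma>_pos in \<open>simp add: A_def\<close>)
      have "?c * (KK ^^ n) (\<lambda>s y. ?\<rho> s * iA y) y y = (KK ^^ n) (\<lambda>s y. ?c * (?\<rho> s * iA y)) y y"
        by (subst KK_funpow_cmult) auto
      also have "\<dots> \<le> (KK ^^ n) fin y y"
        by (intro KK_funpow_mono fin_lower)
      finally show "?c * (KK ^^ n) (\<lambda>s y. ?\<rho> s * iA y) y y \<le> (KK ^^ n) fin y y" .
    qed auto
    also have "\<dots> = (KK ^^ Suc n) fin 0 0"
      by (simp add: KK_def[of "(KK ^^ n) fin"])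
    finally show ?thesis .
  qed
  define \<kappa>' where "\<kappa>' = gr * (gr * gr * exp (- V1 0)) * (gr * \<kappa>)"
  have eq: "ennreal \<kappa>' = g * ?c * (g * ennreal \<kappa>)"
    unfolding \<kappa>'_def g_gr e1_def using gr_pos \<kappa>(1) by (simp add: ennreal_mult)
  have "ennreal \<kappa>' * nu n (indicator {- (\<gamma> / 4)..\<gamma> / 4}) \<le> (KK ^^ (n + 2)) fin 0 0" for n
  proof -
    have "ennreal \<kappa>' * nu n (indicator {- (\<gamma> / 4)..\<gamma> / 4})
        = g * ?c * (g * ennreal \<kappa> * nu n (indicator {- (\<gamma> / 4)..\<gamma> / 4}))"
      unfolding eq by (simp only: mult.assoc)
    also have "\<dots> \<le> g * ?c * nu (Suc n) ?\<rho>" by (intro mult_left_mono 1) auto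
    also have "\<dots> \<le> (KK ^^ Suc (Suc n)) fin 0 0" by (rule 2)
    finally show ?thesis by (simp only: add_2_eq_Suc')
  qed
  moreover have "\<kappa>' > 0" using gr_pos \<kappa>(1) by (simp add: \<kappa>'_def)
  ultimately show ?thesis by blast
qed

lemma KK_funpow_fin_lower:
  "\<exists>c>0. \<forall>n\<ge>3. ennreal (c * lam ^ n / real (Suc n)) \<le> (KK ^^ n) fin 0 0"
proof -
  have "\<gamma> / 4 > 0" using \<gamma>_pos by simp
  \<comment> \<open>These \<open>c1\<close> and \<open>c2\<close> are local and shadow the bounds on
    the site weight and the interaction.\<close>
  obtain c1 where c1: "c1 > 0" "\<And>n. ennreal (c1 * lam ^ (2 * n) / real (Suc n))
      \<le> nu (2 * n + 1) (indicator {- (\<gamma> / 4)..\<gamma> / 4})"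
    using nu_return_odd[OF \<open>\<gamma> / 4 > 0\<close>] by blast
  obtain c2 where c2: "c2 > 0" "\<And>n. ennreal (c2 * lam ^ (2 * n) / real (Suc n))
      \<le> nu (2 * n + 2) (indicator {- (\<gamma> / 4)..\<gamma> / 4})"
    using nu_return_even[OF \<open>\<gamma> / 4 > 0\<close>] by blast
  obtain \<kappa> where \<kappa>: "\<kappa> > 0" "\<And>n. ennreal \<kappa> * nu n (indicator {- (\<gamma> / 4)..\<gamma> / 4}) \<le> (KK ^^ (n + 2)) fin 0 0"
    using KK_funpow_fin_ge_nu by blast
  \<comment> \<open>Exponents 3 and 4: the number of steps is 2j + 3 or 2j + 4, against the power 2j
    of \<open>lam\<close> in the return bounds.\<close>
  define c where "c = min (\<kappa> * c1 / lam ^ 3) (\<kappa> * c2 / lam ^ 4)"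
  have bound: "ennreal (c * lam ^ n / real (Suc n)) \<le> (KK ^^ n) fin 0 0"
    if n: "n = 2 * j + i + 2" and ci: "ci > 0" "c \<le> \<kappa> * ci / lam ^ (i + 2)"
      "ennreal (ci * lam ^ (2 * j) / real (Suc j)) \<le> nu (2 * j + i) (indicator {- (\<gamma> / 4)..\<gamma> / 4})" for n j i ci
  proof -
    have "c * lam ^ n / real (Suc n) \<le> \<kappa> * ci / lam ^ (i + 2) * lam ^ n / real (Suc j)"
      using ci \<kappa>(1) lam_pos n by (intro frac_le mult_right_mono) auto
    also have "\<dots> = \<kappa> * (ci * lam ^ (2 * j) / real (Suc j))"
    proof -
      have "lam ^ n = lam ^ (i + 2) * lam ^ (2 * j)" by (simp add: n power_add[symmetric] add_ac)
      then show ?thesis using lam_pos by simp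
    qed
    finally have "ennreal (c * lam ^ n / real (Suc n)) \<le> ennreal (\<kappa> * (ci * lam ^ (2 * j) / real (Suc j)))"
      by (rule ennreal_leI)
    also have "\<dots> = ennreal \<kappa> * ennreal (ci * lam ^ (2 * j) / real (Suc j))"
      using \<kappa>(1) ci(1) lam_pos by (intro ennreal_mult) auto
    also have "\<dots> \<le> ennreal \<kappa> * nu (2 * j + i) (indicator {- (\<gamma> / 4)..\<gamma> / 4})"
      by (intro mult_left_mono ci) auto
    also have "\<dots> \<le> (KK ^^ n) fin 0 0" unfolding n by (rule \<kappa>)
    finally show ?thesis .
  qed
  have "ennreal (c * lam ^ n / real (Suc n)) \<le> (KK ^^ n) fin 0 0" if "n \<ge> 3" for n
  proof (cases "odd n")
    case True
    then obtain j where "n = 2 * j + 1" by (auto elim: oddE)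
    then have "n = 2 * (j - 1) + 1 + 2" using that by simp
    moreover have "c \<le> \<kappa> * c1 / lam ^ (1 + 2)" by (simp add: c_def numeral_3_eq_3)
    ultimately show ?thesis using c1(1) c1(2)[of "j - 1"] bound[of n "j - 1" 1 c1] by blast
  next
    case False
    then obtain j where "n = 2 * j" by auto
    then have "n = 2 * (j - 2) + 2 + 2" using that by simp
    moreover have "c \<le> \<kappa> * c2 / lam ^ (2 + 2)" by (simp add: c_def)
    ultimately show ?thesis using c2(1) c2(2)[of "j - 2"] bound[of n "j - 2" 2 c2] by blast
  qed
  moreover have "c > 0" using \<kappa>(1) c1(1) c2(1) lam_pos by (simp add: c_def)
  ultimately show ?thesis by blast
qed

lemma k_le: "k x y \<le> ennreal (c1 * c2)"
  unfolding k_eq using c1_pos c2_pos by (subst ennreal_mult) (auto intro!: mult_mono e1_le q_le)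

lemma fin_le: "fin s x \<le> ennreal ((c1 * c2)\<^sup>2)"
proof -
  have "fin s x \<le> ennreal (c1 * c2) * ennreal (c1 * c2)"
    unfolding fin_def by (intro mult_mono k_le) auto
  then show ?thesis using c1_pos c2_pos by (simp add: ennreal_mult[symmetric] power2_eq_square)
qed

text \<open>The return condition is dropped: \<open>fin\<close> is bounded, and what remains is the
  total mass of \<open>n\<close> steps.\<close>

lemma KK_funpow_fin_upper: "\<exists>C>0. \<forall>n. (KK ^^ n) fin 0 0 \<le> ennreal (C * lam ^ n)"
proof -
  obtain B where B: "B > 0" "\<And>n x. (K ^^ n) (\<lambda>_. 1) x \<le> ennreal (B * lam ^ n)"
    using K_power_upper by blast
  have "(KK ^^ n) fin 0 0 \<le> ennreal ((c1 * c2)\<^sup>2 * B * lam ^ n)" for n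
  proof -
    have "(KK ^^ n) fin 0 0 \<le> (KK ^^ n) (\<lambda>s y. ennreal ((c1 * c2)\<^sup>2) * 1) 0 0"
      by (intro KK_funpow_mono) (simp only: mult_1_right fin_le)
    also have "\<dots> = ennreal ((c1 * c2)\<^sup>2) * (K ^^ n) (\<lambda>_. 1) 0"
      by (subst KK_funpow_cmult) (auto simp: KK_funpow_const)
    also have "\<dots> \<le> ennreal ((c1 * c2)\<^sup>2) * ennreal (B * lam ^ n)"
      by (intro mult_left_mono B) auto
    also have "\<dots> = ennreal ((c1 * c2)\<^sup>2 * B * lam ^ n)"
      using B(1) lam_pos by (subst ennreal_mult[symmetric]) (auto simp: mult.assoc)
    finally show ?thesis .
  qed
  then show ?thesis using B(1) c1_pos c2_pos by (intro exI[of _ "(c1 * c2)\<^sup>2 * B"]) auto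
qed

end

text \<open>The divergence of the harmonic series turns the lower bound \<open>c L\<^sup>n / n\<close> for the
  excursions into exponential growth at a rate larger than \<open>L\<close>.\<close>

lemma renewal_growth:
  fixes y z :: "nat \<Rightarrow> real"
  assumes L: "L > 0" and c: "c > 0" and e: "e > 0"
    and y: "\<And>n. n \<ge> 3 \<Longrightarrow> c * L ^ n / real (Suc n) \<le> y n" and y0: "\<And>n. y n \<ge> 0"
    and z: "\<And>n. y n \<le> z n"
    and renewal: "\<And>n. e * (\<Sum>j<n. y j * z (n - Suc j)) \<le> z (Suc n)"
  shows "\<exists>\<mu>>L. \<exists>b>0. \<forall>n\<ge>3. b * \<mu> ^ n \<le> z n"
proof -
  have z0: "z n \<ge> 0" for n using y0[of n] z[of n] by linarith
  have "\<forall>\<^sub>F n in sequentially. (harm n :: real) \<ge> harm 3 + 2 * L\<^sup>2 / (e * c)"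
    using harm_at_top by (simp add: filterlim_at_top)
  then obtain J where J: "J > 3" "(harm J :: real) \<ge> harm 3 + 2 * L\<^sup>2 / (e * c)"
    by (metis eventually_at_top_linorder max.cobounded1 max.cobounded2 less_Suc_eq_le le_SucI)
  have "harm J = (harm 3 :: real) + (\<Sum>j\<in>{3..<J}. 1 / real (Suc j))"
  proof -
    have "harm J = (\<Sum>j<J. 1 / real (Suc j))" for J
      by (simp add: harm_def inverse_eq_divide sum.atLeast1_atMost_eq)
    moreover have "{..<J} = {..<3} \<union> {3..<J}" using J by auto
    ultimately show ?thesis by (simp only:) (subst sum.union_disjoint; auto)
  qed
  with J have S: "2 * L\<^sup>2 \<le> e * c * (\<Sum>j\<in>{3..<J}. 1 / real (Suc j))"
    using e c by (simp add: pos_divide_le_eq mult.commute)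
  \<comment> \<open>For j < J the power \<open>\<rho> ^ (j + 2)\<close> is at most 2, so raising the
    rate from \<open>L\<close> to \<open>L * \<rho>\<close> costs a factor 2, already contained in
    the choice of \<open>J\<close>.\<close>
  define \<rho> where "\<rho> = root (J + 1) 2"
  have \<rho>: "\<rho> > 1" "\<rho> ^ (J + 1) = 2"
    by (auto simp: \<rho>_def simp del: power_Suc)
  define \<mu> where "\<mu> = L * \<rho>"
  have \<mu>: "\<mu> > L" "\<mu> > 0" using L \<rho> by (auto simp: \<mu>_def)
  \<comment> \<open>The finitely many excursions suffice to make the renewal sum at rate \<mu> at
    least 1. The exponent is j + 2 because j free heights and the double contact shorten the path by
    j + 2.\<close>
  have S': "e * (\<Sum>j\<in>{3..<J}. y j / \<mu> ^ (j + 2)) \<ge> 1"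
  proof -
    have "e * c / (2 * L\<^sup>2) * (1 / real (Suc j)) \<le> e * (y j / \<mu> ^ (j + 2))" if j: "j \<in> {3..<J}" for j
    proof -
      have "\<rho> ^ (j + 2) \<le> \<rho> ^ (J + 1)" using j \<rho>(1) by (intro power_increasing) auto
      then have "\<mu> ^ (j + 2) \<le> L ^ (j + 2) * 2"
        using \<rho>(2) L by (simp add: \<mu>_def power_mult_distrib)
      then have "c * L ^ j / real (Suc j) / (L ^ (j + 2) * 2) \<le> y j / \<mu> ^ (j + 2)"
        using y[of j] j \<mu>(2) c L y0 by (intro frac_le) auto
      then have "e * (c * L ^ j / real (Suc j) / (L ^ (j + 2) * 2)) \<le> e * (y j / \<mu> ^ (j + 2))"
        using e by (intro mult_left_mono) auto
      moreover have "e * (c * L ^ j / real (Suc j) / (L ^ (j + 2) * 2)) = e * c / (2 * L\<^sup>2) * (1 / real (Suc j))"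
        using L by (simp add: power_add power2_eq_square)
      ultimately show ?thesis by simp
    qed
    then have "(\<Sum>j\<in>{3..<J}. e * c / (2 * L\<^sup>2) * (1 / real (Suc j))) \<le> (\<Sum>j\<in>{3..<J}. e * (y j / \<mu> ^ (j + 2)))"
      by (rule sum_mono)
    moreover have "1 \<le> e * c / (2 * L\<^sup>2) * (\<Sum>j\<in>{3..<J}. 1 / real (Suc j))"
      using S L by (simp add: field_simps)
    ultimately show ?thesis by (simp only: sum_distrib_left)
  qed
  have "z n / \<mu> ^ n > 0" if "n \<in> {3..<J + 6}" for n
  proof -
    have "0 < c * L ^ n / real (Suc n)" using c L by simp
    also have "\<dots> \<le> z n" using y[of n] z[of n] that by simp
    finally show ?thesis using \<mu> by simp
  qed
  \<comment> \<open>Past this initial range the indices \<open>n - 1 - Suc j\<close> with j < J are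
    still at least 3, so the induction hypothesis applies to them.\<close>
  then obtain b where b: "b > 0" "\<And>n. n \<in> {3..<J + 6} \<Longrightarrow> b \<le> z n / \<mu> ^ n"
    using finite_positive_lower_bound[of "{3..<J + 6}" "\<lambda>n. z n / \<mu> ^ n"] by auto
  have "b * \<mu> ^ n \<le> z n" if "n \<ge> 3" for n
    using that
  proof (induction n rule: less_induct)
    case (less n)
    show ?case
    proof (cases "n < J + 6")
      case True
      then show ?thesis using b(2)[of n] less.prems \<mu>(2) by (simp add: pos_le_divide_eq)
    next
      case False
      have "b * \<mu> ^ n \<le> e * (\<Sum>j\<in>{3..<J}. y j / \<mu> ^ (j + 2)) * (b * \<mu> ^ n)"
        using mult_right_mono[OF S', of "b * \<mu> ^ n"] b(1) \<mu>(2) by simp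
      also have "\<dots> = e * (\<Sum>j\<in>{3..<J}. y j * (b * \<mu> ^ (n - 1 - Suc j)))"
      proof -
        have "y j / \<mu> ^ (j + 2) * (b * \<mu> ^ n) = y j * (b * \<mu> ^ (n - 1 - Suc j))" if "j \<in> {3..<J}" for j
        proof -
          have "n = (n - 1 - Suc j) + (j + 2)" using that False by simp
          then have "\<mu> ^ n = \<mu> ^ (n - 1 - Suc j) * \<mu> ^ (j + 2)" by (metis power_add)
          then show ?thesis using \<mu>(2) by simp
        qed
        then show ?thesis by (simp add: sum_distrib_right mult.assoc)
      qed
      also have "\<dots> \<le> e * (\<Sum>j\<in>{3..<J}. y j * z (n - 1 - Suc j))"
        using e y0 False by (intro mult_left_mono sum_mono less.IH) auto
      also have "\<dots> \<le> e * (\<Sum>j<n - 1. y j * z (n - 1 - Suc j))"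
        using e y0 z0 False by (intro mult_left_mono sum_mono2) auto
      also have "\<dots> \<le> z (Suc (n - 1))" by (rule renewal)
      finally show ?thesis using False by simp
    qed
  qed
  then show ?thesis using \<mu>(1) b(1) by blast
qed

context pinning
begin

subsection \<open>The pinned partition function\<close>

lemma TT_mono: "(\<And>s y. F s y \<le> F' s y) \<Longrightarrow> TT \<epsilon> F s x \<le> TT \<epsilon> F' s x"
  unfolding TT_def PP_def by (intro add_mono mult_left_mono KK_mono) auto

lemma TT_funpow_mono: "(\<And>s y. F s y \<le> F' s y) \<Longrightarrow> (TT \<epsilon> ^^ n) F s x \<le> (TT \<epsilon> ^^ n) F' s x"
  by (induction n arbitrary: s x) (auto intro: TT_mono)

lemma TT_funpow_measurable [measurable]:
  assumes [measurable]: "case_prod F \<in> borel_measurable (borel \<Otimes>\<^sub>M borel)"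
  shows "case_prod ((TT \<epsilon> ^^ n) F) \<in> borel_measurable (borel \<Otimes>\<^sub>M borel)"
  by (induction n) auto

lemma KK_cmult:
  "case_prod F \<in> borel_measurable (borel \<Otimes>\<^sub>M borel) \<Longrightarrow> KK (\<lambda>s y. c * F s y) s x = c * KK F s x"
  using KK_funpow_cmult[of F 1 c] by (simp add: fun_eq_iff)

lemma KK_sum:
  assumes "finite I" "\<And>i. i \<in> I \<Longrightarrow> case_prod (F i) \<in> borel_measurable (borel \<Otimes>\<^sub>M borel)"
  shows "KK (\<lambda>s y. \<Sum>i\<in>I. F i s y) s x = (\<Sum>i\<in>I. KK (F i) s x)"
proof -
  have m: "(\<lambda>y. k x y * F i (s + y) y) \<in> borel_measurable lborel" if "i \<in> I" for i
  proof -
    note [measurable] = assms(2)[OF that]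
    show ?thesis by measurable
  qed
  show ?thesis
    unfolding KK_def[of "\<lambda>s y. \<Sum>i\<in>I. F i s y"] KK_def[of "F _"]
    by (simp add: sum_distrib_left nn_integral_sum[OF m])
qed

lemma TT_funpow_cmult:
  assumes [measurable]: "case_prod F \<in> borel_measurable (borel \<Otimes>\<^sub>M borel)"
  shows "(TT \<epsilon> ^^ n) (\<lambda>s y. c * F s y) = (\<lambda>s x. c * (TT \<epsilon> ^^ n) F s x)"
proof (induction n)
  case (Suc n)
  have "TT \<epsilon> (\<lambda>s x. c * (TT \<epsilon> ^^ n) F s x) s x = c * TT \<epsilon> ((TT \<epsilon> ^^ n) F) s x" for s x
    unfolding TT_def[of \<epsilon> "\<lambda>s x. c * (TT \<epsilon> ^^ n) F s x"] TT_def[of \<epsilon> "(TT \<epsilon> ^^ n) F"]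
    by (simp add: KK_cmult PP_def distrib_left mult_ac)
  then show ?case by (simp add: Suc fun_eq_iff)
qed simp

lemma TT_ge: "KK F s x \<le> TT \<epsilon> F s x" "ennreal \<epsilon> * PP F s x \<le> TT \<epsilon> F s x"
  by (auto simp: TT_def)

text \<open>Two pinned steps in a row carry exactly the weight \<open>fin\<close> and end in the
  state (0, 0), from which the path starts afresh.\<close>

lemma TT_TT_ge:
  assumes "\<epsilon> \<ge> 0"
  shows "ennreal (\<epsilon>\<^sup>2) * fin s x * F 0 0 \<le> ennreal \<epsilon> * PP (TT \<epsilon> F) s x"
proof -
  have "ennreal (\<epsilon>\<^sup>2) * fin s x * F 0 0 = ennreal \<epsilon> * PP (\<lambda>s x. ennreal \<epsilon> * PP F s x) s x"
    using assms by (simp add: PP_def fin_def power2_eq_square ennreal_mult mult_ac)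
  also have "\<dots> \<le> ennreal \<epsilon> * PP (TT \<epsilon> F) s x"
    unfolding PP_def[of "TT \<epsilon> F"] PP_def[of "\<lambda>s x. ennreal \<epsilon> * PP F s x"]
    by (intro mult_left_mono TT_ge) auto
  finally show ?thesis .
qed

text \<open>A double contact \<open>\<phi>\<^sub>i = \<phi>\<^sub>i\<^sub>+\<^sub>1 = 0\<close> splits the field into independent parts; the
  summation index is the position of the first such contact.\<close>

lemma TT_funpow_renewal:
  assumes \<epsilon>: "\<epsilon> \<ge> 0" and [measurable]: "case_prod F \<in> borel_measurable (borel \<Otimes>\<^sub>M borel)"
  shows "(\<Sum>j<n. ennreal (\<epsilon>\<^sup>2) * (TT \<epsilon> ^^ (n - Suc j)) F 0 0 * (KK ^^ j) fin s x) \<le> (TT \<epsilon> ^^ Suc n) F s x"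
proof (induction n arbitrary: s x)
  case (Suc n)
  let ?c = "\<lambda>n j. ennreal (\<epsilon>\<^sup>2) * (TT \<epsilon> ^^ (n - Suc j)) F 0 0"
  have "(\<Sum>j<Suc n. ?c (Suc n) j * (KK ^^ j) fin s x)
      = ?c (Suc n) 0 * fin s x + (\<Sum>j<n. ?c n j * KK ((KK ^^ j) fin) s x)"
    by (subst sum.lessThan_Suc_shift) simp
  also have "(\<Sum>j<n. ?c n j * KK ((KK ^^ j) fin) s x) = KK (\<lambda>s x. \<Sum>j<n. ?c n j * (KK ^^ j) fin s x) s x"
    by (subst KK_sum) (auto simp: KK_cmult)
  \<comment> \<open>The term of index 0 is paid by the pinned branch of the first step, all others
    by its free branch, where the induction hypothesis applies.\<close>
  also have "?c (Suc n) 0 * fin s x + \<dots> \<le> ennreal \<epsilon> * PP (TT \<epsilon> ((TT \<epsilon> ^^ n) F)) s x + KK ((TT \<epsilon> ^^ Suc n) F) s x"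
  proof (intro add_mono KK_mono Suc)
    show "?c (Suc n) 0 * fin s x \<le> ennreal \<epsilon> * PP (TT \<epsilon> ((TT \<epsilon> ^^ n) F)) s x"
      using TT_TT_ge[OF \<epsilon>, of s x "(TT \<epsilon> ^^ n) F"] by (simp add: mult_ac)
  qed
  also have "\<dots> = (TT \<epsilon> ^^ Suc (Suc n)) F s x"
    by (simp add: TT_def[of \<epsilon> "TT \<epsilon> _"])
  finally show ?case .
qed simp

text \<open>Forcing a double contact at the junction costs \<epsilon>^2 and occupies two
  heights.\<close>

lemma TT_funpow_super:
  assumes \<epsilon>: "\<epsilon> \<ge> 0"
  shows "ennreal (\<epsilon>\<^sup>2) * (TT \<epsilon> ^^ m) fin 0 0 * (TT \<epsilon> ^^ n) fin 0 0 \<le> (TT \<epsilon> ^^ (m + n + 2)) fin 0 0"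
proof -
  let ?c = "ennreal (\<epsilon>\<^sup>2) * (TT \<epsilon> ^^ n) fin 0 0"
  have "?c * fin s x \<le> TT \<epsilon> (TT \<epsilon> ((TT \<epsilon> ^^ n) fin)) s x" for s x
    using order_trans[OF TT_TT_ge[OF \<epsilon>, of s x "(TT \<epsilon> ^^ n) fin"] TT_ge(2)] by (simp add: mult_ac)
  then have "(TT \<epsilon> ^^ m) (\<lambda>s x. ?c * fin s x) 0 0 \<le> (TT \<epsilon> ^^ m) (TT \<epsilon> (TT \<epsilon> ((TT \<epsilon> ^^ n) fin))) 0 0"
    by (intro TT_funpow_mono)
  also have "(TT \<epsilon> ^^ m) (TT \<epsilon> (TT \<epsilon> ((TT \<epsilon> ^^ n) fin))) = (TT \<epsilon> ^^ (m + n + 2)) fin"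
  proof -
    have "(TT \<epsilon> ^^ m) ((TT \<epsilon> ^^ Suc (Suc n)) fin) = (TT \<epsilon> ^^ (m + Suc (Suc n))) fin"
      by (simp only: funpow_add comp_apply)
    moreover have "m + Suc (Suc n) = m + n + 2" by simp
    ultimately show ?thesis by (simp only: funpow.simps comp_apply)
  qed
  finally have "?c * (TT \<epsilon> ^^ m) fin 0 0 \<le> (TT \<epsilon> ^^ (m + n + 2)) fin 0 0"
    by (subst (asm) TT_funpow_cmult) (rule fin_measurable)
  then show ?thesis by (simp only: mult_ac)
qed

lemma TT_funpow_ge_KK: "(KK ^^ n) F s x \<le> (TT \<epsilon> ^^ n) F s x"
proof (induction n arbitrary: s x)
  case (Suc n)
  have "KK ((KK ^^ n) F) s x \<le> KK ((TT \<epsilon> ^^ n) F) s x" by (intro KK_mono Suc)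
  also have "\<dots> \<le> TT \<epsilon> ((TT \<epsilon> ^^ n) F) s x" by (rule TT_ge)
  finally show ?case by simp
qed simp

lemma TT_funpow_upper:
  assumes "\<epsilon> \<ge> 0"
  shows "(TT \<epsilon> ^^ n) fin s x \<le> ennreal ((c1 * c2)\<^sup>2 * (\<epsilon> * c1 * c2 + c1 * C0) ^ n)"
proof (induction n arbitrary: s x)
  case (Suc n)
  let ?\<Gamma> = "\<epsilon> * c1 * c2 + c1 * C0" and ?b = "\<lambda>n. ennreal ((c1 * c2)\<^sup>2 * (\<epsilon> * c1 * c2 + c1 * C0) ^ n)"
  have \<Gamma>: "?\<Gamma> \<ge> 0" using assms c1_pos c2_pos C0_nonneg by simp
  have "TT \<epsilon> ((TT \<epsilon> ^^ n) fin) s x \<le> TT \<epsilon> (\<lambda>s y. ?b n * 1) s x"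
    by (intro TT_mono) (simp only: mult_1_right Suc)
  also have "\<dots> = ennreal \<epsilon> * (k x (- s) * ?b n) + ?b n * K (\<lambda>_. 1) x"
    unfolding TT_def by (subst KK_cmult) (auto simp: PP_def KK_def K_def)
  also have "\<dots> \<le> ennreal \<epsilon> * (ennreal (c1 * c2) * ?b n) + ?b n * ennreal (c1 * C0)"
    by (intro add_mono mult_left_mono mult_right_mono k_le K_1_le) auto
  also have "\<dots> = ennreal (\<epsilon> * (c1 * c2 * ((c1 * c2)\<^sup>2 * ?\<Gamma> ^ n)) + (c1 * c2)\<^sup>2 * ?\<Gamma> ^ n * (c1 * C0))"
    using assms c1_pos c2_pos C0_nonneg \<Gamma> by (simp add: ennreal_mult ennreal_plus del: ennreal_power)
  also have "\<epsilon> * (c1 * c2 * ((c1 * c2)\<^sup>2 * ?\<Gamma> ^ n)) + (c1 * c2)\<^sup>2 * ?\<Gamma> ^ n * (c1 * C0) = (c1 * c2)\<^sup>2 * ?\<Gamma> ^ Suc n"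
    by (simp add: algebra_simps)
  finally show ?case by simp
qed (simp add: fin_le)

end

section \<open>Existence and positivity of the free energy\<close>

lemma affine_div_tendsto:
  fixes A B :: real
  shows "(\<lambda>n. (A + real n * B) / real (Suc n)) \<longlonglongrightarrow> B"
proof -
  have "(\<lambda>n. B + (A - B) * inverse (real (Suc n))) \<longlonglongrightarrow> B + (A - B) * 0"
    by (intro tendsto_intros LIMSEQ_inverse_real_of_nat)
  moreover have "B + (A - B) * inverse (real (Suc n)) = (A + real n * B) / real (Suc n)" for n
    by (simp add: field_simps)
  ultimately show ?thesis by simp
qed

context pinning
begin

definition yr :: "nat \<Rightarrow> real" where "yr n = enn2real ((KK ^^ n) fin 0 0)"
definition zr :: "real \<Rightarrow> nat \<Rightarrow> real" where "zr \<epsilon> n = enn2real ((TT \<epsilon> ^^ n) fin 0 0)"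

lemma yr_nonneg: "yr n \<ge> 0"
  by (simp add: yr_def)

lemma ennreal_yr: "(KK ^^ n) fin 0 0 = ennreal (yr n)"
proof -
  obtain C where "\<And>n. (KK ^^ n) fin 0 0 \<le> ennreal (C * lam ^ n)" using KK_funpow_fin_upper by blast
  from le_less_trans[OF this[of n] ennreal_less_top] show ?thesis by (simp add: yr_def)
qed

lemma ennreal_zr: "\<epsilon> \<ge> 0 \<Longrightarrow> (TT \<epsilon> ^^ n) fin 0 0 = ennreal (zr \<epsilon> n)"
  unfolding zr_def using le_less_trans[OF TT_funpow_upper ennreal_less_top, of \<epsilon> n 0 0] by simp

lemma free_energy_N_Suc:
  "free_energy_N V1 V2 \<epsilon> (Suc n) = ln (zr \<epsilon> n / yr n) / real (Suc n)"
  by (simp add: free_energy_N_def partition_fn_eq TT_0 yr_def zr_def)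

text \<open>The upper and lower bounds differ by a polynomial factor, whose logarithm is negligible
  against n.\<close>

lemma ln_yr_lim: "(\<lambda>n. ln (yr n) / real (Suc n)) \<longlonglongrightarrow> ln lam"
proof -
  obtain C where C: "C > 0" "\<And>n. (KK ^^ n) fin 0 0 \<le> ennreal (C * lam ^ n)"
    using KK_funpow_fin_upper by blast
  obtain c where c: "c > 0" "\<And>n. n \<ge> 3 \<Longrightarrow> ennreal (c * lam ^ n / real (Suc n)) \<le> (KK ^^ n) fin 0 0"
    using KK_funpow_fin_lower by blast
  have up: "yr n \<le> C * lam ^ n" for n
    using C(2)[of n] C(1) lam_pos by (simp add: ennreal_yr)
  have low: "c * lam ^ n / real (Suc n) \<le> yr n" if "n \<ge> 3" for n
    using c(2)[OF that] yr_nonneg[of n] by (simp only: ennreal_yr ennreal_le_iff)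
  show ?thesis
  proof (rule tendsto_sandwich)
    show "\<forall>\<^sub>F n in sequentially. (ln c + real n * ln lam - ln (real (Suc n))) / real (Suc n) \<le> ln (yr n) / real (Suc n)"
      using eventually_ge_at_top[of 3]
    proof eventually_elim
      case (elim n)
      have "0 < c * lam ^ n / real (Suc n)" using c(1) lam_pos by simp
      then have "ln (c * lam ^ n / real (Suc n)) \<le> ln (yr n)" using low[OF elim] by (intro ln_mono) auto
      moreover have "ln (c * lam ^ n / real (Suc n)) = ln c + real n * ln lam - ln (real (Suc n))"
        using c(1) lam_pos by (simp add: ln_div ln_mult_pos ln_realpow del: of_nat_Suc)
      ultimately show ?case by (intro divide_right_mono) auto
    qed
    show "\<forall>\<^sub>F n in sequentially. ln (yr n) / real (Suc n) \<le> (ln C + real n * ln lam) / real (Suc n)"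
      using eventually_ge_at_top[of 3]
    proof eventually_elim
      case (elim n)
      have "0 < c * lam ^ n / real (Suc n)" using c(1) lam_pos by simp
      then have "ln (yr n) \<le> ln (C * lam ^ n)" using low[OF elim] up[of n] by (intro ln_mono) linarith+
      then show ?case using C(1) lam_pos by (intro divide_right_mono) (auto simp: ln_mult_pos ln_realpow)
    qed
    have "(\<lambda>n. (ln c + real n * ln lam) / real (Suc n) - ln (real (Suc n)) / real (Suc n)) \<longlonglongrightarrow> ln lam - 0"
      by (intro tendsto_diff affine_div_tendsto LIMSEQ_Suc[OF lim_ln_over_n])
    then show "(\<lambda>n. (ln c + real n * ln lam - ln (real (Suc n))) / real (Suc n)) \<longlonglongrightarrow> ln lam"
      by (simp only: diff_divide_distrib diff_zero)
    show "(\<lambda>n. (ln C + real n * ln lam) / real (Suc n)) \<longlonglongrightarrow> ln lam"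
      by (rule affine_div_tendsto)
  qed
qed

text \<open>The limit is l - ln lam, where l is the Fekete rate of the pinned weights; renewal
  growth gives l at least ln \<mu> with \<mu> > lam.\<close>

lemma free_energy_pos:
  assumes \<epsilon>: "\<epsilon> > 0"
  shows "\<exists>F. (free_energy_N V1 V2 \<epsilon>) \<longlonglongrightarrow> F \<and> F > 0"
proof -
  obtain c where c: "c > 0" "\<And>n. n \<ge> 3 \<Longrightarrow> ennreal (c * lam ^ n / real (Suc n)) \<le> (KK ^^ n) fin 0 0"
    using KK_funpow_fin_lower by blast
  have low: "c * lam ^ n / real (Suc n) \<le> yr n" if "n \<ge> 3" for n
    using c(2)[OF that] yr_nonneg[of n] by (simp only: ennreal_yr ennreal_le_iff)
  note yr0 = yr_nonneg
  have zr0: "zr \<epsilon> n \<ge> 0" for n by (simp add: zr_def)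
  have yz: "yr n \<le> zr \<epsilon> n" for n
    using TT_funpow_ge_KK[of n fin 0 0 \<epsilon>] \<epsilon> zr0 by (simp add: ennreal_yr ennreal_zr)
  have ypos: "yr n > 0" if "n \<ge> 3" for n
  proof -
    have "0 < c * lam ^ n / real (Suc n)" using c(1) lam_pos by simp
    then show ?thesis using low[OF that] by linarith
  qed
  have zpos: "zr \<epsilon> n > 0" if "n \<ge> 3" for n using ypos[OF that] yz[of n] by linarith
  have renewal: "\<epsilon>\<^sup>2 * (\<Sum>j<n. yr j * zr \<epsilon> (n - Suc j)) \<le> zr \<epsilon> (Suc n)" for n
  proof -
    have "ennreal (\<epsilon>\<^sup>2 * (\<Sum>j<n. yr j * zr \<epsilon> (n - Suc j)))
        = (\<Sum>j<n. ennreal (\<epsilon>\<^sup>2 * zr \<epsilon> (n - Suc j) * yr j))"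
      using yr0 zr0 by (subst sum_ennreal) (auto simp: sum_distrib_left mult_ac)
    also have "\<dots> = (\<Sum>j<n. ennreal (\<epsilon>\<^sup>2) * (TT \<epsilon> ^^ (n - Suc j)) fin 0 0 * (KK ^^ j) fin 0 0)"
      using \<epsilon> yr0 zr0 by (simp only: ennreal_zr ennreal_yr less_imp_le ennreal_mult mult_nonneg_nonneg zero_le_power2)
    also have "\<dots> \<le> (TT \<epsilon> ^^ Suc n) fin 0 0" using \<epsilon> by (intro TT_funpow_renewal) auto
    finally show ?thesis using \<epsilon> zr0 by (simp only: ennreal_zr less_imp_le ennreal_le_iff)
  qed
  obtain \<mu> b where \<mu>: "\<mu> > lam" and b: "b > 0" "\<And>n. n \<ge> 3 \<Longrightarrow> b * \<mu> ^ n \<le> zr \<epsilon> n"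
    using renewal_growth[OF lam_pos c(1), of "\<epsilon>\<^sup>2" yr "zr \<epsilon>"] low yr0 yz renewal \<epsilon> by auto
  have \<mu>0: "\<mu> > 0" using \<mu> lam_pos by linarith
  let ?\<Gamma> = "\<epsilon> * c1 * c2 + c1 * C0"
  define t where "t = max 1 (max (\<epsilon>\<^sup>2 * (c1 * c2)\<^sup>2) ?\<Gamma>)"
  \<comment> \<open>The shift by 2 turns the index \<open>m + n + 2\<close> of
    \<open>TT_funpow_super\<close> into a sum of indices. From index 5 on the argument
    \<open>n - 2\<close> is at least 3, where positivity is known.\<close>
  let ?a = "\<lambda>n. ln (\<epsilon>\<^sup>2 * zr \<epsilon> (n - 2))"
  have "\<exists>l. (\<lambda>n. ?a n / real n) \<longlonglongrightarrow> l \<and> (\<forall>n\<ge>5. ?a n \<le> l * real n)"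
  proof (rule superadditive_limit)
    fix m n :: nat assume mn: "m \<ge> 5" "n \<ge> 5"
    then have pos: "zr \<epsilon> (m - 2) > 0" "zr \<epsilon> (n - 2) > 0" by (auto intro!: zpos)
    have "ennreal (\<epsilon>\<^sup>2) * ennreal (zr \<epsilon> (m - 2)) * ennreal (zr \<epsilon> (n - 2)) \<le> ennreal (zr \<epsilon> (m - 2 + (n - 2) + 2))"
      using TT_funpow_super[of \<epsilon> "m - 2" "n - 2"] \<epsilon> by (simp only: ennreal_zr less_imp_le)
    moreover have "m - 2 + (n - 2) + 2 = m + n - 2" using mn by simp
    ultimately have "ennreal (\<epsilon>\<^sup>2 * zr \<epsilon> (m - 2) * zr \<epsilon> (n - 2)) \<le> ennreal (zr \<epsilon> (m + n - 2))"
      using zr0 by (simp only: ennreal_mult mult_nonneg_nonneg zero_le_power2)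
    then have "\<epsilon>\<^sup>2 * zr \<epsilon> (m - 2) * zr \<epsilon> (n - 2) \<le> zr \<epsilon> (m + n - 2)"
      using zr0 by (simp only: ennreal_le_iff)
    then have "\<epsilon>\<^sup>2 * (\<epsilon>\<^sup>2 * zr \<epsilon> (m - 2) * zr \<epsilon> (n - 2)) \<le> \<epsilon>\<^sup>2 * zr \<epsilon> (m + n - 2)"
      by (intro mult_left_mono) auto
    then have "(\<epsilon>\<^sup>2 * zr \<epsilon> (m - 2)) * (\<epsilon>\<^sup>2 * zr \<epsilon> (n - 2)) \<le> \<epsilon>\<^sup>2 * zr \<epsilon> (m + n - 2)"
      by (simp only: mult_ac)
    then have "ln ((\<epsilon>\<^sup>2 * zr \<epsilon> (m - 2)) * (\<epsilon>\<^sup>2 * zr \<epsilon> (n - 2))) \<le> ?a (m + n)"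
      using \<epsilon> pos by (intro ln_mono) auto
    then show "?a m + ?a n \<le> ?a (m + n)"
      using \<epsilon> pos by (subst (asm) ln_mult_pos) auto
  next
    fix n :: nat assume n: "n \<ge> 5"
    have \<Gamma>: "?\<Gamma> \<ge> 0" using \<epsilon> c1_pos c2_pos C0_nonneg by simp
    have "ennreal (zr \<epsilon> (n - 2)) \<le> ennreal ((c1 * c2)\<^sup>2 * ?\<Gamma> ^ (n - 2))"
      using TT_funpow_upper[of \<epsilon> "n - 2" 0 0] \<epsilon> by (simp only: ennreal_zr less_imp_le)
    then have "zr \<epsilon> (n - 2) \<le> (c1 * c2)\<^sup>2 * ?\<Gamma> ^ (n - 2)"
      using \<Gamma> by (subst (asm) ennreal_le_iff) auto
    then have "\<epsilon>\<^sup>2 * zr \<epsilon> (n - 2) \<le> \<epsilon>\<^sup>2 * ((c1 * c2)\<^sup>2 * ?\<Gamma> ^ (n - 2))"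
      by (intro mult_left_mono) auto
    also have "\<dots> = \<epsilon>\<^sup>2 * (c1 * c2)\<^sup>2 * ?\<Gamma> ^ (n - 2)" by (simp only: mult.assoc)
    also have "\<dots> \<le> t * t ^ (n - 2)"
      using \<Gamma> by (intro mult_mono power_mono) (auto simp: t_def)
    also have "\<dots> \<le> t ^ n"
      using n by (subst power_Suc[symmetric], intro power_increasing) (auto simp: t_def)
    finally have "\<epsilon>\<^sup>2 * zr \<epsilon> (n - 2) \<le> t ^ n" .
    then have "?a n \<le> ln (t ^ n)" using \<epsilon> zpos[of "n - 2"] n by (intro ln_mono) auto
    also have "\<dots> = ln t * real n" by (simp add: t_def ln_realpow mult.commute)
    finally show "?a n \<le> ln t * real n" .
  qed simp
  then obtain l where l: "(\<lambda>n. ?a n / real n) \<longlonglongrightarrow> l" by blast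
  have "ln \<mu> \<le> l"
  proof (rule LIMSEQ_le)
    show "(\<lambda>n. (ln (\<epsilon>\<^sup>2 * b) - 2 * ln \<mu> + real n * ln \<mu>) / real n) \<longlonglongrightarrow> ln \<mu>"
    proof (rule LIMSEQ_imp_Suc)
      have "ln (\<epsilon>\<^sup>2 * b) - 2 * ln \<mu> + real (Suc n) * ln \<mu> = (ln (\<epsilon>\<^sup>2 * b) - ln \<mu>) + real n * ln \<mu>" for n
        by (simp add: algebra_simps)
      then show "(\<lambda>n. (ln (\<epsilon>\<^sup>2 * b) - 2 * ln \<mu> + real (Suc n) * ln \<mu>) / real (Suc n)) \<longlonglongrightarrow> ln \<mu>"
        using affine_div_tendsto[of "ln (\<epsilon>\<^sup>2 * b) - ln \<mu>" "ln \<mu>"] by (simp only:)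
    qed
    show "\<exists>N. \<forall>n\<ge>N. (ln (\<epsilon>\<^sup>2 * b) - 2 * ln \<mu> + real n * ln \<mu>) / real n \<le> ?a n / real n"
    proof (intro exI[of _ 5] allI impI divide_right_mono)
      fix n :: nat assume n: "n \<ge> 5"
      have "ln (\<epsilon>\<^sup>2 * b * \<mu> ^ (n - 2)) \<le> ?a n"
        using b(2)[of "n - 2"] b(1) \<epsilon> \<mu>0 n by (intro ln_mono) (auto simp: mult.assoc)
      moreover have "ln (\<epsilon>\<^sup>2 * b * \<mu> ^ (n - 2)) = ln (\<epsilon>\<^sup>2 * b) + real (n - 2) * ln \<mu>"
        using b(1) \<epsilon> \<mu>0 by (subst ln_mult_pos) (auto simp: ln_realpow)
      moreover have "real (n - 2) = real n - 2" using n by simp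
      ultimately show "ln (\<epsilon>\<^sup>2 * b) - 2 * ln \<mu> + real n * ln \<mu> \<le> ?a n"
        by (simp add: algebra_simps)
    qed simp
  qed (rule l)
  moreover have "ln lam < ln \<mu>" using \<mu> lam_pos by simp
  ultimately have pos: "l - ln lam > 0" by linarith
  have "(\<lambda>n. ?a (n + 2) / real (n + 2)) \<longlonglongrightarrow> l"
    using l by (rule LIMSEQ_ignore_initial_segment)
  moreover have "(\<lambda>n. real (n + 2) / real (Suc n)) \<longlonglongrightarrow> 1"
    using affine_div_tendsto[of 2 1] by (simp add: add.commute)
  moreover have "(\<lambda>n. ln (\<epsilon>\<^sup>2) / real (Suc n)) \<longlonglongrightarrow> 0"
    using affine_div_tendsto[of "ln (\<epsilon>\<^sup>2)" 0] by (simp only: mult_zero_right add_0_right)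
  \<comment> \<open>The pinned weight with \<open>n\<close> heights is \<open>?a (n + 2)\<close> up
    to the constant ln \<epsilon>^2 and belongs to N = Suc n, hence the quotient (n + 2)/(n +
    1).\<close>
  ultimately have "(\<lambda>n. ?a (n + 2) / real (n + 2) * (real (n + 2) / real (Suc n)) - ln (\<epsilon>\<^sup>2) / real (Suc n)
      - ln (yr n) / real (Suc n)) \<longlonglongrightarrow> l * 1 - 0 - ln lam"
    by (intro tendsto_intros ln_yr_lim)
  moreover have "\<forall>\<^sub>F n in sequentially. ?a (n + 2) / real (n + 2) * (real (n + 2) / real (Suc n)) - ln (\<epsilon>\<^sup>2) / real (Suc n)
      - ln (yr n) / real (Suc n) = free_energy_N V1 V2 \<epsilon> (Suc n)"
    using eventually_ge_at_top[of 3]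
  proof eventually_elim
    case (elim n)
    have X: "?a (n + 2) / real (n + 2) * (real (n + 2) / real (Suc n)) = ?a (n + 2) / real (Suc n)"
      by (simp del: of_nat_Suc)
    have Y: "?a (n + 2) = ln (\<epsilon>\<^sup>2) + ln (zr \<epsilon> n)"
      using \<epsilon> zpos[OF elim] by (simp add: ln_mult_pos)
    have Z: "ln (zr \<epsilon> n / yr n) = ln (zr \<epsilon> n) - ln (yr n)"
      using zpos[OF elim] ypos[OF elim] by (simp add: ln_div)
    show ?case
      unfolding X unfolding Y free_energy_N_Suc Z by (simp add: diff_divide_distrib add_divide_distrib del: of_nat_Suc)
  qed
  ultimately have "(\<lambda>n. free_energy_N V1 V2 \<epsilon> (Suc n)) \<longlonglongrightarrow> l - ln lam"
    by (simp add: tendsto_cong)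
  then have "(free_energy_N V1 V2 \<epsilon>) \<longlonglongrightarrow> l - ln lam"
    by (subst (asm) filterlim_sequentially_Suc)
  then show ?thesis using pos by blast
qed

end

theorem theorem1p1:
  fixes V1 V2 :: "real \<Rightarrow> real" and \<epsilon> :: real
  assumes V1_meas: "V1 \<in> borel_measurable borel"
    and V2_meas: "V2 \<in> borel_measurable borel"
    and C1_below: "bdd_below (range V1)"
    and C1_sym: "\<And>x. V1 x = V1 (- x)"
    and C1_lim: "filterlim V1 at_top at_infinity"
    and C1_int: "integrable lborel (\<lambda>x. exp (- 2 * V1 x))"
    and C2_below: "bdd_below (range V2)"
    and C2_loc: "\<exists>\<gamma>>0. bdd_above (V2 ` {-\<gamma>..\<gamma>})"
    and C2_int: "integrable lborel (\<lambda>x. \<bar>x\<bar> * exp (- V2 x))"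
    and eps_pos: "\<epsilon> > 0"
  shows "\<exists>F. (free_energy_N V1 V2 \<epsilon> \<longlongrightarrow> F) sequentially \<and> F > 0"
proof -
  obtain v1 v2 where v: "\<And>x. v1 \<le> V1 x" "\<And>x. v2 \<le> V2 x"
    using C1_below C2_below unfolding bdd_below_def by fast
  obtain \<gamma> G where G: "\<gamma> > 0" "\<And>x. x \<in> {-\<gamma>..\<gamma>} \<Longrightarrow> V2 x \<le> G"
    using C2_loc unfolding bdd_above_def by fast
  interpret pinning V1 V2 v1 v2 \<gamma> G
  proof
    show "V2 x \<le> G" if "\<bar>x\<bar> \<le> \<gamma>" for x
      using that by (intro G(2)) (simp add: abs_le_iff)
  qed (fact V1_meas V2_meas v C1_sym[symmetric] C1_lim G(1) C2_int)+
  show ?thesis using free_energy_pos[OF eps_pos] .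
qed

end
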